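(* Let $I\subset\mathbb{R}$ be a compact interval and let $F:I\to\mathbb{R}$ be a nonlinear smooth and strictly increasing function ($F'>0$ on $I$) such that the generalized mean functional $\mathfrak{M}_F$ is convex. Then $\mathfrak{M}_F$ admits the stochastic representation $$\mathfrak{M}_F(f)=\sup_{\alpha\in\mathcal{C}_b^n}\ \sup_{\beta\in\mathcal{C}_b^1}K_f[\alpha,\beta]$$ for every lower-semicontinuous function $f:\mathbb{R}^n\to I$, where $$K_f[\alpha,\beta]:=\mathbf{E}\bigg[e^{\frac12\int_0^1\beta_t\|\alpha_t\|^2dt}\,f\bigg(W_1+\int_0^1\alpha_t\,dt\bigg)-\frac12\int_0^1e^{\frac12\int_0^t\beta_s\|\alpha_s\|^2ds}\,R(\beta_t)\|\alpha_t\|^2\,dt\bigg]$$ with $R:=(-F'/F'')^*$.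
   Context: $\gamma_n$ is the standard Gaussian measure on $\mathbb{R}^n$. For measurable $f:\mathbb{R}^n\to I$, the generalized mean is $\mathfrak{M}_F(f):=F^{-1}\big(\int F(f)\,d\gamma_n\big)$; convexity of $\mathfrak{M}_F$ means convexity of the functional $f\mapsto\mathfrak{M}_F(f)$ on measurable functions $f:\mathbb{R}^n\to I$. Smooth on the compact interval $I$ means smooth up to the endpoints. For $F$ nonlinear with $\mathfrak{M}_F$ convex one has $F''>0$ everywhere in $I$ and $F'/F''$ concave, so that $-F'/F''$ is a well-defined convex function on $I$; $R=(-F'/F'')^*$ denotes its Fenchel transform, $R(b)=\sup_{x\in I}\{bx+F'(x)/F''(x)\}$. $(\Omega,\mathcal{F},\{\mathcal{F}_t\},\mathbf{P})$ is a probability space with a complete and right-continuous filtration, and $\{W_t\}$ is a standard $n$-dimensional $\mathcal{F}_t$-Brownian motion. $\mathcal{C}_b^k$ denotes the family of all $k$-dimensional uniformly bounded and progressively measurable processes on $[0,1]$. *)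

theory Defs
  imports "HOL-Probability.Probability"
begin

section \<open>Calculus on an interval\<close>

text \<open>Derivative relative to \<open>I\<close>, hence one-sided at the endpoints of a compact interval; it only
  depends on the values of \<open>f\<close> on \<open>I\<close>.\<close>

definition deriv_on :: "real set \<Rightarrow> (real \<Rightarrow> real) \<Rightarrow> real \<Rightarrow> real" where
  "deriv_on I f x = vector_derivative f (at x within I)"

definition smooth_on :: "real set \<Rightarrow> (real \<Rightarrow> real) \<Rightarrow> bool" where
  "smooth_on I f \<longleftrightarrow> (\<forall>k. ((deriv_on I ^^ k) f) differentiable_on I)"

definition affine_function_on :: "real set \<Rightarrow> (real \<Rightarrow> real) \<Rightarrow> bool" where
  "affine_function_on I f \<longleftrightarrow> (\<exists>c d. \<forall>x\<in>I. f x = c * x + d)"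

text \<open>The supremum is taken in \<^typ>\<open>real\<close>; it is the Fenchel transform of \<open>g\<close> (set to \<open>\<infinity>\<close> outside
  \<open>I\<close>) whenever \<open>I\<close> is nonempty and compact and \<open>g\<close> is continuous on \<open>I\<close>.\<close>

definition fenchel_transform :: "real set \<Rightarrow> (real \<Rightarrow> real) \<Rightarrow> real \<Rightarrow> real" where
  "fenchel_transform I g b = (SUP x\<in>I. b * x - g x)"

definition cost_R :: "real set \<Rightarrow> (real \<Rightarrow> real) \<Rightarrow> real \<Rightarrow> real" where
  "cost_R I F = fenchel_transform I (\<lambda>x. - (deriv_on I F x / deriv_on I (deriv_on I F) x))"

definition lower_semicontinuous :: "('a::topological_space \<Rightarrow> real) \<Rightarrow> bool" where
  "lower_semicontinuous f \<longleftrightarrow> (\<forall>x. \<forall>c<f x. \<forall>\<^sub>F y in nhds x. c < f y)"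

section \<open>Generalized Gaussian means\<close>

definition std_gaussian :: "'a::euclidean_space measure" where
  "std_gaussian =
     density lborel (\<lambda>x::'a. ennreal (exp (- (norm x)\<^sup>2 / 2) / sqrt (2 * pi) ^ DIM('a)))"

definition measurable_into :: "real set \<Rightarrow> ('a::euclidean_space \<Rightarrow> real) set" where
  "measurable_into I = {f \<in> borel_measurable borel. range f \<subseteq> I}"

definition gen_mean :: "real set \<Rightarrow> (real \<Rightarrow> real) \<Rightarrow> ('a::euclidean_space \<Rightarrow> real) \<Rightarrow> real" where
  "gen_mean I F f = inv_into I F (\<integral>x. F (f x) \<partial>std_gaussian)"

text \<open>\<^const>\<open>convex_on\<close> for functionals of real functions, a type that is not an instance of
  \<^class>\<open>real_vector\<close>.\<close>

definition convex_functional_on :: "('a \<Rightarrow> real) set \<Rightarrow> (('a \<Rightarrow> real) \<Rightarrow> real) \<Rightarrow> bool" where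
  "convex_functional_on S \<Phi> \<longleftrightarrow>
     (\<forall>f\<in>S. \<forall>g\<in>S. \<forall>u\<ge>0. \<forall>v\<ge>0. u + v = 1 \<longrightarrow>
        (\<lambda>x. u * f x + v * g x) \<in> S \<and> \<Phi> (\<lambda>x. u * f x + v * g x) \<le> u * \<Phi> f + v * \<Phi> g)"

section \<open>Brownian motion on a filtered probability space\<close>

text \<open>Time is \<open>[0,\<infinity>)\<close>: the values of processes and filtrations at negative arguments are
  unconstrained. Completeness is meant in the usual sense that already \<open>\<F>\<^sub>0\<close> contains every subset
  of a null set of \<open>M\<close>.\<close>

locale usual_filtered_prob_space = prob_space M
  for M :: "'w measure" +
  fixes Ft :: "real \<Rightarrow> 'w measure"
  assumes Ft_subalgebra: "\<And>t. 0 \<le> t \<Longrightarrow> subalgebra M (Ft t)"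
    and Ft_mono: "\<And>s t. 0 \<le> s \<Longrightarrow> s \<le> t \<Longrightarrow> sets (Ft s) \<subseteq> sets (Ft t)"
    and Ft_complete: "\<And>N A. N \<in> null_sets M \<Longrightarrow> A \<subseteq> N \<Longrightarrow> A \<in> sets (Ft 0)"
    and Ft_right_continuous: "\<And>t. 0 \<le> t \<Longrightarrow> sets (Ft t) = (\<Inter>u\<in>{t<..}. sets (Ft u))"

locale std_brownian_motion = usual_filtered_prob_space M Ft
  for M :: "'w measure" and Ft :: "real \<Rightarrow> 'w measure" +
  fixes W :: "real \<Rightarrow> 'w \<Rightarrow> 'a::euclidean_space"
  assumes W_adapted: "\<And>t. 0 \<le> t \<Longrightarrow> W t \<in> borel_measurable (Ft t)"
    and W_start: "AE \<omega> in M. W 0 \<omega> = 0"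
    and W_continuous: "AE \<omega> in M. continuous_on {0..} (\<lambda>t. W t \<omega>)"
    and W_increment_indep: "\<And>s t. 0 \<le> s \<Longrightarrow> s \<le> t \<Longrightarrow>
      indep_set (sets (Ft s)) (sets (vimage_algebra (space M) (\<lambda>\<omega>. W t \<omega> - W s \<omega>) borel))"
    and W_increment_distr: "\<And>s t. 0 \<le> s \<Longrightarrow> s \<le> t \<Longrightarrow>
      distr M borel (\<lambda>\<omega>. W t \<omega> - W s \<omega>) = distr std_gaussian borel (\<lambda>x. sqrt (t - s) *\<^sub>R x)"

section \<open>Control processes and the cost functional\<close>

definition progressively_measurable ::
  "(real \<Rightarrow> 'w measure) \<Rightarrow> (real \<Rightarrow> 'w \<Rightarrow> 'b::euclidean_space) \<Rightarrow> bool" where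
  "progressively_measurable Ft X \<longleftrightarrow>
     (\<forall>t\<in>{0..1}. (\<lambda>(s, \<omega>). X s \<omega>) \<in> borel_measurable (restrict_space borel {0..t} \<Otimes>\<^sub>M Ft t))"

definition bounded_controls ::
  "'w measure \<Rightarrow> (real \<Rightarrow> 'w measure) \<Rightarrow> (real \<Rightarrow> 'w \<Rightarrow> 'b::euclidean_space) set" where
  "bounded_controls M Ft =
     {X. progressively_measurable Ft X \<and> (\<exists>C. \<forall>t\<in>{0..1}. \<forall>\<omega>\<in>space M. norm (X t \<omega>) \<le> C)}"

definition discount ::
  "(real \<Rightarrow> 'w \<Rightarrow> 'a::euclidean_space) \<Rightarrow> (real \<Rightarrow> 'w \<Rightarrow> real) \<Rightarrow> real \<Rightarrow> 'w \<Rightarrow> real" where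
  "discount \<alpha> \<beta> t \<omega> = exp (1/2 * (LINT s:{0..t}|lborel. \<beta> s \<omega> * (norm (\<alpha> s \<omega>))\<^sup>2))"

definition K_functional ::
  "'w measure \<Rightarrow> (real \<Rightarrow> 'w \<Rightarrow> 'a::euclidean_space) \<Rightarrow> (real \<Rightarrow> real) \<Rightarrow> ('a \<Rightarrow> real) \<Rightarrow>
     (real \<Rightarrow> 'w \<Rightarrow> 'a) \<Rightarrow> (real \<Rightarrow> 'w \<Rightarrow> real) \<Rightarrow> real" where
  "K_functional M W R f \<alpha> \<beta> =
     (\<integral>\<omega>. discount \<alpha> \<beta> 1 \<omega> * f (W 1 \<omega> + (LINT t:{0..1}|lborel. \<alpha> t \<omega>))
           - 1/2 * (LINT t:{0..1}|lborel. discount \<alpha> \<beta> t \<omega> * R (\<beta> t \<omega>) * (norm (\<alpha> t \<omega>))\<^sup>2) \<partial>M)"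

end

theory Submission
  imports Defs
begin

text \<open>
  Write \<open>P\<^sub>s\<close> for the heat semigroup, \<open>G = F\<inverse>\<close> on \<open>F(I)\<close> and \<open>u(t, y) = G(P\<^bsub>1-t\<^esub>(F \<circ> f)(y))\<close>. The paper's
  Hamilton--Jacobi--Bellman argument is run in discrete time, so that no stochastic calculus is needed: for arbitrary
  bounded controls, a second-order expansion of \<open>G\<close> over a step of length \<open>\<delta>\<close> shows that, up to an error
  \<open>O(\<delta>\<^bsup>3/2\<^esup>)\<close>, the discounted process \<open>u(t, W\<^sub>t + \<integral>\<alpha>)\<close> minus the accumulated cost changes in
  expectation by a running gain. The gain is nonpositive because \<open>bx + F'(x)/F''(x) \<le> R(b)\<close>, and it vanishes for the
  step controls \<open>\<alpha> = (F''/F')(u) \<nabla>u\<close>, \<open>\<beta> = -(F'/F'')'(u)\<close> because \<open>F'/F''\<close> is concave. Summing over the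
  \<open>1/\<delta>\<close> steps and letting \<open>\<delta> \<rightarrow> 0\<close> gives both inequalities.

  The expansion only uses that \<open>P\<^sub>s(F \<circ> f)\<close> has a Lipschitz gradient, which holds for every bounded \<open>F \<circ> f\<close> and
  \<open>s > 0\<close>; therefore the terminal time is moved to \<open>1 + \<epsilon>\<close>, and \<open>f\<close> is approximated from below by the
  Lipschitz functions \<open>inf\<^sub>y (f(y) + n \<parallel>x - y\<parallel>)\<close> so that \<open>\<epsilon> \<rightarrow> 0\<close> is uniform.

  The convexity of the functional enters through functions taking two values with probability \<open>1/2\<close> each: the second
  variation of \<open>(x, y) \<mapsto> G((F(x) + F(y))/2)\<close> yields \<open>F'' > 0\<close> and the concavity of \<open>F'/F''\<close>.
\<close>

section \<open>Convex two-point means\<close>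

text \<open>No Hessian and no time derivative of the heat flow enters. Write
  \<open>v t = heat (1 + \<epsilon> - t) \<phi>\<close>. By the semigroup property,
  \<open>v t'\<close> at the point moved by the Brownian increment alone has conditional mean
  \<open>v t\<close>. This difference is therefore kept whole in the first-order term, where it
  averages to zero, and the second-order term needs only a gradient. The rest is cubic in
  \<open>sqrt \<delta> + norm w\<close>, and a third Gaussian moment bounds its mean.

  The other obstacle is uniformity. The optimal controls change with the mesh and with \<epsilon>,
  so the error constants may depend on the controls only through a bound \<open>c\<close>, and
  \<open>c\<close> must not depend on \<epsilon>. The C^{1,1} constant of \<open>v t\<close>,
  however, grows like 1/\<epsilon>. The bound \<open>c\<close> is taken instead from the Lipschitz
  constant of \<phi>, which the heat flow preserves; this is what the Lipschitz approximation of
  \<open>f\<close> is for. Since it lies below \<open>f\<close>, near-optimal controls for it serve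
  directly for \<open>f\<close>; the opposite inequality follows by dominated convergence for fixed
  controls.\<close>

lemma has_real_derivative_inverse_within:
  fixes F G :: "real \<Rightarrow> real"
  assumes F: "(F has_real_derivative d) (at x within S)" and "d \<noteq> 0" "x \<in> S"
    and GF: "\<And>z. z \<in> S \<Longrightarrow> G (F z) = z" and G: "continuous_on (F ` S) G"
  shows "(G has_real_derivative 1 / d) (at (F x) within F ` S)"
proof -
  have "(G \<longlongrightarrow> G (F x)) (at (F x) within F ` S)"
    using G \<open>x \<in> S\<close> by (auto simp: continuous_on_def)
  then have "filterlim G (at x within S) (at (F x) within F ` S)"
    using \<open>x \<in> S\<close> GF by (auto simp: filterlim_at eventually_at_filter intro!: always_eventually)
  with F have "((\<lambda>y. (F (G y) - F x) / (G y - x)) \<longlongrightarrow> d) (at (F x) within F ` S)"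
    unfolding has_field_derivative_iff by (rule filterlim_compose)
  then have "((\<lambda>y. inverse ((F (G y) - F x) / (G y - x))) \<longlongrightarrow> inverse d) (at (F x) within F ` S)"
    using \<open>d \<noteq> 0\<close> by (rule tendsto_inverse)
  then show ?thesis
    unfolding has_field_derivative_iff
    by (rule tendsto_eq_rhs[OF Lim_transform_eventually])
      (auto simp: eventually_at_filter GF \<open>x \<in> S\<close> inverse_eq_divide intro!: always_eventually)
qed

text \<open>If \<open>c < 0\<close>, then \<open>\<phi>' h < \<phi>' 0 < \<phi>' (- h)\<close> for
  small \<open>h > 0\<close>, so the symmetric sum \<psi> decreases strictly away from 0, against
  midpoint convexity. Only the value of the second derivative at 0 is involved.\<close>

lemma midpoint_convex_second_derivative_nonneg:
  fixes \<phi> \<phi>' :: "real \<Rightarrow> real"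
  assumes "e > 0" and mid: "\<And>s. \<bar>s\<bar> < e \<Longrightarrow> 2 * \<phi> 0 \<le> \<phi> s + \<phi> (- s)"
    and D: "\<And>s. \<bar>s\<bar> < e \<Longrightarrow> (\<phi> has_real_derivative \<phi>' s) (at s)"
    and D2: "(\<phi>' has_real_derivative c) (at 0)"
  shows "0 \<le> c"
proof (rule ccontr)
  assume "\<not> 0 \<le> c"
  then have "c < 0" by simp
  obtain d1 where d1: "d1 > 0" "\<And>h. 0 < h \<Longrightarrow> h < d1 \<Longrightarrow> \<phi>' h < \<phi>' 0"
    using DERIV_neg_dec_right[OF D2 \<open>c < 0\<close>] by auto
  obtain d2 where d2: "d2 > 0" "\<And>h. 0 < h \<Longrightarrow> h < d2 \<Longrightarrow> \<phi>' 0 < \<phi>' (- h)"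
    using DERIV_neg_dec_left[OF D2 \<open>c < 0\<close>] by auto
  define d where "d = min (min d1 d2) e / 2"
  have d: "0 < d" "d < d1" "d < d2" "d < e"
    using d1(1) d2(1) \<open>e > 0\<close> by (auto simp: d_def min_def)
  define \<psi> where "\<psi> s = \<phi> s + \<phi> (- s)" for s
  have D\<psi>: "(\<psi> has_real_derivative \<phi>' s - \<phi>' (- s)) (at s)" if "\<bar>s\<bar> < e" for s
    using D[of s] D[of "- s"] that unfolding \<psi>_def
    by (auto intro!: derivative_eq_intros DERIV_chain2[of \<phi>])
  have "\<psi> d < \<psi> 0"
  proof (rule DERIV_neg_imp_decreasing_open[OF \<open>0 < d\<close>])
    show "\<exists>y. (\<psi> has_real_derivative y) (at x) \<and> y < 0" if "0 < x" "x < d" for x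
      using that d d1(2)[of x] d2(2)[of x] D\<psi>[of x] by (intro exI[of _ "\<phi>' x - \<phi>' (- x)"]) auto
    show "continuous_on {0..d} \<psi>"
      using d by (intro continuous_at_imp_continuous_on ballI DERIV_isCont[OF D\<psi>]) auto
  qed
  moreover have "\<psi> 0 \<le> \<psi> d"
    using mid[of d] d by (simp add: \<psi>_def)
  ultimately show False by simp
qed

text \<open>Halving the chord towards \<open>p\<close> never decreases the rescaled increment
  \<open>2 ^ n * (S (r n) - S p)\<close>, and this increment tends to
  \<open>d * (q - p)\<close>.\<close>

lemma midpoint_concave_below_tangent:
  fixes S :: "real \<Rightarrow> real"
  assumes mid: "\<And>x y. x \<in> {A..B} \<Longrightarrow> y \<in> {A..B} \<Longrightarrow> (S x + S y) / 2 \<le> S ((x + y) / 2)"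
    and D: "(S has_real_derivative d) (at p within {A..B})"
    and "p \<in> {A..B}" "q \<in> {A..B}"
  shows "S q \<le> S p + d * (q - p)"
proof (cases "q = p")
  case False
  define r where "r n = p + (q - p) / 2 ^ n" for n :: nat
  have r: "r n \<in> {A..B}" for n
  proof -
    have "(1 - 1 / 2 ^ n) *\<^sub>R p + (1 / 2 ^ n) *\<^sub>R q \<in> {A..B}"
      using \<open>p \<in> {A..B}\<close> \<open>q \<in> {A..B}\<close> by (intro convexD_alt) auto
    then show ?thesis
      by (simp add: r_def algebra_simps diff_divide_distrib)
  qed
  have step: "S q - S p \<le> 2 ^ n * (S (r n) - S p)" for n
  proof (induction n)
    case 0
    show ?case by (simp add: r_def)
  next
    case (Suc n)
    have "(p + r n) / 2 = r (Suc n)"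
      by (simp add: r_def field_simps)
    then have "S (r n) - S p \<le> 2 * (S (r (Suc n)) - S p)"
      using mid[OF \<open>p \<in> {A..B}\<close> r[of n]] by simp
    then have "2 ^ n * (S (r n) - S p) \<le> 2 ^ n * (2 * (S (r (Suc n)) - S p))"
      by (intro mult_left_mono) auto
    with Suc show ?case by (simp only: power_Suc mult.assoc mult.left_commute)
  qed
  have "(\<lambda>n. (q - p) / 2 ^ n) \<longlonglongrightarrow> 0"
    by (rule LIMSEQ_divide_realpow_zero) simp
  then have "(\<lambda>n. p + (q - p) / 2 ^ n) \<longlonglongrightarrow> p + 0"
    by (intro tendsto_add) auto
  then have lim: "r \<longlonglongrightarrow> p"
    by (simp add: r_def[abs_def])
  have "filterlim r (at p within {A..B}) sequentially"
    using lim r False by (auto simp: filterlim_at r_def)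
  then have "(\<lambda>n. (S (r n) - S p) / (r n - p)) \<longlonglongrightarrow> d"
    using D unfolding has_field_derivative_iff by (rule filterlim_compose[rotated])
  then have "(\<lambda>n. (S (r n) - S p) / (r n - p) * (q - p)) \<longlonglongrightarrow> d * (q - p)"
    by (intro tendsto_intros)
  moreover have "(S (r n) - S p) / (r n - p) * (q - p) = 2 ^ n * (S (r n) - S p)" for n
    using False by (simp add: r_def field_simps)
  ultimately have "(\<lambda>n. 2 ^ n * (S (r n) - S p)) \<longlonglongrightarrow> d * (q - p)" by simp
  then have "S q - S p \<le> d * (q - p)"
    by (rule LIMSEQ_le_const) (auto intro: step)
  then show ?thesis by simp
qed simp

text \<open>Two mean value inequalities on the segment from \<open>v\<close> to \<open>x\<close>,
  first for the remainder of \<open>G1\<close> and then for that of \<open>G\<close>. Each bounds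
  its integrand by the endpoint value, hence \<open>L\<close> in place of
  \<open>L / 6\<close>.\<close>

lemma taylor_second_order_bound:
  fixes G G1 G2 :: "real \<Rightarrow> real"
  assumes D0: "\<And>v. v \<in> {A..B} \<Longrightarrow> (G has_real_derivative G1 v) (at v within {A..B})"
    and D1: "\<And>v. v \<in> {A..B} \<Longrightarrow> (G1 has_real_derivative G2 v) (at v within {A..B})"
    and lip: "\<And>v w. v \<in> {A..B} \<Longrightarrow> w \<in> {A..B} \<Longrightarrow> \<bar>G2 v - G2 w\<bar> \<le> L * \<bar>v - w\<bar>"
    and v: "v \<in> {A..B}" and x: "x \<in> {A..B}"
  shows "\<bar>G x - G v - G1 v * (x - v) - G2 v / 2 * (x - v)\<^sup>2\<bar> \<le> L * \<bar>x - v\<bar> ^ 3"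
proof -
  define T where "T = closed_segment v x"
  have T: "T \<subseteq> {A..B}" "v \<in> T" "x \<in> T" "convex T"
    using v x by (auto simp: T_def closed_segment_eq_real_ivl)
  have Tdist: "\<bar>w - v\<bar> \<le> \<bar>x - v\<bar>" if "w \<in> T" for w
    using that by (auto simp: T_def closed_segment_eq_real_ivl split: if_splits)
  have L0: "0 \<le> L" if "x \<noteq> v"
  proof -
    have "0 \<le> L * \<bar>v - x\<bar>"
      using lip[OF v x] by (rule order_trans[OF abs_ge_zero])
    with that show ?thesis by (simp add: zero_le_mult_iff)
  qed
  show ?thesis
  proof (cases "x = v")
    case False
    have r1: "\<bar>G1 w - G1 v - G2 v * (w - v)\<bar> \<le> L * \<bar>x - v\<bar>\<^sup>2" if "w \<in> T" for w
    proof -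
      have "norm ((\<lambda>w. G1 w - G1 v - G2 v * (w - v)) w - (\<lambda>w. G1 w - G1 v - G2 v * (w - v)) v)
          \<le> (L * \<bar>x - v\<bar>) * norm (w - v)"
      proof (rule field_differentiable_bound[OF \<open>convex T\<close>])
        fix z assume "z \<in> T"
        then show "((\<lambda>w. G1 w - G1 v - G2 v * (w - v)) has_real_derivative G2 z - G2 v) (at z within T)"
          using T by (auto intro!: derivative_eq_intros DERIV_subset[OF D1])
        have "\<bar>G2 z - G2 v\<bar> \<le> L * \<bar>z - v\<bar>"
          using lip[of z v] \<open>z \<in> T\<close> T v by auto
        also have "\<dots> \<le> L * \<bar>x - v\<bar>"
          using Tdist[OF \<open>z \<in> T\<close>] L0 False by (intro mult_left_mono) auto
        finally show "norm (G2 z - G2 v) \<le> L * \<bar>x - v\<bar>" by simp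
      qed (use T that in auto)
      also have "\<dots> \<le> (L * \<bar>x - v\<bar>) * \<bar>x - v\<bar>"
        using Tdist[OF that] L0 False by (intro mult_left_mono) auto
      finally show ?thesis by (simp add: power2_eq_square mult.assoc)
    qed
    let ?r = "\<lambda>x. G x - G v - G1 v * (x - v) - G2 v / 2 * (x - v)\<^sup>2"
    have "norm (?r x - ?r v) \<le> (L * \<bar>x - v\<bar>\<^sup>2) * norm (x - v)"
    proof (rule field_differentiable_bound[OF \<open>convex T\<close>])
      fix z assume "z \<in> T"
      then show "(?r has_real_derivative G1 z - G1 v - G2 v * (z - v)) (at z within T)"
        using T by (auto intro!: derivative_eq_intros DERIV_subset[OF D0])
      show "norm (G1 z - G1 v - G2 v * (z - v)) \<le> L * \<bar>x - v\<bar>\<^sup>2"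
        using r1[OF \<open>z \<in> T\<close>] by simp
    qed (use T in auto)
    then show ?thesis by (simp add: power3_eq_cube power2_eq_square mult.assoc)
  qed simp
qed

section \<open>The inverse of a smooth increasing function on a compact interval\<close>

locale smooth_increasing =
  fixes a b :: real and F F1 F2 F3 :: "real \<Rightarrow> real"
  assumes ab: "a < b"
    and D0: "\<And>x. x \<in> {a..b} \<Longrightarrow> (F has_real_derivative F1 x) (at x within {a..b})"
    and D1: "\<And>x. x \<in> {a..b} \<Longrightarrow> (F1 has_real_derivative F2 x) (at x within {a..b})"
    and D2: "\<And>x. x \<in> {a..b} \<Longrightarrow> (F2 has_real_derivative F3 x) (at x within {a..b})"
    and cont3: "continuous_on {a..b} F3"
    and F1_pos: "\<And>x. x \<in> {a..b} \<Longrightarrow> 0 < F1 x"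
begin

definition G :: "real \<Rightarrow> real" where "G = inv_into {a..b} F"

lemma cont0: "continuous_on {a..b} F" and cont1: "continuous_on {a..b} F1"
  and cont2: "continuous_on {a..b} F2"
  using D0 D1 D2 DERIV_continuous_on by blast+

lemma F_less: "F x < F y" if "x \<in> {a..b}" "y \<in> {a..b}" "x < y"
proof (rule DERIV_pos_imp_increasing_open[OF \<open>x < y\<close>])
  show "\<exists>d. (F has_real_derivative d) (at z) \<and> 0 < d" if "x < z" "z < y" for z
    using D0[of z] F1_pos[of z] that \<open>x \<in> {a..b}\<close> \<open>y \<in> {a..b}\<close> at_within_Icc_at[of a z b] by auto
  show "continuous_on {x..y} F"
    using that by (intro continuous_on_subset[OF cont0]) auto
qed

lemma F_inj: "inj_on F {a..b}"
  using F_less by (intro linorder_inj_onI) (auto simp: order_less_imp_not_eq)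

lemma F_mono: "F x \<le> F y" if "x \<in> {a..b}" "y \<in> {a..b}" "x \<le> y"
  using F_less[OF that(1,2)] that(3) by (cases "x = y") auto

lemma F_image: "F ` {a..b} = {F a..F b}"
proof
  show "F ` {a..b} \<subseteq> {F a..F b}"
    using F_mono by auto
  show "{F a..F b} \<subseteq> F ` {a..b}"
  proof
    fix y assume "y \<in> {F a..F b}"
    then obtain x where "a \<le> x" "x \<le> b" "F x = y"
      using IVT'[of F a y b] cont0 ab by auto
    then show "y \<in> F ` {a..b}" by auto
  qed
qed

lemma GF: "x \<in> {a..b} \<Longrightarrow> G (F x) = x"
  unfolding G_def by (rule inv_into_f_f[OF F_inj])

lemma FG: "v \<in> {F a..F b} \<Longrightarrow> F (G v) = v"
  unfolding G_def by (rule f_inv_into_f) (simp add: F_image)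

lemma G_in: "v \<in> {F a..F b} \<Longrightarrow> G v \<in> {a..b}"
  unfolding G_def by (rule inv_into_into) (simp add: F_image)

lemma G_cont: "continuous_on {F a..F b} G"
  using continuous_on_inv[OF cont0 _ ballI[OF GF]] by (simp add: F_image)

lemma G_less_iff: "v \<in> {F a..F b} \<Longrightarrow> w \<in> {F a..F b} \<Longrightarrow> G v < G w \<longleftrightarrow> v < w"
  using F_less[of "G v" "G w"] F_mono[of "G w" "G v"] FG[of v] FG[of w] G_in[of v] G_in[of w]
  by linarith

lemma DG: "(G has_real_derivative 1 / F1 (G v)) (at v within {F a..F b})" if "v \<in> {F a..F b}"
  using has_real_derivative_inverse_within[OF D0[OF G_in[OF that]], of G] F1_pos[OF G_in[OF that]]
    GF G_cont G_in[OF that] by (simp add: F_image FG[OF that])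

lemma F_mid: "(F x + F y) / 2 \<in> {F a..F b}" if "x \<in> {a..b}" "y \<in> {a..b}"
  using that F_mono[of a x] F_mono[of a y] F_mono[of x b] F_mono[of y b] ab
  by auto

lemma G_less_iff': "G v \<in> {a<..<b} \<longleftrightarrow> v \<in> {F a<..<F b}" if "v \<in> {F a..F b}"
  using G_less_iff[of "F a" v] G_less_iff[of v "F b"] that GF[of a] GF[of b] ab F_mono[of a b] by auto

lemma D_open: assumes "x \<in> {a<..<b}"
  shows "(F has_real_derivative F1 x) (at x)" "(F1 has_real_derivative F2 x) (at x)"
  using D0[of x] D1[of x] assms at_within_Icc_at[of a x b] by auto

lemma DG_open: "(G has_real_derivative 1 / F1 (G v)) (at v)" if "v \<in> {F a<..<F b}"
  using DG[of v] that at_within_Icc_at[of "F a" v "F b"] by auto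

end

section \<open>Second variation of the two-point mean\<close>

locale convex_two_point_mean = smooth_increasing +
  assumes mean_mid: "\<And>x x' y y'. x \<in> {a..b} \<Longrightarrow> x' \<in> {a..b} \<Longrightarrow> y \<in> {a..b} \<Longrightarrow> y' \<in> {a..b} \<Longrightarrow>
      2 * G ((F ((x + x') / 2) + F ((y + y') / 2)) / 2) \<le> G ((F x + F y) / 2) + G ((F x' + F y') / 2)"
    and nonaffine: "\<not> affine_function_on {a..b} F"
begin

text \<open>Along the line \<open>s \<mapsto> (x + s * \<xi>, y + s * \<eta>)\<close> the mean
  \<phi> is midpoint convex. Since \<open>\<phi>' = w' / F1 \<phi>\<close>, its second derivative at
  0 is a quotient with denominator \<open>(F1 m)\<^sup>2\<close>; nonnegativity of the numerator is
  the claim.\<close>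

lemma second_variation_open:
  assumes x: "x \<in> {a<..<b}" and y: "y \<in> {a<..<b}"
  defines "m \<equiv> G ((F x + F y) / 2)"
  shows "F2 m * (F1 x * \<xi> + F1 y * \<eta>)\<^sup>2 \<le> 2 * (F1 m)\<^sup>2 * (F2 x * \<xi>\<^sup>2 + F2 y * \<eta>\<^sup>2)"
proof -
  define r where "r = min (min (x - a) (b - x)) (min (y - a) (b - y))"
  \<comment> \<open>For \<open>\<bar>s\<bar> < e\<close> both moving points stay in the open
    interval; the summand 1 keeps the denominator positive.\<close>
  define e where "e = r / (1 + \<bar>\<xi>\<bar> + \<bar>\<eta>\<bar>)"
  have "r > 0" using x y by (auto simp: r_def)
  then have "e > 0" by (simp add: e_def)
  have s: "x + s * \<xi> \<in> {a<..<b}" "y + s * \<eta> \<in> {a<..<b}" if "\<bar>s\<bar> < e" for s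
  proof -
    have "\<bar>s\<bar> * (1 + \<bar>\<xi>\<bar> + \<bar>\<eta>\<bar>) < r"
      using that by (simp add: e_def field_simps)
    moreover have "\<bar>s * \<xi>\<bar> \<le> \<bar>s\<bar> * (1 + \<bar>\<xi>\<bar> + \<bar>\<eta>\<bar>)" "\<bar>s * \<eta>\<bar> \<le> \<bar>s\<bar> * (1 + \<bar>\<xi>\<bar> + \<bar>\<eta>\<bar>)"
      by (auto simp: abs_mult intro!: mult_left_mono)
    ultimately have "\<bar>s * \<xi>\<bar> < r" "\<bar>s * \<eta>\<bar> < r" by auto
    then show "x + s * \<xi> \<in> {a<..<b}" "y + s * \<eta> \<in> {a<..<b}"
      by (auto simp: r_def abs_less_iff)
  qed
  define w where "w s = (F (x + s * \<xi>) + F (y + s * \<eta>)) / 2" for s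
  define w' where "w' s = (F1 (x + s * \<xi>) * \<xi> + F1 (y + s * \<eta>) * \<eta>) / 2" for s
  have w_in: "w s \<in> {F a<..<F b}" if "\<bar>s\<bar> < e" for s
    using s[OF that] F_less[of a "x + s * \<xi>"] F_less[of a "y + s * \<eta>"]
      F_less[of "x + s * \<xi>" b] F_less[of "y + s * \<eta>" b] ab by (auto simp: w_def)
  have lin: "((\<lambda>s. z + s * \<zeta>) has_real_derivative \<zeta>) (at s)" for z \<zeta> s :: real
    by (auto intro!: derivative_eq_intros)
  have Dw: "(w has_real_derivative w' s) (at s)" if "\<bar>s\<bar> < e" for s
    unfolding w_def w'_def
    by (intro DERIV_cdivide DERIV_add DERIV_chain2[OF D_open(1) lin] s that)
  have "(w' has_real_derivative (F2 (x + 0 * \<xi>) * \<xi> * \<xi> + F2 (y + 0 * \<eta>) * \<eta> * \<eta>) / 2) (at 0)"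
    unfolding w'_def
    by (intro DERIV_cdivide DERIV_add DERIV_cmult_right DERIV_chain2[OF D_open(2) lin] s) (simp_all add: \<open>e > 0\<close>)
  then have Dw': "(w' has_real_derivative (F2 x * \<xi>\<^sup>2 + F2 y * \<eta>\<^sup>2) / 2) (at 0)"
    by (simp add: power2_eq_square mult.assoc)
  define \<phi> where "\<phi> s = G (w s)" for s
  have D\<phi>: "(\<phi> has_real_derivative w' s / F1 (\<phi> s)) (at s)" if "\<bar>s\<bar> < e" for s
    unfolding \<phi>_def using DERIV_chain2[OF DG_open[OF w_in[OF that]] Dw[OF that]] by simp
  have m: "\<phi> 0 = m" "w 0 \<in> {F a<..<F b}" "m \<in> {a<..<b}"
    using w_in[of 0] \<open>e > 0\<close> G_less_iff'[of "w 0"] by (auto simp: \<phi>_def m_def w_def)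
  have m_pos: "F1 m > 0" using m F1_pos[of m] by auto
  have "0 \<le> ((F2 x * \<xi>\<^sup>2 + F2 y * \<eta>\<^sup>2) / 2 * F1 m - w' 0 * (F2 m * (w' 0 / F1 m))) / (F1 m * F1 m)"
  proof (rule midpoint_convex_second_derivative_nonneg[OF \<open>e > 0\<close> _ D\<phi>])
    fix s assume "\<bar>s\<bar> < e"
    then show "2 * \<phi> 0 \<le> \<phi> s + \<phi> (- s)"
      using mean_mid[of "x + s * \<xi>" "x - s * \<xi>" "y + s * \<eta>" "y - s * \<eta>"] s[of s] s[of "- s"]
      by (auto simp: \<phi>_def w_def)
  next
    have "(\<phi> has_real_derivative w' 0 / F1 m) (at 0)"
      using D\<phi>[of 0] \<open>e > 0\<close> m by simp
    then have "((\<lambda>s. F1 (\<phi> s)) has_real_derivative F2 m * (w' 0 / F1 m)) (at 0)"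
      using m D_open(2)[of m] by (intro DERIV_chain2[of F1]) auto
    from DERIV_divide[OF Dw' this] show "((\<lambda>s. w' s / F1 (\<phi> s)) has_real_derivative
        ((F2 x * \<xi>\<^sup>2 + F2 y * \<eta>\<^sup>2) / 2 * F1 m - w' 0 * (F2 m * (w' 0 / F1 m))) / (F1 m * F1 m)) (at 0)"
      using m m_pos by simp
  qed
  then have "0 \<le> (F2 x * \<xi>\<^sup>2 + F2 y * \<eta>\<^sup>2) / 2 * F1 m - w' 0 * (F2 m * (w' 0 / F1 m))"
    using pos_le_divide_eq[OF mult_pos_pos[OF m_pos m_pos], of 0] by simp
  then have "F2 m * (w' 0)\<^sup>2 \<le> (F1 m)\<^sup>2 * ((F2 x * \<xi>\<^sup>2 + F2 y * \<eta>\<^sup>2) / 2)"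
    using m_pos by (simp add: field_simps power2_eq_square)
  then show ?thesis
    by (simp add: w'_def power_divide field_simps)
qed

lemma second_variation:
  assumes x: "x \<in> {a..b}" and y: "y \<in> {a..b}"
  defines "m \<equiv> G ((F x + F y) / 2)"
  shows "F2 m * (F1 x * \<xi> + F1 y * \<eta>)\<^sup>2 \<le> 2 * (F1 m)\<^sup>2 * (F2 x * \<xi>\<^sup>2 + F2 y * \<eta>\<^sup>2)"
proof -
  define c where "c = (a + b) / 2"
  \<comment> \<open>The endpoints are reached by continuity: points are pulled towards the centre
    \<open>c\<close> with a weight that is strictly between 0 and 1 from \<open>n = 0\<close>
    on.\<close>
  define t :: "nat \<Rightarrow> real" where "t n = 1 / (n + 2)" for n
  have t: "0 < t n" "t n < 1" for n by (auto simp: t_def)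
  have t0: "t \<longlonglongrightarrow> 0"
    unfolding t_def using LIMSEQ_ignore_initial_segment[OF lim_1_over_n, of 2] by (simp add: add.commute)
  define p where "p z n = z + t n * (c - z)" for z n
  have p_lim: "p z \<longlonglongrightarrow> z" for z
    unfolding p_def by (rule tendsto_eq_intros tendsto_intros t0 | simp)+
  have p_in: "p z n \<in> {a<..<b}" if "z \<in> {a..b}" for z n
  proof -
    have *: "p z n - a = (1 - t n) * (z - a) + t n * (c - a)" "b - p z n = (1 - t n) * (b - z) + t n * (b - c)"
      by (simp_all add: p_def algebra_simps)
    have "0 < p z n - a" "0 < b - p z n"
      unfolding * using that t[of n] ab by (auto intro!: add_nonneg_pos mult_nonneg_nonneg mult_pos_pos simp: c_def)
    then show ?thesis by auto
  qed
  have lim: "(\<lambda>n. h (p z n)) \<longlonglongrightarrow> h z" if "continuous_on {a..b} h" "z \<in> {a..b}" for h :: "real \<Rightarrow> real" and z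
    using p_in[OF that(2)] that(2)
    by (intro continuous_on_tendsto_compose[OF that(1) p_lim]) (auto intro!: always_eventually less_imp_le)
  let ?m = "\<lambda>n. G ((F (p x n) + F (p y n)) / 2)"
  have m_in: "m \<in> {a..b}" "?m n \<in> {a..b}" for n
    using F_mid[OF x y] F_mid[of "p x n" "p y n"] p_in[OF x, of n] p_in[OF y, of n] G_in
    by (auto simp: m_def less_imp_le)
  have m_lim: "?m \<longlonglongrightarrow> m"
    unfolding m_def
  proof (rule continuous_on_tendsto_compose[OF G_cont])
    show "(\<lambda>n. (F (p x n) + F (p y n)) / 2) \<longlonglongrightarrow> (F x + F y) / 2"
      by (intro tendsto_intros lim cont0 x y) simp
    show "\<forall>\<^sub>F n in sequentially. (F (p x n) + F (p y n)) / 2 \<in> {F a..F b}"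
      using p_in x y by (intro always_eventually allI F_mid) (auto simp: less_imp_le)
  qed (rule F_mid[OF x y])
  have lim_m: "(\<lambda>n. h (?m n)) \<longlonglongrightarrow> h m" if "continuous_on {a..b} h" for h :: "real \<Rightarrow> real"
    using m_in by (intro continuous_on_tendsto_compose[OF that m_lim]) auto
  show ?thesis
  proof (rule LIMSEQ_le)
    show "(\<lambda>n. F2 (?m n) * (F1 (p x n) * \<xi> + F1 (p y n) * \<eta>)\<^sup>2) \<longlonglongrightarrow> F2 m * (F1 x * \<xi> + F1 y * \<eta>)\<^sup>2"
      by (intro tendsto_intros lim lim_m cont1 cont2 x y)
    show "(\<lambda>n. 2 * (F1 (?m n))\<^sup>2 * (F2 (p x n) * \<xi>\<^sup>2 + F2 (p y n) * \<eta>\<^sup>2))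
        \<longlonglongrightarrow> 2 * (F1 m)\<^sup>2 * (F2 x * \<xi>\<^sup>2 + F2 y * \<eta>\<^sup>2)"
      by (intro tendsto_intros lim lim_m cont1 cont2 x y)
    show "\<exists>N. \<forall>n\<ge>N. F2 (?m n) * (F1 (p x n) * \<xi> + F1 (p y n) * \<eta>)\<^sup>2
        \<le> 2 * (F1 (?m n))\<^sup>2 * (F2 (p x n) * \<xi>\<^sup>2 + F2 (p y n) * \<eta>\<^sup>2)"
      using second_variation_open p_in x y by blast
  qed
qed

text \<open>By the second variation with \<open>\<eta> = 0\<close>, the zero set of \<open>F'' \<circ> G\<close> contains the midpoint of each of its points
  and any point of \<open>F(I)\<close>. If it is nonempty, repeated halving makes it dense, and \<open>F\<close> is affine.\<close>

lemma F2_pos: assumes "x \<in> {a..b}" shows "0 < F2 x"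
proof -
  have nonneg: "0 \<le> F2 z" if "z \<in> {a..b}" for z
  proof -
    \<comment> \<open>For \<open>x = y = z\<close> the directions 1 and -1 cancel on the left-hand
      side of the second variation.\<close>
    have "0 \<le> 2 * (F1 z)\<^sup>2 * (F2 z * 2)"
      using second_variation[OF that that, of 1 "- 1"] GF[OF that] by simp
    then show ?thesis using F1_pos[OF that] by (simp add: zero_le_mult_iff)
  qed
  have zero: "F2 (G ((F x + F y) / 2)) = 0" if "x \<in> {a..b}" "F2 x = 0" "y \<in> {a..b}" for x y
  proof -
    have "F2 (G ((F x + F y) / 2)) * (F1 x)\<^sup>2 \<le> 0"
      using second_variation[OF that(1,3), of 1 0] that(2) by simp
    then show ?thesis
      using F1_pos[OF that(1)] nonneg[OF G_in[OF F_mid[OF that(1,3)]]] by (simp add: mult_le_0_iff)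
  qed
  have "F2 x \<noteq> 0"
  proof
    assume "F2 x = 0"
    have all0: "F2 z = 0" if z: "z \<in> {a..b}" for z
    proof -
      define c where "c n = F z + (F x - F z) / 2 ^ n" for n :: nat
      have c: "c n \<in> {F a..F b} \<and> F2 (G (c n)) = 0" for n
      proof (induction n)
        case 0
        then show ?case using assms \<open>F2 x = 0\<close> GF[OF assms] F_image by (auto simp: c_def)
      next
        case (Suc n)
        have "(F (G (c n)) + F z) / 2 = c (Suc n)"
          using Suc FG[of "c n"] by (simp add: c_def field_simps)
        then show ?case
          using zero[of "G (c n)" z] F_mid[of "G (c n)" z] Suc G_in[of "c n"] z by simp
      qed
      have "(\<lambda>n. (F x - F z) / 2 ^ n) \<longlonglongrightarrow> 0"
        by (rule LIMSEQ_divide_realpow_zero) simp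
      then have "c \<longlonglongrightarrow> F z + 0"
        unfolding c_def by (intro tendsto_add) auto
      then have "(\<lambda>n. F2 (G (c n))) \<longlonglongrightarrow> F2 (G (F z))"
        using c z F_image
        by (intro continuous_on_tendsto_compose[OF continuous_on_compose2[OF cont2 G_cont]])
          (auto intro: G_in)
      then show ?thesis
        using c GF[OF z] by (simp add: LIMSEQ_const_iff)
    qed
    have "\<exists>c. \<forall>z\<in>{a..b}. F1 z = c"
      using D1 all0 by (intro has_field_derivative_zero_constant) auto
    then obtain c where c: "\<And>z. z \<in> {a..b} \<Longrightarrow> F1 z = c" by blast
    have "\<exists>d. \<forall>z\<in>{a..b}. F z - c * z = d"
      using D0 c by (intro has_field_derivative_zero_constant) (auto intro!: derivative_eq_intros)
    then obtain d where "\<And>z. z \<in> {a..b} \<Longrightarrow> F z - c * z = d" by blast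
    then have "\<forall>z\<in>{a..b}. F z = c * z + d" by (simp add: algebra_simps)
    then show False using nonaffine unfolding affine_function_on_def by blast
  qed
  then show ?thesis using nonneg[OF assms] by simp
qed

definition k :: "real \<Rightarrow> real" where "k x = F1 x / F2 x"
definition k' :: "real \<Rightarrow> real" where "k' x = 1 - F1 x * F3 x / (F2 x)\<^sup>2"

lemma Dk: "(k has_real_derivative k' x) (at x within {a..b})" if "x \<in> {a..b}"
  unfolding k_def[abs_def] k'_def using F2_pos[OF that] that
  by (auto intro!: derivative_eq_intros D1 D2 simp: field_simps power2_eq_square)

lemma k_pos: "x \<in> {a..b} \<Longrightarrow> 0 < k x"
  unfolding k_def using F1_pos F2_pos by simp

lemma k'_cont: "continuous_on {a..b} k'"
  unfolding k'_def[abs_def] using F2_pos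
  by (intro continuous_intros cont1 cont2 cont3) (auto simp: less_imp_neq[symmetric])

text \<open>The choice \<open>\<xi> = k x\<close>, \<open>\<eta> = k y\<close> in the second variation says that \<open>S = (F' k) \<circ> G\<close> is midpoint concave, and
  \<open>S' = 1 + k' \<circ> G\<close>.\<close>

lemma k'_antimono: assumes x: "x \<in> {a..b}" and u: "u \<in> {a..b}" and "u \<le> x" shows "k' x \<le> k' u"
proof (cases "x = u")
  case False
  define S where "S v = F1 (G v) * k (G v)" for v
  have mid: "(S v + S w) / 2 \<le> S ((v + w) / 2)" if v: "v \<in> {F a..F b}" and w: "w \<in> {F a..F b}" for v w
  proof -
    define m where "m = G ((v + w) / 2)"
    have in_I: "G v \<in> {a..b}" "G w \<in> {a..b}" "m \<in> {a..b}"
      using G_in v w unfolding m_def by auto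
    \<comment> \<open>With \<open>\<xi> = k x\<close> both \<open>F1 x * \<xi>\<close> and
      \<open>F2 x * \<xi>\<^sup>2\<close> equal \<open>F1 x * k x\<close>, so the same positive sum
      stands squared on the left and once on the right and can be cancelled.\<close>
    have "F2 m * (S v + S w)\<^sup>2 \<le> 2 * (F1 m)\<^sup>2 * (S v + S w)"
      using second_variation[OF in_I(1,2), of "k (G v)" "k (G w)"] F2_pos[OF in_I(1)] F2_pos[OF in_I(2)]
      by (simp add: FG[OF v] FG[OF w] m_def S_def k_def power2_eq_square)
    moreover have "0 < S v + S w"
      using F1_pos[OF in_I(1)] F1_pos[OF in_I(2)] k_pos[OF in_I(1)] k_pos[OF in_I(2)]
      by (auto simp: S_def intro!: add_pos_pos)
    ultimately have "F2 m * (S v + S w) \<le> 2 * (F1 m)\<^sup>2"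
      by (simp add: power2_eq_square)
    then show ?thesis
      using F2_pos[OF in_I(3)] unfolding S_def k_def m_def[symmetric] by (simp add: field_simps power2_eq_square)
  qed
  have DS: "(S has_real_derivative 1 + k' (G v)) (at v within {F a..F b})" if v: "v \<in> {F a..F b}" for v
  proof -
    have "G v \<in> {a..b}" using G_in v .
    have img: "G ` {F a..F b} \<subseteq> {a..b}" using G_in by auto
    have "((\<lambda>x. F1 x * k x) has_real_derivative F2 (G v) * k (G v) + k' (G v) * F1 (G v)) (at (G v) within {a..b})"
      using DERIV_mult[OF D1 Dk] \<open>G v \<in> {a..b}\<close> by simp
    then have "((\<lambda>x. F1 x * k x) has_real_derivative F2 (G v) * k (G v) + k' (G v) * F1 (G v))
        (at (G v) within G ` {F a..F b})"
      by (rule DERIV_subset[OF _ img])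
    from DERIV_image_chain[OF this DG[OF v]]
    have "(S has_real_derivative (F2 (G v) * k (G v) + k' (G v) * F1 (G v)) * (1 / F1 (G v))) (at v within {F a..F b})"
      by (simp add: o_def S_def[abs_def])
    moreover have "(F2 (G v) * k (G v) + k' (G v) * F1 (G v)) * (1 / F1 (G v)) = 1 + k' (G v)"
      using F1_pos[OF \<open>G v \<in> {a..b}\<close>] F2_pos[OF \<open>G v \<in> {a..b}\<close>] by (simp add: k_def field_simps)
    ultimately show ?thesis by simp
  qed
  have Fx: "F x \<in> {F a..F b}" and Fu: "F u \<in> {F a..F b}"
    using x u F_image by auto
  \<comment> \<open>Adding the tangent inequalities of \<open>S\<close> at \<open>F u\<close> and at
    \<open>F x\<close> compares the two slopes.\<close>
  have "S (F x) \<le> S (F u) + (1 + k' u) * (F x - F u)"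
    using midpoint_concave_below_tangent[OF mid DS[OF Fu] Fu Fx] GF[OF u] by simp
  moreover have "S (F u) \<le> S (F x) + (1 + k' x) * (F u - F x)"
    using midpoint_concave_below_tangent[OF mid DS[OF Fx] Fx Fu] GF[OF x] by simp
  ultimately have "0 \<le> (k' u - k' x) * (F x - F u)"
    by (simp add: algebra_simps)
  moreover have "F u < F x" using F_less[OF u x] False \<open>u \<le> x\<close> by simp
  ultimately show ?thesis by (simp add: zero_le_mult_iff)
qed simp

text \<open>The global form of concavity that identifies the maximizer in the Fenchel transform, see
  \<open>R_eq\<close>.\<close>

lemma k_below_tangent: assumes x: "x \<in> {a..b}" and u: "u \<in> {a..b}"
  shows "k x \<le> k u + k' u * (x - u)"
proof -
  have mvt: "\<exists>z\<in>{p<..<q}. k q - k p = k' z * (q - p)" if "p \<in> {a..b}" "q \<in> {a..b}" "p < q" for p q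
  proof (rule mvt_simple[OF \<open>p < q\<close>])
    show "(k has_derivative (*) (k' z)) (at z within {p..q})" if "p \<le> z" "z \<le> q" for z
      using that \<open>p \<in> {a..b}\<close> \<open>q \<in> {a..b}\<close>
      by (intro has_field_derivative_imp_has_derivative DERIV_subset[OF Dk]) auto
  qed
  consider "x = u" | "u < x" | "x < u" by linarith
  then show ?thesis
  proof cases
    case 2
    then obtain z where z: "z \<in> {u<..<x}" "k x - k u = k' z * (x - u)"
      using mvt[OF u x] by blast
    have "k' z * (x - u) \<le> k' u * (x - u)"
      using z x u by (intro mult_right_mono k'_antimono) auto
    with z show ?thesis by linarith
  next
    case 3
    then obtain z where z: "z \<in> {x<..<u}" "k u - k x = k' z * (u - x)"
      using mvt[OF x u] by blast
    have "k' u * (u - x) \<le> k' z * (u - x)"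
      using z x u by (intro mult_right_mono k'_antimono) auto
    with z show ?thesis by (simp add: right_diff_distrib)
  qed simp
qed

section \<open>Derivatives of the inverse and the Fenchel transform\<close>

definition G1 :: "real \<Rightarrow> real" where "G1 v = 1 / F1 (G v)"
definition G2 :: "real \<Rightarrow> real" where "G2 v = - F2 (G v) / (F1 (G v)) ^ 3"

lemma G1_cont: "continuous_on {F a..F b} G1" and G2_cont: "continuous_on {F a..F b} G2"
  unfolding G1_def[abs_def] G2_def[abs_def] using F1_pos[OF G_in]
  by (auto intro!: continuous_intros continuous_on_compose2[OF cont1 G_cont]
      continuous_on_compose2[OF cont2 G_cont] G_in simp: less_imp_neq[symmetric])

lemma G1_pos: "v \<in> {F a..F b} \<Longrightarrow> 0 < G1 v" and G2_neg: "v \<in> {F a..F b} \<Longrightarrow> G2 v < 0"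
  unfolding G1_def G2_def using F1_pos[OF G_in] F2_pos[OF G_in] by auto

text \<open>Expresses the cost through \<open>G\<close> alone. In this form the term is what
  completing the square in the control leaves behind.\<close>

lemma k_G: "k (G v) = (G1 v)\<^sup>2 / (- G2 v)" if "v \<in> {F a..F b}"
  using F1_pos[OF G_in[OF that]] F2_pos[OF G_in[OF that]]
  by (simp add: k_def G1_def G2_def field_simps power2_eq_square power3_eq_cube)

lemma DG1: "(G1 has_real_derivative G2 v) (at v within {F a..F b})" if v: "v \<in> {F a..F b}"
proof -
  have img: "G ` {F a..F b} \<subseteq> {a..b}" using G_in by auto
  have "((\<lambda>x. 1 / F1 x) has_real_derivative - F2 (G v) / (F1 (G v))\<^sup>2) (at (G v) within {a..b})"
    using D1[OF G_in[OF v]] F1_pos[OF G_in[OF v]]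
    by (auto intro!: derivative_eq_intros simp: power2_eq_square)
  from DERIV_image_chain[OF DERIV_subset[OF this img] DG[OF v]] show ?thesis
    by (simp add: o_def G1_def[abs_def] G2_def power2_eq_square power3_eq_cube mult.assoc)
qed

lemma G2_lipschitz:
  obtains L where "\<And>v w. v \<in> {F a..F b} \<Longrightarrow> w \<in> {F a..F b} \<Longrightarrow> \<bar>G2 v - G2 w\<bar> \<le> L * \<bar>v - w\<bar>"
proof -
  \<comment> \<open>\<open>h (G v)\<close> is the third derivative of \<open>G\<close>: the quotient
    rule for \<open>- F2 / F1 ^ 3\<close>, times \<open>G1 = 1 / F1\<close>.\<close>
  define h where "h x = (- F3 x * F1 x ^ 3 + F2 x * (3 * F1 x ^ 2 * F2 x)) / (F1 x ^ 3 * F1 x ^ 3) * (1 / F1 x)" for x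
  have img: "G ` {F a..F b} \<subseteq> {a..b}" using G_in by auto
  have D: "(G2 has_real_derivative h (G v)) (at v within {F a..F b})" if v: "v \<in> {F a..F b}" for v
  proof -
    have "((\<lambda>x. - F2 x / F1 x ^ 3) has_real_derivative
        (- F3 (G v) * F1 (G v) ^ 3 + F2 (G v) * (3 * F1 (G v) ^ 2 * F2 (G v))) / (F1 (G v) ^ 3 * F1 (G v) ^ 3))
        (at (G v) within {a..b})"
      using D1[OF G_in[OF v]] D2[OF G_in[OF v]] F1_pos[OF G_in[OF v]]
      by (auto intro!: derivative_eq_intros simp: field_simps)
    from DERIV_image_chain[OF DERIV_subset[OF this img] DG[OF v]] show ?thesis
      by (simp add: o_def G2_def[abs_def] h_def)
  qed
  have "continuous_on {a..b} h"
    unfolding h_def[abs_def] using F1_pos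
    by (intro continuous_intros cont1 cont2 cont3) (auto simp: less_imp_neq[symmetric])
  then have "bounded (h ` {a..b})"
    by (intro compact_imp_bounded compact_continuous_image) auto
  then obtain L where L: "\<And>x. x \<in> {a..b} \<Longrightarrow> \<bar>h x\<bar> \<le> L"
    unfolding bounded_iff real_norm_def by (metis imageI)
  have "norm (G2 v - G2 w) \<le> L * norm (v - w)" if "v \<in> {F a..F b}" "w \<in> {F a..F b}" for v w
    by (rule field_differentiable_bound[OF _ D _ that]) (auto intro!: L G_in)
  then show ?thesis
    by (intro that[of L]) auto
qed

lemma compact_bound:
  fixes h :: "real \<Rightarrow> real"
  assumes "continuous_on {F a..F b} h"
  obtains C where "\<And>v. v \<in> {F a..F b} \<Longrightarrow> \<bar>h v\<bar> \<le> C"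
proof -
  have "bounded (h ` {F a..F b})"
    by (intro compact_imp_bounded compact_continuous_image assms) auto
  then show ?thesis
    using that unfolding bounded_iff real_norm_def by (metis imageI)
qed

lemma G_lipschitz:
  obtains L where "\<And>v w. v \<in> {F a..F b} \<Longrightarrow> w \<in> {F a..F b} \<Longrightarrow> \<bar>G v - G w\<bar> \<le> L * \<bar>v - w\<bar>"
proof -
  obtain L where L: "\<And>v. v \<in> {F a..F b} \<Longrightarrow> \<bar>G1 v\<bar> \<le> L"
    using compact_bound[OF G1_cont] by blast
  have "norm (G v - G w) \<le> L * norm (v - w)" if "v \<in> {F a..F b}" "w \<in> {F a..F b}" for v w
    by (rule field_differentiable_bound[OF _ DG _ that]) (use L in \<open>auto simp: G1_def\<close>)
  then show ?thesis
    by (intro that[of L]) auto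
qed

definition R :: "real \<Rightarrow> real" where "R b' = (SUP x\<in>{a..b}. b' * x + k x)"

lemma R_bdd: "bdd_above ((\<lambda>x. \<beta> * x + k x) ` {a..b})"
proof -
  have "continuous_on {a..b} (\<lambda>x. \<beta> * x + k x)"
    using DERIV_continuous_on[OF Dk] by (intro continuous_intros)
  then have "bounded ((\<lambda>x. \<beta> * x + k x) ` {a..b})"
    by (intro compact_imp_bounded compact_continuous_image) auto
  then show ?thesis by (rule bounded_imp_bdd_above)
qed

lemma R_ge: "x \<in> {a..b} \<Longrightarrow> \<beta> * x + k x \<le> R \<beta>"
  unfolding R_def by (rule cSUP_upper[OF _ R_bdd])

text \<open>The slope \<open>- k' u\<close> cancels the tangent slope of the concave function
  \<open>k\<close> at \<open>u\<close>, so the supremum is attained there.\<close>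

lemma R_eq: "R (- k' u) = - k' u * u + k u" if "u \<in> {a..b}"
proof (rule antisym)
  show "R (- k' u) \<le> - k' u * u + k u"
    unfolding R_def using that ab k_below_tangent[OF _ that]
    by (intro cSUP_least) (auto simp: algebra_simps)
qed (rule R_ge[OF that])

text \<open>A supremum of affine functions with slopes in \<open>{a..b}\<close>. The resulting
  continuity makes the running cost of a bounded control measurable and bounded.\<close>

lemma R_lipschitz: "\<bar>R \<beta> - R \<gamma>\<bar> \<le> max \<bar>a\<bar> \<bar>b\<bar> * \<bar>\<beta> - \<gamma>\<bar>"
proof -
  have *: "R \<beta> \<le> R \<gamma> + max \<bar>a\<bar> \<bar>b\<bar> * \<bar>\<beta> - \<gamma>\<bar>" for \<beta> \<gamma>
    unfolding R_def[of \<beta>]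
  proof (rule cSUP_least)
    fix x assume x: "x \<in> {a..b}"
    have "(\<beta> - \<gamma>) * x \<le> \<bar>\<beta> - \<gamma>\<bar> * max \<bar>a\<bar> \<bar>b\<bar>"
    proof -
      have "(\<beta> - \<gamma>) * x \<le> \<bar>\<beta> - \<gamma>\<bar> * \<bar>x\<bar>"
        using abs_ge_self[of "(\<beta> - \<gamma>) * x"] by (simp add: abs_mult)
      also have "\<dots> \<le> \<bar>\<beta> - \<gamma>\<bar> * max \<bar>a\<bar> \<bar>b\<bar>"
        using x by (intro mult_left_mono) auto
      finally show ?thesis .
    qed
    then show "\<beta> * x + k x \<le> R \<gamma> + max \<bar>a\<bar> \<bar>b\<bar> * \<bar>\<beta> - \<gamma>\<bar>"
      using R_ge[OF x, of \<gamma>] by (simp add: algebra_simps)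
  qed (use ab in auto)
  show ?thesis
    using *[of \<beta> \<gamma>] *[of \<gamma> \<beta>] by (simp add: abs_le_iff abs_minus_commute)
qed

lemma R_cont: "continuous_on UNIV R"
proof -
  have "(max \<bar>a\<bar> \<bar>b\<bar>)-lipschitz_on UNIV R"
    using R_lipschitz by (intro lipschitz_onI) (auto simp: dist_real_def)
  then show ?thesis by (rule lipschitz_on_continuous_on)
qed

end

section \<open>The standard Gaussian measure\<close>

definition gauss_density :: "'a::euclidean_space \<Rightarrow> real" where
  "gauss_density x = exp (- (norm x)\<^sup>2 / 2) / sqrt (2 * pi) ^ DIM('a)"

lemma std_gaussian_eq: "std_gaussian = density lborel (\<lambda>x. ennreal (gauss_density x))"
  by (simp add: std_gaussian_def gauss_density_def)

lemma gauss_density_nonneg: "0 \<le> gauss_density x"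
  by (simp add: gauss_density_def)

lemma gauss_density_measurable[measurable]: "gauss_density \<in> borel_measurable borel"
  unfolding gauss_density_def[abs_def] by measurable

lemma sets_std_gaussian[measurable_cong, simp]: "sets std_gaussian = sets borel"
  and space_std_gaussian[simp]: "space std_gaussian = UNIV"
  by (simp_all add: std_gaussian_def)

lemma gauss_density_prod:
  "gauss_density (x::'a::euclidean_space) = (\<Prod>b\<in>Basis. std_normal_density (x \<bullet> b))"
proof -
  have "(norm x)\<^sup>2 = (\<Sum>b\<in>Basis. (x \<bullet> b)\<^sup>2)"
    unfolding power2_norm_eq_inner by (subst euclidean_inner) (simp add: power2_eq_square)
  then have "- (norm x)\<^sup>2 / 2 = (\<Sum>b\<in>Basis. - (x \<bullet> b)\<^sup>2 / 2)"
    by (simp add: sum_negf sum_divide_distrib)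
  then have "exp (- (norm x)\<^sup>2 / 2) = (\<Prod>b\<in>Basis. exp (- (x \<bullet> b)\<^sup>2 / 2))"
    by (simp only: exp_sum[OF finite_Basis])
  then show ?thesis
    unfolding gauss_density_def std_normal_density_def prod.distrib by (simp add: power_one_over)
qed

lemma nn_integral_std_gaussian_prod:
  assumes [measurable]: "\<And>b. b \<in> Basis \<Longrightarrow> h b \<in> borel_measurable borel"
  shows "(\<integral>\<^sup>+(x::'a::euclidean_space). (\<Prod>b\<in>Basis. h b (x \<bullet> b)) \<partial>std_gaussian)
    = (\<Prod>b\<in>Basis. (\<integral>\<^sup>+t. ennreal (std_normal_density t) * h b t \<partial>lborel))"
proof -
  have "(\<integral>\<^sup>+(x::'a). (\<Prod>b\<in>Basis. h b (x \<bullet> b)) \<partial>std_gaussian)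
    = (\<integral>\<^sup>+(x::'a). ennreal (gauss_density x) * (\<Prod>b\<in>Basis. h b (x \<bullet> b)) \<partial>lborel)"
    unfolding std_gaussian_eq by (intro nn_integral_density) auto
  also have "\<dots> = (\<integral>\<^sup>+(x::'a). (\<Prod>b\<in>Basis. ennreal (std_normal_density (x \<bullet> b)) * h b (x \<bullet> b)) \<partial>lborel)"
    by (simp add: gauss_density_prod prod.distrib prod_ennreal)
  also have "\<dots> = (\<Prod>b\<in>Basis. (\<integral>\<^sup>+t. ennreal (std_normal_density t) * h b t \<partial>lborel))"
    by (rule nn_integral_lborel_prod) auto
  finally show ?thesis .
qed

lemma nn_integral_std_normal_moment:
  "(\<integral>\<^sup>+t. ennreal (std_normal_density t * t ^ (2 * k)) \<partial>lborel) = ennreal (fact (2 * k) / (2 ^ k * fact k))"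
  using std_normal_moment_even[of k]
  by (subst nn_integral_eq_integral) (auto simp: has_bochner_integral_iff)

lemma nn_integral_std_normal: "(\<integral>\<^sup>+t. ennreal (std_normal_density t) \<partial>lborel) = 1"
  using nn_integral_std_normal_moment[of 0] by simp

interpretation std_gaussian: prob_space "std_gaussian :: 'a::euclidean_space measure"
proof
  show "emeasure (std_gaussian :: 'a measure) (space std_gaussian) = 1"
    using nn_integral_std_gaussian_prod[where 'a='a, of "\<lambda>_ _. 1"] by (simp add: nn_integral_std_normal)
qed

lemma measure_std_gaussian_UNIV[simp]: "measure std_gaussian (UNIV :: 'a::euclidean_space set) = 1"
  using std_gaussian.prob_space[where 'a='a] by simp

lemma std_gaussian_coord_moment:
  fixes b :: "'a::euclidean_space"
  assumes b: "b \<in> Basis"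
  shows "has_bochner_integral std_gaussian (\<lambda>z::'a. (z \<bullet> b) ^ (2 * k)) (fact (2 * k) / (2 ^ k * fact k))"
proof (rule has_bochner_integral_nn_integral)
  have "(\<integral>\<^sup>+(z::'a). ennreal ((z \<bullet> b) ^ (2 * k)) \<partial>std_gaussian)
    = (\<integral>\<^sup>+(z::'a). (\<Prod>c\<in>Basis. if c = b then ennreal ((z \<bullet> c) ^ (2 * k)) else 1) \<partial>std_gaussian)"
    using b by (simp add: prod.If_cases Int_insert_right)
  also have "\<dots> = (\<Prod>c\<in>(Basis::'a set). (\<integral>\<^sup>+t. ennreal (std_normal_density t) * (if c = b then ennreal (t ^ (2 * k)) else 1) \<partial>lborel))"
    by (subst nn_integral_std_gaussian_prod[symmetric]) auto
  also have "\<dots> = (\<Prod>c\<in>(Basis::'a set). if c = b then ennreal (fact (2 * k) / (2 ^ k * fact k)) else 1)"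
    by (intro prod.cong) (auto simp: nn_integral_std_normal ennreal_mult'[symmetric]
        nn_integral_std_normal_moment[symmetric])
  also have "\<dots> = ennreal (fact (2 * k) / (2 ^ k * fact k))"
    using b by (simp add: prod.If_cases Int_insert_right)
  finally show "(\<integral>\<^sup>+(z::'a). ennreal ((z \<bullet> b) ^ (2 * k)) \<partial>std_gaussian) = ennreal (fact (2 * k) / (2 ^ k * fact k))" .
qed auto

text \<open>Flipping all coordinates gives mean zero; flipping a single one removes the mixed second
  moments.\<close>

lemma distr_std_gaussian_sign:
  fixes c :: "'a::euclidean_space \<Rightarrow> real"
  assumes c: "\<And>b. b \<in> Basis \<Longrightarrow> \<bar>c b\<bar> = 1"
  defines "T \<equiv> \<lambda>x. \<Sum>b\<in>Basis. (c b * (x \<bullet> b)) *\<^sub>R b"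
  shows "distr std_gaussian borel T = (std_gaussian :: 'a measure)"
proof -
  have [measurable]: "T \<in> borel_measurable borel"
    unfolding T_def by measurable
  have "c b \<noteq> 0" if "b \<in> Basis" for b
    using c[OF that] by auto
  then have lb: "lborel = distr lborel borel T"
    using lborel_affine_euclidean[of c 0] c by (auto simp: T_def density_1 abs_prod[symmetric])
  have "T x \<bullet> b = c b * (x \<bullet> b)" if "b \<in> Basis" for x b
    using that by (simp add: T_def inner_sum_left inner_Basis if_distrib sum.delta' cong: if_cong)
  moreover have "(c b * u)\<^sup>2 = u\<^sup>2" if "b \<in> Basis" for b u
    using c[OF that] by (metis mult_1 power2_abs power_mult_distrib power_one)
  ultimately have gd: "gauss_density (T x) = gauss_density x" for x
    by (simp add: gauss_density_prod std_normal_density_def)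
  have "distr (density lborel (\<lambda>x. ennreal (gauss_density (T x)))) borel T = density (distr lborel borel T) (\<lambda>x. ennreal (gauss_density x))"
    by (rule density_distr[symmetric]) auto
  then show ?thesis
    unfolding std_gaussian_eq gd lb[symmetric] .
qed

lemma distr_std_gaussian_uminus: "distr std_gaussian borel uminus = (std_gaussian :: 'a::euclidean_space measure)"
  using distr_std_gaussian_sign[of "\<lambda>_. - 1 :: real"]
  by (simp add: sum_negf euclidean_representation)

lemma distr_std_gaussian_reflect:
  fixes b :: "'a::euclidean_space"
  assumes "b \<in> Basis"
  shows "distr std_gaussian borel (\<lambda>x. x - (2 * (x \<bullet> b)) *\<^sub>R b) = std_gaussian"
proof -
  have "(\<Sum>c\<in>Basis. ((if c = b then - 1 else 1) * (x \<bullet> c)) *\<^sub>R c) = x - (2 * (x \<bullet> b)) *\<^sub>R b" for x :: 'a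
  proof -
    have "(\<Sum>c\<in>Basis. ((if c = b then - 1 else 1) * (x \<bullet> c)) *\<^sub>R c)
      = (\<Sum>c\<in>Basis. (x \<bullet> c) *\<^sub>R c) - (\<Sum>c\<in>Basis. if c = b then (2 * (x \<bullet> c)) *\<^sub>R c else 0)"
      unfolding sum_subtractf[symmetric] by (intro sum.cong) (auto simp: algebra_simps scaleR_2[symmetric])
    then show ?thesis
      using assms by (simp add: euclidean_representation)
  qed
  then show ?thesis
    using distr_std_gaussian_sign[of "\<lambda>c. if c = b then - 1 else 1 :: real"] by auto
qed

text \<open>The fourth moment dominates all lower ones, in particular the cubic remainder of a time
  step. The fourth power of the norm is a double sum of products of squared coordinates, each at
  most a sum of two fourth powers.\<close>

lemma integrable_std_gaussian_norm4: "integrable std_gaussian (\<lambda>z::'a::euclidean_space. norm z ^ 4)"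
proof -
  have c4: "integrable std_gaussian (\<lambda>z::'a. (z \<bullet> b) ^ 4)" if "b \<in> Basis" for b
    using std_gaussian_coord_moment[OF that, of 2] by (simp add: has_bochner_integral_iff)
  have "integrable std_gaussian (\<lambda>z::'a. \<Sum>b\<in>Basis. \<Sum>c\<in>Basis. (z \<bullet> b)\<^sup>2 * (z \<bullet> c)\<^sup>2)"
  proof (intro Bochner_Integration.integrable_sum)
    fix b c :: 'a assume bc: "b \<in> Basis" "c \<in> Basis"
    show "integrable std_gaussian (\<lambda>z. (z \<bullet> b)\<^sup>2 * (z \<bullet> c)\<^sup>2)"
    proof (rule Bochner_Integration.integrable_bound)
      show "integrable std_gaussian (\<lambda>z. (z \<bullet> b) ^ 4 + (z \<bullet> c) ^ 4)"
        using c4 bc by auto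
      have "(u\<^sup>2 * v\<^sup>2 :: real) \<le> u ^ 4 + v ^ 4" for u v :: real
      proof -
        have "2 * (u\<^sup>2 * v\<^sup>2) \<le> u ^ 4 + v ^ 4"
          using sum_squares_bound[of "u\<^sup>2" "v\<^sup>2"] by simp
        moreover have "0 \<le> u\<^sup>2 * v\<^sup>2" by simp
        ultimately show ?thesis by linarith
      qed
      then show "AE z in std_gaussian. norm ((z \<bullet> b)\<^sup>2 * (z \<bullet> c)\<^sup>2) \<le> norm ((z \<bullet> b) ^ 4 + (z \<bullet> c) ^ 4)"
        by auto
    qed auto
  qed
  moreover have "norm z ^ 4 = (\<Sum>b\<in>Basis. \<Sum>c\<in>Basis. (z \<bullet> b)\<^sup>2 * (z \<bullet> c)\<^sup>2)" for z :: 'a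
  proof -
    have "(norm z)\<^sup>2 = (\<Sum>b\<in>Basis. (z \<bullet> b)\<^sup>2)"
      unfolding power2_norm_eq_inner by (subst euclidean_inner) (simp add: power2_eq_square)
    then have "(norm z)\<^sup>2 * (norm z)\<^sup>2 = (\<Sum>b\<in>Basis. \<Sum>c\<in>Basis. (z \<bullet> b)\<^sup>2 * (z \<bullet> c)\<^sup>2)"
      by (simp add: sum_product)
    then show ?thesis by simp
  qed
  ultimately show ?thesis by simp
qed

lemma integrable_std_gaussian_of_bound:
  fixes h :: "'a::euclidean_space \<Rightarrow> real"
  assumes [measurable]: "h \<in> borel_measurable borel" and h: "\<And>z. \<bar>h z\<bar> \<le> C * (1 + norm z ^ 4)"
  shows "integrable std_gaussian h"
  by (rule Bochner_Integration.integrable_bound[of _ "\<lambda>z. C * (1 + norm z ^ 4)"])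
    (use h in \<open>auto intro!: integrable_std_gaussian_norm4 intro: order_trans[OF _ abs_ge_self]\<close>)

lemma power_le_one_plus_power4: "0 \<le> x \<Longrightarrow> k \<le> 4 \<Longrightarrow> x ^ k \<le> 1 + (x::real) ^ 4"
  by (cases "x \<le> 1") (auto simp: power_le_one add_increasing2 add_increasing intro: power_increasing)

lemma integrable_std_gaussian_norm:
  assumes "k \<le> 4" shows "integrable std_gaussian (\<lambda>z::'a::euclidean_space. norm z ^ k)"
  using power_le_one_plus_power4[OF norm_ge_zero assms]
  by (intro integrable_std_gaussian_of_bound[of _ 1]) auto

lemma integrable_std_gaussian_inner: "integrable std_gaussian (\<lambda>z::'a::euclidean_space. z \<bullet> p)"
proof (rule Bochner_Integration.integrable_bound)
  show "integrable std_gaussian (\<lambda>z::'a. norm z ^ 1 * norm p)"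
    by (intro integrable_mult_left integrable_std_gaussian_norm) simp
qed (auto simp: Cauchy_Schwarz_ineq2 abs_mult)

lemma std_gaussian_mean: "(\<integral>(z::'a::euclidean_space). z \<bullet> p \<partial>std_gaussian) = 0"
proof -
  have "(\<integral>(z::'a). z \<bullet> p \<partial>std_gaussian) = (\<integral>z. z \<bullet> p \<partial>distr std_gaussian borel uminus)"
    by (simp add: distr_std_gaussian_uminus)
  also have "\<dots> = - (\<integral>(z::'a). z \<bullet> p \<partial>std_gaussian)"
    by (subst integral_distr) auto
  finally show ?thesis by simp
qed

lemma std_gaussian_variance:
  "has_bochner_integral std_gaussian (\<lambda>z::'a::euclidean_space. (z \<bullet> p)\<^sup>2) ((norm p)\<^sup>2)"
proof -
  have int: "integrable std_gaussian (\<lambda>z::'a. (z \<bullet> p) * (z \<bullet> q))" for p q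
  proof (rule Bochner_Integration.integrable_bound)
    show "integrable std_gaussian (\<lambda>z::'a. norm z ^ 2 * (norm p * norm q))"
      by (intro integrable_mult_left integrable_std_gaussian_norm) simp
    have "\<bar>z \<bullet> p\<bar> * \<bar>z \<bullet> q\<bar> \<le> norm z ^ 2 * (norm p * norm q)" for z
      using mult_mono[OF Cauchy_Schwarz_ineq2[of z p] Cauchy_Schwarz_ineq2[of z q]]
      by (simp add: power2_eq_square mult_ac)
    then show "AE z in std_gaussian. norm ((z \<bullet> p) * (z \<bullet> q)) \<le> norm (norm z ^ 2 * (norm p * norm q))"
      by (simp add: abs_mult)
  qed auto
  have cov: "(\<integral>(z::'a). (z \<bullet> b) * (z \<bullet> c) \<partial>std_gaussian) = (if b = c then 1 else 0)"
    if "b \<in> Basis" "c \<in> Basis" for b c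
  proof (cases "b = c")
    case True
    then show ?thesis
      using std_gaussian_coord_moment[OF that(1), of 1]
      by (simp add: has_bochner_integral_iff power2_eq_square fact_numeral)
  next
    case False
    have "(\<integral>(z::'a). (z \<bullet> b) * (z \<bullet> c) \<partial>std_gaussian)
      = (\<integral>z. (z \<bullet> b) * (z \<bullet> c) \<partial>distr std_gaussian borel (\<lambda>x. x - (2 * (x \<bullet> b)) *\<^sub>R b))"
      by (simp add: distr_std_gaussian_reflect[OF that(1)])
    also have "\<dots> = (\<integral>(z::'a). - ((z \<bullet> b) * (z \<bullet> c)) \<partial>std_gaussian)"
      using that False by (subst integral_distr) (auto simp: inner_diff_left inner_Basis)
    finally show ?thesis using False by simp
  qed
  have eq: "(z \<bullet> p)\<^sup>2 = (\<Sum>b\<in>Basis. \<Sum>c\<in>Basis. (p \<bullet> b) * (p \<bullet> c) * ((z \<bullet> b) * (z \<bullet> c)))" for z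
    by (subst euclidean_inner) (simp add: power2_eq_square sum_product mult_ac)
  have "(\<integral>(z::'a). (z \<bullet> p)\<^sup>2 \<partial>std_gaussian) = (\<Sum>b\<in>Basis. \<Sum>c\<in>Basis. (p \<bullet> b) * (p \<bullet> c) * (if b = c then 1 else 0))"
    unfolding eq by (simp add: int cov)
  also have "\<dots> = (norm p)\<^sup>2"
    unfolding power2_norm_eq_inner by (subst (3) euclidean_inner) (simp add: if_distrib sum.delta cong: if_cong)
  finally show ?thesis
    using int[of p p] by (simp add: has_bochner_integral_iff power2_eq_square)
qed

text \<open>The finite-dimensional Cameron--Martin formula, by completing the square in the
  exponent.\<close>

lemma distr_std_gaussian_shift:
  "distr std_gaussian borel (\<lambda>z. z + k) =
    density std_gaussian (\<lambda>z::'a::euclidean_space. ennreal (exp (k \<bullet> z - (norm k)\<^sup>2 / 2)))"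
proof -
  have gd: "gauss_density (z - k) = gauss_density z * exp (k \<bullet> z - (norm k)\<^sup>2 / 2)" for z :: 'a
    by (simp add: gauss_density_def exp_add[symmetric] power2_norm_eq_inner inner_diff_left inner_diff_right
        inner_commute field_simps)
  have lb: "lborel = distr lborel borel (\<lambda>z::'a. z + k)"
  proof -
    have "(\<lambda>z::'a. z + k) = (+) k" by (auto simp: add.commute)
    then show ?thesis by (simp add: lborel_distr_plus)
  qed
  have "distr (density lborel (\<lambda>z. ennreal (gauss_density (z + k - k)))) borel (\<lambda>z. z + k)
      = density (distr lborel borel (\<lambda>z. z + k)) (\<lambda>z. ennreal (gauss_density (z - k)))"
    by (rule density_distr[symmetric]) auto
  also have "\<dots> = density lborel (\<lambda>z. ennreal (gauss_density (z - k)))"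
    unfolding lb[symmetric] ..
  also have "\<dots> = density (density lborel (\<lambda>z. ennreal (gauss_density z))) (\<lambda>z. ennreal (exp (k \<bullet> z - (norm k)\<^sup>2 / 2)))"
    by (subst density_density_eq) (auto simp: gd ennreal_mult' gauss_density_nonneg)
  finally show ?thesis
    by (simp add: std_gaussian_eq)
qed

lemma
  fixes \<psi> :: "'a::euclidean_space \<Rightarrow> real"
  assumes [measurable]: "\<psi> \<in> borel_measurable borel"
  shows integrable_std_gaussian_shift: "integrable std_gaussian (\<lambda>z. \<psi> (z + k))
      \<longleftrightarrow> integrable std_gaussian (\<lambda>z. exp (k \<bullet> z - (norm k)\<^sup>2 / 2) * \<psi> z)"
    and integral_std_gaussian_shift: "(\<integral>z. \<psi> (z + k) \<partial>std_gaussian)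
      = (\<integral>z. exp (k \<bullet> z - (norm k)\<^sup>2 / 2) * \<psi> z \<partial>std_gaussian)"
proof -
  have "integrable std_gaussian (\<lambda>z. \<psi> (z + k)) \<longleftrightarrow> integrable (distr std_gaussian borel (\<lambda>z. z + k)) \<psi>"
    by (subst integrable_distr_eq) auto
  also have "\<dots> \<longleftrightarrow> integrable std_gaussian (\<lambda>z. exp (k \<bullet> z - (norm k)\<^sup>2 / 2) * \<psi> z)"
    unfolding distr_std_gaussian_shift by (subst integrable_density) auto
  finally show "integrable std_gaussian (\<lambda>z. \<psi> (z + k))
      \<longleftrightarrow> integrable std_gaussian (\<lambda>z. exp (k \<bullet> z - (norm k)\<^sup>2 / 2) * \<psi> z)" .
  have "(\<integral>z. \<psi> (z + k) \<partial>std_gaussian) = (\<integral>z. \<psi> z \<partial>distr std_gaussian borel (\<lambda>z. z + k))"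
    by (subst integral_distr) auto
  also have "\<dots> = (\<integral>z. exp (k \<bullet> z - (norm k)\<^sup>2 / 2) * \<psi> z \<partial>std_gaussian)"
    unfolding distr_std_gaussian_shift by (subst integral_density) auto
  finally show "(\<integral>z. \<psi> (z + k) \<partial>std_gaussian)
      = (\<integral>z. exp (k \<bullet> z - (norm k)\<^sup>2 / 2) * \<psi> z \<partial>std_gaussian)" .
qed

lemma exp_minus_linear_square_bound:
  assumes "0 \<le> x" "x \<le> 1" shows "exp x - 1 - x \<le> (x::real)\<^sup>2"
  using exp_bound[OF assms] by simp

text \<open>For small \<open>k\<close> the bound comes from the second moment \<open>exp(\<parallel>k\<parallel>\<^sup>2) - 1 - \<parallel>k\<parallel>\<^sup>2 \<le> \<parallel>k\<parallel>\<^sup>4\<close>.\<close>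

lemma gaussian_tilt_linearization_bound:
  fixes k :: "'a::euclidean_space"
  defines "X \<equiv> \<lambda>z::'a. exp (k \<bullet> z - (norm k)\<^sup>2 / 2) - 1 - k \<bullet> z"
  shows "integrable std_gaussian X" "(\<integral>z. \<bar>X z\<bar> \<partial>std_gaussian) \<le> 3 * (norm k)\<^sup>2"
proof -
  let ?e = "\<lambda>z::'a. exp (k \<bullet> z - (norm k)\<^sup>2 / 2)"
  have var: "has_bochner_integral std_gaussian (\<lambda>z::'a. (k \<bullet> z)\<^sup>2) ((norm k)\<^sup>2)"
    using std_gaussian_variance[of k] by (simp add: inner_commute)
  have lin: "has_bochner_integral std_gaussian (\<lambda>z::'a. k \<bullet> z) 0"
    using integrable_std_gaussian_inner[of k] std_gaussian_mean[of k]
    by (simp add: inner_commute has_bochner_integral_iff)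
  have e: "has_bochner_integral std_gaussian ?e 1"
    using integrable_std_gaussian_shift[of "\<lambda>_. 1" k] integral_std_gaussian_shift[of "\<lambda>_. 1" k]
    by (simp add: has_bochner_integral_iff)
  have elin: "has_bochner_integral std_gaussian (\<lambda>z. ?e z * (k \<bullet> z)) ((norm k)\<^sup>2)"
    using integrable_std_gaussian_shift[of "\<lambda>z. k \<bullet> z" k] integral_std_gaussian_shift[of "\<lambda>z. k \<bullet> z" k] lin
    by (simp add: has_bochner_integral_iff inner_add_right power2_norm_eq_inner)
  \<comment> \<open>The squared tilt by \<open>k\<close> is \<open>exp ((norm k)\<^sup>2)\<close>
    times the tilt by \<open>2 *\<^sub>R k\<close>, whose integral is 1.\<close>
  have e2: "has_bochner_integral std_gaussian (\<lambda>z. (?e z)\<^sup>2) (exp ((norm k)\<^sup>2))"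
  proof -
    have "has_bochner_integral std_gaussian (\<lambda>z::'a. exp ((2 *\<^sub>R k) \<bullet> z - (norm (2 *\<^sub>R k))\<^sup>2 / 2)) 1"
      using integrable_std_gaussian_shift[of "\<lambda>_. 1" "2 *\<^sub>R k"] integral_std_gaussian_shift[of "\<lambda>_. 1" "2 *\<^sub>R k"]
      by (simp add: has_bochner_integral_iff)
    from has_bochner_integral_mult_right[OF this, of "exp ((norm k)\<^sup>2)"] show ?thesis
      by (simp add: exp_add[symmetric] power2_eq_square algebra_simps)
  qed
  have X2: "has_bochner_integral std_gaussian (\<lambda>z. (X z)\<^sup>2) (exp ((norm k)\<^sup>2) - 1 - (norm k)\<^sup>2)"
  proof -
    have one: "has_bochner_integral std_gaussian (\<lambda>z::'a. 1::real) 1"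
      by (simp add: has_bochner_integral_iff)
    have "has_bochner_integral std_gaussian
        (\<lambda>z. (?e z)\<^sup>2 + 1 + (k \<bullet> z)\<^sup>2 - 2 * ?e z - 2 * (?e z * (k \<bullet> z)) + 2 * (k \<bullet> z))
        (exp ((norm k)\<^sup>2) + 1 + (norm k)\<^sup>2 - 2 * 1 - 2 * (norm k)\<^sup>2 + 2 * 0)"
      by (intro has_bochner_integral_add has_bochner_integral_diff has_bochner_integral_mult_right e e2 one elin lin var)
    then show ?thesis
      by (simp add: X_def power2_eq_square algebra_simps)
  qed
  have "has_bochner_integral std_gaussian X (1 - 1 - 0)"
    unfolding X_def by (intro has_bochner_integral_diff e lin) (simp add: has_bochner_integral_iff)
  then show intX: "integrable std_gaussian X"
    by (simp add: has_bochner_integral_iff)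
  show "(\<integral>z. \<bar>X z\<bar> \<partial>std_gaussian) \<le> 3 * (norm k)\<^sup>2"
  proof (cases "norm k \<le> 1")
    case True
    show ?thesis
    proof (cases "k = 0")
      case False
      then have pos: "(norm k)\<^sup>2 > 0" by simp
      have "exp ((norm k)\<^sup>2) - 1 - (norm k)\<^sup>2 \<le> ((norm k)\<^sup>2)\<^sup>2"
        using True by (intro exp_minus_linear_square_bound) (auto simp: power_le_one)
      then have *: "(exp ((norm k)\<^sup>2) - 1 - (norm k)\<^sup>2) / (norm k)\<^sup>2 \<le> (norm k)\<^sup>2"
        using pos by (simp add: pos_divide_le_eq power2_eq_square)
      \<comment> \<open>Young's inequality with weight \<open>(norm k)\<^sup>2\<close>: as the
        second moment is at most the square of this weight, both summands are of the order of the
        weight.\<close>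
      have "(\<integral>z. \<bar>X z\<bar> \<partial>std_gaussian) \<le> (\<integral>z. (X z)\<^sup>2 / (norm k)\<^sup>2 + (norm k)\<^sup>2 \<partial>std_gaussian)"
      proof (rule integral_mono)
        fix z
        have "2 * \<bar>X z\<bar> * (norm k)\<^sup>2 \<le> (X z)\<^sup>2 + ((norm k)\<^sup>2)\<^sup>2"
          using sum_squares_bound[of "\<bar>X z\<bar>" "(norm k)\<^sup>2"] by simp
        moreover have "0 \<le> \<bar>X z\<bar> * (norm k)\<^sup>2" by simp
        ultimately have "\<bar>X z\<bar> * (norm k)\<^sup>2 \<le> (X z)\<^sup>2 + ((norm k)\<^sup>2)\<^sup>2"
          by linarith
        then have "\<bar>X z\<bar> \<le> ((X z)\<^sup>2 + ((norm k)\<^sup>2)\<^sup>2) / (norm k)\<^sup>2"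
          using pos by (simp add: pos_le_divide_eq)
        also have "\<dots> = (X z)\<^sup>2 / (norm k)\<^sup>2 + (norm k)\<^sup>2"
          using pos by (simp add: add_divide_distrib power2_eq_square)
        finally show "\<bar>X z\<bar> \<le> (X z)\<^sup>2 / (norm k)\<^sup>2 + (norm k)\<^sup>2" .
      qed (use intX X2 in \<open>auto simp: has_bochner_integral_iff\<close>)
      also have "\<dots> = (exp ((norm k)\<^sup>2) - 1 - (norm k)\<^sup>2) / (norm k)\<^sup>2 + (norm k)\<^sup>2"
        using X2 by (simp add: has_bochner_integral_iff)
      also have "\<dots> \<le> 3 * (norm k)\<^sup>2"
        using * pos by linarith
      finally show ?thesis .
    qed (simp add: X_def)
  next
    case False
    \<comment> \<open>For large \<open>k\<close> a termwise bound suffices. This case fixes the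
      factor 3, the value of the bound at \<open>norm k = 1\<close>.\<close>
    have "(\<integral>z. \<bar>X z\<bar> \<partial>std_gaussian) \<le> (\<integral>z. ?e z + 1 + (1 + (k \<bullet> z)\<^sup>2) / 2 \<partial>std_gaussian)"
    proof (rule integral_mono)
      show "integrable std_gaussian (\<lambda>z. ?e z + 1 + (1 + (k \<bullet> z)\<^sup>2) / 2)"
        using e var by (auto simp: has_bochner_integral_iff)
      have "\<bar>u\<bar> \<le> (1 + u\<^sup>2) / 2" for u :: real
        using sum_squares_bound[of "\<bar>u\<bar>" 1] by simp
      note this[of "k \<bullet> z" for z]
      then show "\<bar>X z\<bar> \<le> ?e z + 1 + (1 + (k \<bullet> z)\<^sup>2) / 2" for z
        unfolding X_def using exp_gt_zero[of "k \<bullet> z - (norm k)\<^sup>2 / 2"] by (smt (verit))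
    qed (use intX in auto)
    also have "\<dots> = 1 + 1 + (1 + (norm k)\<^sup>2) / 2"
      using e var by (simp add: has_bochner_integral_iff)
    also have "\<dots> \<le> 3 * (norm k)\<^sup>2"
    proof -
      have "1 \<le> (norm k)\<^sup>2" using False by (intro one_le_power) simp
      moreover have "1 + 1 + (1 + n) / 2 \<le> 3 * n" if "1 \<le> n" for n :: real
        using that by (simp add: field_simps)
      ultimately show ?thesis by blast
    qed
    finally show ?thesis .
  qed
qed

text \<open>\<open>g\<close> has the bounded, Lipschitz gradient \<open>p\<close>. Inequalities
  replace derivatives because the one-step expansion consumes exactly these, and one constant serves
  all three.\<close>

definition C11_bound :: "real \<Rightarrow> ('a::real_inner \<Rightarrow> real) \<Rightarrow> ('a \<Rightarrow> 'a) \<Rightarrow> bool" where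
  "C11_bound C g p \<longleftrightarrow> (\<forall>y h. \<bar>g (y + h) - g y - p y \<bullet> h\<bar> \<le> C * (norm h)\<^sup>2) \<and>
     (\<forall>y. norm (p y) \<le> C) \<and> (\<forall>y h. norm (p (y + h) - p y) \<le> C * norm h)"

text \<open>For bounded \<open>g\<close> the quadratic remainder controls the gradient. A unit step
  gives \<open>2 * B + C\<close>. Combining the remainders from \<open>y + h\<close> along
  \<open>l\<close>, from \<open>y\<close> along \<open>h + l\<close> and from \<open>y\<close> along
  \<open>h\<close>, with \<open>norm l = norm h\<close>, isolates
  \<open>(p (y + h) - p y) \<bullet> l\<close> at the price
  \<open>(1 + 4 + 1) * C * (norm h)\<^sup>2\<close>.\<close>

lemma C11_boundI:
  fixes g :: "'a::euclidean_space \<Rightarrow> real"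
  assumes quad: "\<And>y h. \<bar>g (y + h) - g y - p y \<bullet> h\<bar> \<le> C * (norm h)\<^sup>2"
    and g: "\<And>y. \<bar>g y\<bar> \<le> B" and "0 \<le> C" "0 \<le> B"
  shows "C11_bound (2 * B + 6 * C) g p"
proof -
  have le: "norm u \<le> D" if "\<And>h. norm h = r \<Longrightarrow> u \<bullet> h \<le> D * r" "0 < r" for u :: 'a and r D
  proof (cases "u = 0")
    case True
    obtain h :: 'a where "norm h = r" using vector_choose_size[of r] \<open>0 < r\<close> by auto
    then show ?thesis
      using that(1)[of h] \<open>0 < r\<close> True by (auto simp: zero_le_mult_iff)
  next
    case False
    have "u \<bullet> ((r / norm u) *\<^sub>R u) \<le> D * r"
      using False \<open>0 < r\<close> by (intro that(1)) simp
    moreover have "u \<bullet> ((r / norm u) *\<^sub>R u) = norm u * r"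
      using False by (simp add: power2_norm_eq_inner[symmetric] power2_eq_square)
    ultimately show ?thesis using \<open>0 < r\<close> by simp
  qed
  have p: "norm (p y) \<le> 2 * B + C" for y
  proof (rule le[of 1])
    fix h :: 'a assume "norm h = 1"
    then show "p y \<bullet> h \<le> (2 * B + C) * 1"
      using quad[of y h] g[of y] g[of "y + h"] by simp
  qed simp
  have lip: "norm (p (y + h) - p y) \<le> 6 * C * norm h" for y h
  proof (cases "h = 0")
    case False
    show ?thesis
    proof (rule le[of "norm h"])
      fix l :: 'a assume l: "norm l = norm h"
      have "norm (h + l) \<le> 2 * norm h"
        using norm_triangle_ineq[of h l] l by simp
      then have "(norm (h + l))\<^sup>2 \<le> (2 * norm h)\<^sup>2"
        by (rule power_mono) simp
      then have "C * (norm (h + l))\<^sup>2 \<le> C * (4 * (norm h)\<^sup>2)"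
        using \<open>0 \<le> C\<close> by (intro mult_left_mono) (auto simp: power_mult_distrib)
      then show "(p (y + h) - p y) \<bullet> l \<le> 6 * C * norm h * norm h"
        using quad[of "y + h" l] quad[of y "h + l"] quad[of y h] l
        by (simp add: inner_diff_left inner_add_right add.assoc power2_eq_square)
    qed (use False in simp)
  qed simp
  show ?thesis
    unfolding C11_bound_def
  proof (intro conjI allI)
    show "\<bar>g (y + h) - g y - p y \<bullet> h\<bar> \<le> (2 * B + 6 * C) * (norm h)\<^sup>2" for y h
      using \<open>0 \<le> C\<close> \<open>0 \<le> B\<close> by (intro order_trans[OF quad mult_right_mono]) auto
    show "norm (p y) \<le> 2 * B + 6 * C" for y
      using p[of y] \<open>0 \<le> C\<close> by simp
    show "norm (p (y + h) - p y) \<le> (2 * B + 6 * C) * norm h" for y h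
      using \<open>0 \<le> C\<close> \<open>0 \<le> B\<close> by (intro order_trans[OF lip mult_right_mono]) auto
  qed
qed

text \<open>Time is Brownian time: the generator is half the Laplacian. At \<open>s = 0\<close> the
  formula returns \<phi> itself.\<close>

definition heat :: "real \<Rightarrow> ('a::euclidean_space \<Rightarrow> real) \<Rightarrow> 'a \<Rightarrow> real" where
  "heat s \<phi> y = (\<integral>z. \<phi> (y + sqrt s *\<^sub>R z) \<partial>std_gaussian)"

lemma integrable_std_gaussian_bounded:
  fixes \<psi> :: "'a::euclidean_space \<Rightarrow> real"
  assumes "\<psi> \<in> borel_measurable borel" "\<And>z. \<bar>\<psi> z\<bar> \<le> B"
  shows "integrable std_gaussian \<psi>"
  using assms by (intro std_gaussian.integrable_const_bound[of _ B]) auto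

lemma heat_between:
  assumes [measurable]: "\<phi> \<in> borel_measurable borel" and "\<And>y. \<phi> y \<in> {A..B}"
  shows "heat s \<phi> y \<in> {A..B}"
proof -
  have "\<bar>\<phi> z\<bar> \<le> max \<bar>A\<bar> \<bar>B\<bar>" for z
    using assms(2)[of z] by auto
  then have "integrable std_gaussian (\<lambda>z. \<phi> (y + sqrt s *\<^sub>R z))"
    by (intro integrable_std_gaussian_bounded) auto
  then show ?thesis
    unfolding heat_def using assms(2)
    by (auto intro!: std_gaussian.integral_ge_const std_gaussian.integral_le_const)
qed

text \<open>By Cameron--Martin, a translation of the argument becomes an exponential tilt, so no regularity of \<open>\<phi>\<close> is needed.\<close>

lemma heat_C11:
  fixes \<phi> :: "'a::euclidean_space \<Rightarrow> real"
  assumes [measurable]: "\<phi> \<in> borel_measurable borel" and \<phi>: "\<And>y. \<bar>\<phi> y\<bar> \<le> B" and "s > 0"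
  shows "\<exists>p. C11_bound (2 * B + 18 * B / s) (heat s \<phi>) p"
proof -
  have "0 \<le> B" using \<phi>[of 0] by linarith
  \<comment> \<open>The gradient after Gaussian integration by parts: the derivative falls on the
    density and produces the factor \<open>z / sqrt s\<close>.\<close>
  define p where "p y = (\<Sum>b\<in>Basis. (\<integral>z. \<phi> (y + sqrt s *\<^sub>R z) * (z \<bullet> b) \<partial>std_gaussian / sqrt s) *\<^sub>R b)" for y
  have int: "integrable std_gaussian (\<lambda>z. \<phi> (y + sqrt s *\<^sub>R z) * h z)" if "integrable std_gaussian h" for y and h :: "'a \<Rightarrow> real"
  proof (rule Bochner_Integration.integrable_bound[of _ "\<lambda>z. B * h z"])
    have "\<bar>\<phi> (y + sqrt s *\<^sub>R z)\<bar> * \<bar>h z\<bar> \<le> \<bar>B\<bar> * \<bar>h z\<bar>" for z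
      using \<phi>[of "y + sqrt s *\<^sub>R z"] \<open>0 \<le> B\<close> by (intro mult_right_mono) auto
    then show "AE z in std_gaussian. norm (\<phi> (y + sqrt s *\<^sub>R z) * h z) \<le> norm (B * h z)"
      by (simp add: abs_mult)
    show "(\<lambda>z. \<phi> (y + sqrt s *\<^sub>R z) * h z) \<in> borel_measurable std_gaussian"
      using borel_measurable_integrable[OF that] by measurable
  qed (use that in auto)
  have p_inner: "p y \<bullet> h = (\<integral>z. \<phi> (y + sqrt s *\<^sub>R z) * ((h /\<^sub>R sqrt s) \<bullet> z) \<partial>std_gaussian)" for y h
  proof -
    have "(h /\<^sub>R sqrt s) \<bullet> z = (\<Sum>b\<in>Basis. (z \<bullet> b) * (h \<bullet> b) / sqrt s)" for z
      by (subst inner_commute, subst euclidean_inner) (simp add: divide_inverse mult_ac)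
    then have "(\<integral>z. \<phi> (y + sqrt s *\<^sub>R z) * ((h /\<^sub>R sqrt s) \<bullet> z) \<partial>std_gaussian)
      = (\<integral>z. (\<Sum>b\<in>Basis. \<phi> (y + sqrt s *\<^sub>R z) * (z \<bullet> b) * ((h \<bullet> b) / sqrt s)) \<partial>std_gaussian)"
      by (simp add: sum_distrib_left mult_ac)
    also have "\<dots> = (\<Sum>b\<in>Basis. (\<integral>z. \<phi> (y + sqrt s *\<^sub>R z) * (z \<bullet> b) \<partial>std_gaussian) * ((h \<bullet> b) / sqrt s))"
      by (subst Bochner_Integration.integral_sum) (auto intro!: int integrable_std_gaussian_inner)
    also have "\<dots> = p y \<bullet> h"
      by (simp add: p_def inner_sum_left inner_commute[of h])
    finally show ?thesis by simp
  qed
  have "\<bar>heat s \<phi> (y + h) - heat s \<phi> y - p y \<bullet> h\<bar> \<le> 3 * B / s * (norm h)\<^sup>2" for y h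
  proof -
    define k where "k = h /\<^sub>R sqrt s"
    have nk: "(norm k)\<^sup>2 = (norm h)\<^sup>2 / s"
      using \<open>s > 0\<close> by (simp add: k_def power_mult_distrib power_inverse divide_inverse)
    let ?e = "\<lambda>z::'a. exp (k \<bullet> z - (norm k)\<^sup>2 / 2)"
    let ?X = "\<lambda>z::'a. ?e z - 1 - k \<bullet> z"
    note X = gaussian_tilt_linearization_bound[of k]
    have e_int: "integrable std_gaussian ?e"
      using integrable_std_gaussian_shift[of "\<lambda>_. 1" k] by simp
    have k_int: "integrable std_gaussian (\<lambda>z. k \<bullet> z)"
      using integrable_std_gaussian_inner[of k] by (simp add: inner_commute)
    have "heat s \<phi> (y + h) = (\<integral>z. (\<lambda>z. \<phi> (y + sqrt s *\<^sub>R z)) (z + k) \<partial>std_gaussian)"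
      using \<open>s > 0\<close> by (simp add: heat_def k_def scaleR_add_right add_ac)
    also have "\<dots> = (\<integral>z. ?e z * \<phi> (y + sqrt s *\<^sub>R z) \<partial>std_gaussian)"
      by (rule integral_std_gaussian_shift) simp
    also have "\<dots> = (\<integral>z. \<phi> (y + sqrt s *\<^sub>R z) * ?X z + \<phi> (y + sqrt s *\<^sub>R z) * 1 + \<phi> (y + sqrt s *\<^sub>R z) * (k \<bullet> z) \<partial>std_gaussian)"
      by (simp add: algebra_simps)
    also have "\<dots> = (\<integral>z. \<phi> (y + sqrt s *\<^sub>R z) * ?X z \<partial>std_gaussian) + heat s \<phi> y + p y \<bullet> h"
      using int[OF X(1), of y] int[OF k_int, of y] int[of "\<lambda>_. 1" y]
      by (simp add: p_inner k_def[symmetric] heat_def)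
    finally have "\<bar>heat s \<phi> (y + h) - heat s \<phi> y - p y \<bullet> h\<bar> = \<bar>\<integral>z. \<phi> (y + sqrt s *\<^sub>R z) * ?X z \<partial>std_gaussian\<bar>"
      by simp
    also have "\<dots> \<le> (\<integral>z. \<bar>\<phi> (y + sqrt s *\<^sub>R z) * ?X z\<bar> \<partial>std_gaussian)"
      by (rule integral_abs_bound)
    also have "\<dots> \<le> (\<integral>z. B * \<bar>?X z\<bar> \<partial>std_gaussian)"
      using integrable_abs[OF int[OF X(1), of y]] X(1) \<phi>
      by (intro integral_mono) (auto simp: abs_mult intro!: mult_right_mono)
    also have "\<dots> \<le> B * (3 * (norm k)\<^sup>2)"
      using X(2) \<open>0 \<le> B\<close> by (simp add: mult_left_mono)
    finally show ?thesis by (simp add: nk mult_ac)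
  qed
  \<comment> \<open>With remainder constant \<open>3 * B / s\<close> the bound
    \<open>2 * B + 6 * C\<close> becomes \<open>2 * B + 18 * B / s\<close>.\<close>
  from C11_boundI[OF this, of B] show ?thesis
    using \<phi> heat_between[of \<phi> "- B" B s] \<open>0 \<le> B\<close> \<open>s > 0\<close>
    by (intro exI[of _ p]) (auto simp: abs_le_iff minus_le_iff)
qed

definition gauss_norm_moment :: "'a::euclidean_space itself \<Rightarrow> nat \<Rightarrow> real" where
  "gauss_norm_moment T k = (\<integral>z. norm (z::'a) ^ k \<partial>std_gaussian)"

text \<open>Both sides are coupled through the same Gaussian variable. The modulus in
  \<open>sqrt s\<close> stays finite at time 0, where the constant of \<open>heat_C11\<close> blows
  up; hence it controls the passage \<epsilon> \<rightarrow> 0.\<close>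

lemma heat_lipschitz_diff:
  fixes \<phi> :: "'a::euclidean_space \<Rightarrow> real"
  assumes lip: "\<And>x y. \<bar>\<phi> x - \<phi> y\<bar> \<le> L * norm (x - y)" and \<phi>: "\<And>y. \<bar>\<phi> y\<bar> \<le> B"
    and [measurable]: "\<phi> \<in> borel_measurable borel"
  shows "\<bar>heat s \<phi> y - heat t \<phi> y'\<bar> \<le> L * norm (y - y') + L * \<bar>sqrt s - sqrt t\<bar> * gauss_norm_moment TYPE('a) 1"
proof -
  have int: "integrable std_gaussian (\<lambda>z. \<phi> (y + sqrt s *\<^sub>R z))" for y s
    using \<phi> by (intro integrable_std_gaussian_bounded[of _ B]) auto
  have L: "0 \<le> L"
  proof -
    obtain h :: 'a where "norm h = 1" using vector_choose_size[of 1] by auto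
    then show ?thesis using order_trans[OF abs_ge_zero lip[of h 0]] by simp
  qed
  have "\<bar>heat s \<phi> y - heat t \<phi> y'\<bar> = \<bar>\<integral>z. \<phi> (y + sqrt s *\<^sub>R z) - \<phi> (y' + sqrt t *\<^sub>R z) \<partial>std_gaussian\<bar>"
    by (simp add: heat_def int)
  also have "\<dots> \<le> (\<integral>z. \<bar>\<phi> (y + sqrt s *\<^sub>R z) - \<phi> (y' + sqrt t *\<^sub>R z)\<bar> \<partial>std_gaussian)"
    by (rule integral_abs_bound)
  also have "\<dots> \<le> (\<integral>(z::'a). L * norm (y - y') + L * \<bar>sqrt s - sqrt t\<bar> * norm z ^ 1 \<partial>std_gaussian)"
  proof (rule integral_mono)
    show "integrable std_gaussian (\<lambda>z::'a. L * norm (y - y') + L * \<bar>sqrt s - sqrt t\<bar> * norm z ^ 1)"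
      by (intro Bochner_Integration.integrable_add integrable_mult_right integrable_std_gaussian_norm) auto
    fix z :: 'a
    have "norm ((y + sqrt s *\<^sub>R z) - (y' + sqrt t *\<^sub>R z)) = norm ((y - y') + (sqrt s - sqrt t) *\<^sub>R z)"
      by (simp add: algebra_simps)
    also have "\<dots> \<le> norm (y - y') + \<bar>sqrt s - sqrt t\<bar> * norm z"
      by (rule order_trans[OF norm_triangle_ineq]) simp
    finally have "L * norm ((y + sqrt s *\<^sub>R z) - (y' + sqrt t *\<^sub>R z)) \<le> L * (norm (y - y') + \<bar>sqrt s - sqrt t\<bar> * norm z)"
      using L by (rule mult_left_mono)
    with lip[of "y + sqrt s *\<^sub>R z" "y' + sqrt t *\<^sub>R z"]
    show "\<bar>\<phi> (y + sqrt s *\<^sub>R z) - \<phi> (y' + sqrt t *\<^sub>R z)\<bar> \<le> L * norm (y - y') + L * \<bar>sqrt s - sqrt t\<bar> * norm z ^ 1"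
      by (simp add: algebra_simps)
  qed (use int in auto)
  also have "\<dots> = L * norm (y - y') + L * \<bar>sqrt s - sqrt t\<bar> * gauss_norm_moment TYPE('a) 1"
    using integrable_std_gaussian_norm[of 1, where 'a='a]
    by (simp add: gauss_norm_moment_def)
  finally show ?thesis .
qed

text \<open>Supplies the event of probability 1/2 behind the two-valued test functions. The two open
  half-spaces are exchanged by \<open>uminus\<close>, and the hyperplane between them is
  null.\<close>

lemma std_gaussian_halfspace:
  fixes b :: "'a::euclidean_space"
  assumes b: "b \<in> Basis"
  shows "measure std_gaussian {z::'a. 0 < z \<bullet> b} = 1 / 2"
proof -
  have "measure std_gaussian {z::'a. z \<bullet> b < 0} = measure (distr std_gaussian borel uminus) {z::'a. z \<bullet> b < 0}"
    by (simp add: distr_std_gaussian_uminus)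
  also have "\<dots> = measure std_gaussian {z::'a. 0 < z \<bullet> b}"
    by (subst measure_distr) (auto intro!: arg_cong[where f="measure _"])
  finally have sym: "measure std_gaussian {z::'a. z \<bullet> b < 0} = measure std_gaussian {z::'a. 0 < z \<bullet> b}" .
  have "{z::'a. z \<bullet> b = 0} \<in> null_sets lebesgue"
    using negligible_standard_hyperplane[OF b, of 0] by (simp add: negligible_iff_null_sets inner_commute)
  then have "{z::'a. z \<bullet> b = 0} \<in> null_sets lborel"
    by (auto simp: null_sets_def)
  then have "emeasure std_gaussian {z::'a. z \<bullet> b = 0} = 0"
    unfolding std_gaussian_eq
    by (subst emeasure_density) (auto intro!: nn_integral_null_set simp: nn_integral_null_set)
  then have null: "measure std_gaussian {z::'a. z \<bullet> b = 0} = 0"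
    by (simp add: measure_def)
  have "1 = measure std_gaussian (({z::'a. 0 < z \<bullet> b} \<union> {z. z \<bullet> b < 0}) \<union> {z. z \<bullet> b = 0})"
  proof -
    have "({z::'a. 0 < z \<bullet> b} \<union> {z. z \<bullet> b < 0}) \<union> {z. z \<bullet> b = 0} = UNIV" by auto
    then show ?thesis by simp
  qed
  also have "\<dots> = measure std_gaussian {z::'a. 0 < z \<bullet> b} + measure std_gaussian {z::'a. z \<bullet> b < 0} + measure std_gaussian {z::'a. z \<bullet> b = 0}"
    by (subst std_gaussian.finite_measure_Union, simp, simp, force)+ simp
  finally show ?thesis
    using sym null by simp
qed

section \<open>The one-step expansion along a path\<close>

text \<open>The increment is cut into \<open>n + 1\<close> equal pieces. The quadratic remainders
  add up to order \<open>1 / (n + 1)\<close>, so the limit leaves the constant \<open>C\<close> at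
  every distance.\<close>

lemma C11_bound_lipschitz:
  assumes "C11_bound C g p"
  shows "\<bar>g (z + h) - g z\<bar> \<le> C * norm h"
proof -
  have quad: "\<bar>g (z + h) - g z - p z \<bullet> h\<bar> \<le> C * (norm h)\<^sup>2" and pC: "norm (p z) \<le> C" for z h
    using assms by (auto simp: C11_bound_def)
  have D: "\<bar>g (z + u + l) - g (z + u)\<bar> \<le> (C + C * norm l) * norm l" for u l
    using quad[of "z + u" l] Cauchy_Schwarz_ineq2[of "p (z + u)" l] mult_right_mono[OF pC[of "z + u"], of "norm l"]
    by (simp add: power2_eq_square algebra_simps)
  have n: "\<bar>g (z + h) - g z\<bar> \<le> (C + C * (norm h / real (Suc n))) * norm h" for n
  proof -
    define l where "l = h /\<^sub>R real (Suc n)"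
    have l: "norm l = norm h / real (Suc n)" by (simp add: l_def divide_inverse)
    have "\<bar>g (z + real j *\<^sub>R l) - g z\<bar> \<le> real j * ((C + C * norm l) * norm l)" for j
    proof (induction j)
      case (Suc j)
      have 1: "z + real (Suc j) *\<^sub>R l = z + real j *\<^sub>R l + l" by (simp add: algebra_simps)
      have 2: "real (Suc j) * ((C + C * norm l) * norm l) = real j * ((C + C * norm l) * norm l) + (C + C * norm l) * norm l"
        by (simp add: algebra_simps)
      show ?case
        unfolding 1 2 using D[of "real j *\<^sub>R l" l] Suc by linarith
    qed simp
    from this[of "Suc n"] show ?thesis
      unfolding l by (simp add: l_def del: of_nat_Suc)
  qed
  have "(\<lambda>n. (C + C * (norm h / real (Suc n))) * norm h) \<longlonglongrightarrow> (C + C * 0) * norm h"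
    by (intro tendsto_intros LIMSEQ_Suc[OF lim_const_over_n])
  from LIMSEQ_le_const[OF this] n show ?thesis by auto
qed

text \<open>All that the time-stepping argument retains of \<open>F\<close>. The interval
  \<open>{A..B}\<close> is the range of \<open>F\<close>, \<open>(G1 v)\<^sup>2 / (- G2 v)\<close>
  is \<open>F' / F''\<close> at \<open>G v\<close>, and \<open>bs v\<close> is the optimal discount
  rate, at which \<open>R_ge\<close> becomes an equality.\<close>

locale hjb_kernel =
  fixes A B L :: real and G G1 G2 bs R :: "real \<Rightarrow> real"
  assumes L_ge_1: "1 \<le> L"
    and cont: "continuous_on {A..B} G" "continuous_on {A..B} G1" "continuous_on {A..B} G2"
      "continuous_on {A..B} bs" "continuous_on UNIV R"
    and bounds: "\<And>v. v \<in> {A..B} \<Longrightarrow> \<bar>G v\<bar> \<le> L" "\<And>v. v \<in> {A..B} \<Longrightarrow> \<bar>G1 v\<bar> \<le> L"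
      "\<And>v. v \<in> {A..B} \<Longrightarrow> \<bar>G2 v\<bar> \<le> L" "\<And>v. v \<in> {A..B} \<Longrightarrow> \<bar>bs v\<bar> \<le> L"
      "\<And>v. v \<in> {A..B} \<Longrightarrow> \<bar>G2 v / G1 v\<bar> \<le> L"
    and signs: "\<And>v. v \<in> {A..B} \<Longrightarrow> 0 < G1 v" "\<And>v. v \<in> {A..B} \<Longrightarrow> G2 v < 0"
    and lipschitz: "\<And>v x. v \<in> {A..B} \<Longrightarrow> x \<in> {A..B} \<Longrightarrow> \<bar>G x - G v\<bar> \<le> L * \<bar>x - v\<bar>"
    and taylor: "\<And>v x. v \<in> {A..B} \<Longrightarrow> x \<in> {A..B} \<Longrightarrow>
      \<bar>G x - G v - G1 v * (x - v) - G2 v / 2 * (x - v)\<^sup>2\<bar> \<le> L * \<bar>x - v\<bar> ^ 3"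
    and R_ge: "\<And>v \<beta>. v \<in> {A..B} \<Longrightarrow> \<beta> * G v + (G1 v)\<^sup>2 / (- G2 v) \<le> R \<beta>"
    and R_eq: "\<And>v. v \<in> {A..B} \<Longrightarrow> R (bs v) = bs v * G v + (G1 v)\<^sup>2 / (- G2 v)"
begin

text \<open>The summands bound, in this order, the remainder of the exponential, the product of
  \<theta> with the change of \<open>G\<close>, the Taylor remainder, the error in the drift term
  and the error in the quadratic term, whose 9/2 is rounded up to 5.\<close>

definition step_const :: "real \<Rightarrow> real" where
  "step_const C = L * (C\<^sup>2 * exp C + 2 * C ^ 3 + 8 * C ^ 6 + C ^ 3 + 5 * C ^ 5)"

text \<open>Here \<open>s\<close> is the square root of the step length. The drift \<open>a\<close>,
  the exponent \<theta> and the time change \<open>g y - v0\<close> count as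
  \<open>s\<^sup>2\<close>, the noise \<open>w\<close> as \<open>s\<close>, and every term of total
  order three joins the remainder. Expanding \<open>g (y + w) - v0\<close> would leave an error of
  order two, because \<open>g\<close> is only C^{1,1}; it stays whole since its mean will
  vanish.\<close>

lemma one_step_pathwise:
  fixes g :: "'a::euclidean_space \<Rightarrow> real"
  assumes C11: "C11_bound C g p" and "1 \<le> C" and g: "\<And>y. g y \<in> {A..B}" and v0: "v0 \<in> {A..B}"
    and s: "0 < s" "s \<le> 1" and gv: "\<bar>g y - v0\<bar> \<le> C * s\<^sup>2" and a: "norm a \<le> C * s\<^sup>2" and \<theta>: "\<bar>\<theta>\<bar> \<le> C * s\<^sup>2"
  shows "\<bar>exp \<theta> * G (g (y + a + w)) - (G v0 + \<theta> * G v0 + G1 v0 * (g (y + w) - v0) + G1 v0 * (p y \<bullet> a)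
      + G2 v0 / 2 * (p y \<bullet> w)\<^sup>2)\<bar> \<le> step_const C * (s + norm w) ^ 3"
proof -
  define m where "m = s + norm w"
  define x where "x = g (y + a + w)"
  have x_in: "x \<in> {A..B}" using g by (simp add: x_def)
  have m: "0 < m" "s \<le> m" "norm w \<le> m" using s by (auto simp: m_def add_pos_nonneg)
  have C: "0 \<le> C" "0 < C" using \<open>1 \<le> C\<close> by auto
  have s2: "s\<^sup>2 \<le> s" "s\<^sup>2 \<le> m\<^sup>2" "s\<^sup>2 * m \<le> m ^ 3" "s ^ 4 \<le> m ^ 3"
  proof -
    show "s\<^sup>2 \<le> s" using s by (simp add: power2_eq_square mult_left_le)
    show "s\<^sup>2 \<le> m\<^sup>2" using s m by (intro power_mono) auto
    then have "s\<^sup>2 * m \<le> m\<^sup>2 * m" using m by (intro mult_right_mono) auto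
    then show "s\<^sup>2 * m \<le> m ^ 3" by (simp add: power2_eq_square power3_eq_cube)
    have "s ^ 4 \<le> s ^ 3" using s by (intro power_decreasing) auto
    also have "\<dots> \<le> m ^ 3" using s m by (intro power_mono) auto
    finally show "s ^ 4 \<le> m ^ 3" .
  qed
  have quad: "\<bar>g (z + h) - g z - p z \<bullet> h\<bar> \<le> C * (norm h)\<^sup>2" for z h
    using C11 by (auto simp: C11_bound_def)
  have pC: "norm (p z) \<le> C" and plip: "norm (p (z + h) - p z) \<le> C * norm h" for z h
    using C11 by (auto simp: C11_bound_def)
  have C_pow: "C \<le> C\<^sup>2" "C\<^sup>2 \<le> C ^ 3" "C \<le> C ^ 3"
    using power_increasing[of 1 2 C] power_increasing[of 2 3 C] power_increasing[of 1 3 C] \<open>1 \<le> C\<close> by auto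
  have aw: "norm (a + w) \<le> C * m"
  proof -
    have "norm (a + w) \<le> C * s\<^sup>2 + norm w"
      using norm_triangle_ineq[of a w] a by simp
    also have "\<dots> \<le> C * s + C * norm w"
      using s2(1) C \<open>1 \<le> C\<close> mult_right_mono[of 1 C "norm w"] by (intro add_mono mult_left_mono) auto
    finally show ?thesis by (simp add: m_def distrib_left)
  qed
  have pa: "\<bar>p y \<bullet> a\<bar> \<le> C\<^sup>2 * s\<^sup>2"
  proof -
    have "\<bar>p y \<bullet> a\<bar> \<le> norm (p y) * norm a" by (rule Cauchy_Schwarz_ineq2)
    also have "\<dots> \<le> C * (C * s\<^sup>2)" using pC a C by (intro mult_mono) auto
    finally show ?thesis by (simp add: power2_eq_square mult_ac)
  qed
  have pw: "\<bar>p y \<bullet> w\<bar> \<le> C * m"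
  proof -
    have "\<bar>p y \<bullet> w\<bar> \<le> norm (p y) * norm w" by (rule Cauchy_Schwarz_ineq2)
    also have "\<dots> \<le> C * m" using pC m C by (intro mult_mono) auto
    finally show ?thesis .
  qed
  \<comment> \<open>The drift acts from \<open>y + w\<close>; moving its gradient back to
    \<open>y\<close> costs \<open>norm w\<close> times \<open>norm a\<close>, already of order
    three.\<close>
  have first: "\<bar>x - g (y + w) - p y \<bullet> a\<bar> \<le> C ^ 3 * m ^ 3"
  proof -
    have "\<bar>(p (y + w) - p y) \<bullet> a\<bar> \<le> norm (p (y + w) - p y) * norm a" by (rule Cauchy_Schwarz_ineq2)
    also have "\<dots> \<le> (C * norm w) * (C * s\<^sup>2)"
      using plip a C by (intro mult_mono) auto
    finally have 1: "\<bar>(p (y + w) - p y) \<bullet> a\<bar> \<le> C\<^sup>2 * (s\<^sup>2 * norm w)"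
      by (simp add: power2_eq_square mult_ac)
    have "\<bar>g (y + w + a) - g (y + w) - p (y + w) \<bullet> a\<bar> \<le> C * (norm a)\<^sup>2" by (rule quad)
    also have "\<dots> \<le> C * (C * s\<^sup>2)\<^sup>2" using a C by (intro mult_left_mono power_mono) auto
    also have "\<dots> = C ^ 3 * (s\<^sup>2 * s\<^sup>2)" by (simp add: power2_eq_square power3_eq_cube)
    also have "\<dots> \<le> C ^ 3 * (s\<^sup>2 * s)" using s2(1) C by (intro mult_left_mono) auto
    finally have 2: "\<bar>g (y + w + a) - g (y + w) - p (y + w) \<bullet> a\<bar> \<le> C ^ 3 * (s\<^sup>2 * s)" .
    have "\<bar>x - g (y + w) - p y \<bullet> a\<bar> \<le> C ^ 3 * (s\<^sup>2 * s) + C\<^sup>2 * (s\<^sup>2 * norm w)"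
      using 1 2 by (simp add: x_def add_ac inner_diff_left)
    also have "\<dots> \<le> C ^ 3 * (s\<^sup>2 * s) + C ^ 3 * (s\<^sup>2 * norm w)"
      using C_pow s by (intro add_mono mult_right_mono) auto
    also have "\<dots> = C ^ 3 * (s\<^sup>2 * m)" by (simp add: m_def algebra_simps)
    also have "\<dots> \<le> C ^ 3 * m ^ 3" using s2(3) C by (intro mult_left_mono) auto
    finally show ?thesis .
  qed
  have second: "\<bar>x - v0 - p y \<bullet> w\<bar> \<le> 3 * C ^ 3 * m\<^sup>2"
  proof -
    have "\<bar>x - g y - p y \<bullet> (a + w)\<bar> \<le> C * (norm (a + w))\<^sup>2"
      using quad[of y "a + w"] by (simp add: x_def add_ac)
    also have "\<dots> \<le> C * (C * m)\<^sup>2" using aw C by (intro mult_left_mono power_mono) auto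
    finally have "\<bar>x - g y - p y \<bullet> (a + w)\<bar> \<le> C ^ 3 * m\<^sup>2"
      by (simp add: power2_eq_square power3_eq_cube mult_ac)
    moreover have "C\<^sup>2 * s\<^sup>2 \<le> C ^ 3 * m\<^sup>2" "C * s\<^sup>2 \<le> C ^ 3 * m\<^sup>2"
      using C_pow s2 C by (auto intro!: mult_mono)
    ultimately show ?thesis
      using pa gv by (simp add: inner_add_right)
  qed
  have third: "\<bar>x - v0\<bar> \<le> 2 * C\<^sup>2 * m"
  proof -
    have "\<bar>x - v0\<bar> \<le> C * norm (a + w) + C * s\<^sup>2"
      using C11_bound_lipschitz[OF C11, of y "a + w"] gv by (simp add: x_def add_ac)
    also have "\<dots> \<le> C * (C * m) + C * m"
      using aw C s2(1) m by (intro add_mono mult_left_mono) auto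
    also have "\<dots> \<le> 2 * C\<^sup>2 * m"
      using C_pow(1) m mult_right_mono[of C "C\<^sup>2" m] by (simp add: power2_eq_square mult_ac)
    finally show ?thesis .
  qed
  \<comment> \<open>A difference of squares: one factor has order two by \<open>second\<close>, the
    other order one.\<close>
  have sq: "\<bar>(x - v0)\<^sup>2 - (p y \<bullet> w)\<^sup>2\<bar> \<le> 9 * C ^ 5 * m ^ 3"
  proof -
    have "\<bar>x - v0 + p y \<bullet> w\<bar> \<le> 2 * C\<^sup>2 * m + C * m" using third pw by linarith
    also have "\<dots> \<le> 3 * C\<^sup>2 * m" using C_pow(1) m mult_right_mono[of C "C\<^sup>2" m] by simp
    finally have "\<bar>x - v0 - p y \<bullet> w\<bar> * \<bar>x - v0 + p y \<bullet> w\<bar> \<le> (3 * C ^ 3 * m\<^sup>2) * (3 * C\<^sup>2 * m)"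
      using second C m by (intro mult_mono) auto
    also have "\<dots> = 9 * C ^ 5 * m ^ 3"
      by (simp add: power2_eq_square power3_eq_cube numeral_eq_Suc)
    finally show ?thesis
      by (simp add: abs_mult[symmetric] power2_eq_square algebra_simps)
  qed
  have cube: "\<bar>x - v0\<bar> ^ 3 \<le> 8 * C ^ 6 * m ^ 3"
  proof -
    have "\<bar>x - v0\<bar> ^ 3 \<le> (2 * C\<^sup>2 * m) ^ 3" using third by (intro power_mono) auto
    then show ?thesis by (simp add: power_mult_distrib)
  qed
  have expb: "\<bar>exp \<theta> - 1 - \<theta>\<bar> \<le> C\<^sup>2 * exp C * m ^ 3"
  proof -
    have "\<bar>\<theta>\<bar> \<le> C" using \<theta> s C by (meson mult_left_le order_trans power_le_one less_imp_le)
    have "\<bar>exp \<theta> - 1 - \<theta>\<bar> \<le> \<theta>\<^sup>2 * exp \<bar>\<theta>\<bar>"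
    proof -
      obtain t where t: "\<bar>t\<bar> \<le> \<bar>\<theta>\<bar>" "exp \<theta> = (\<Sum>m<2. \<theta> ^ m / fact m) + exp t / fact 2 * \<theta> ^ 2"
        using Maclaurin_exp_le[of \<theta> 2] by blast
      then have "\<bar>exp \<theta> - 1 - \<theta>\<bar> = exp t / 2 * \<theta>\<^sup>2"
        by (simp add: numeral_2_eq_2 abs_mult)
      also have "\<dots> \<le> exp \<bar>\<theta>\<bar> * \<theta>\<^sup>2"
        using t(1) by (intro mult_right_mono order_trans[OF _ exp_mono[of t "\<bar>\<theta>\<bar>"]]) auto
      finally show ?thesis by (simp add: mult.commute)
    qed
    also have "\<dots> \<le> (C * s\<^sup>2)\<^sup>2 * exp C"
      using \<theta> \<open>\<bar>\<theta>\<bar> \<le> C\<close> C power_mono[OF \<theta>, of 2] by (intro mult_mono) auto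
    also have "\<dots> = C\<^sup>2 * exp C * s ^ 4" by (simp add: power_mult_distrib)
    also have "\<dots> \<le> C\<^sup>2 * exp C * m ^ 3" using s2(4) by (intro mult_left_mono) auto
    finally show ?thesis .
  qed
  have L0: "0 \<le> L" using L_ge_1 by simp
  have "exp \<theta> * G x - (G v0 + \<theta> * G v0 + G1 v0 * (g (y + w) - v0) + G1 v0 * (p y \<bullet> a) + G2 v0 / 2 * (p y \<bullet> w)\<^sup>2)
    = (exp \<theta> - 1 - \<theta>) * G x + \<theta> * (G x - G v0) + (G x - G v0 - G1 v0 * (x - v0) - G2 v0 / 2 * (x - v0)\<^sup>2)
      + G1 v0 * (x - g (y + w) - p y \<bullet> a) + G2 v0 / 2 * ((x - v0)\<^sup>2 - (p y \<bullet> w)\<^sup>2)"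
    by (simp add: algebra_simps)
  also have "\<bar>\<dots>\<bar> \<le> \<bar>exp \<theta> - 1 - \<theta>\<bar> * \<bar>G x\<bar> + \<bar>\<theta>\<bar> * \<bar>G x - G v0\<bar> + \<bar>G x - G v0 - G1 v0 * (x - v0) - G2 v0 / 2 * (x - v0)\<^sup>2\<bar>
      + \<bar>G1 v0\<bar> * \<bar>x - g (y + w) - p y \<bullet> a\<bar> + \<bar>G2 v0\<bar> / 2 * \<bar>(x - v0)\<^sup>2 - (p y \<bullet> w)\<^sup>2\<bar>"
    by (intro order_trans[OF abs_triangle_ineq] add_mono) (simp_all add: abs_mult)
  also have "\<dots> \<le> (C\<^sup>2 * exp C * m ^ 3) * L + (2 * C ^ 3 * m ^ 3) * L + L * (8 * C ^ 6 * m ^ 3) + L * (C ^ 3 * m ^ 3)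
      + L / 2 * (9 * C ^ 5 * m ^ 3)"
  proof (intro add_mono)
    show "\<bar>exp \<theta> - 1 - \<theta>\<bar> * \<bar>G x\<bar> \<le> (C\<^sup>2 * exp C * m ^ 3) * L"
      using expb bounds(1)[OF x_in] L0 m by (intro mult_mono) auto
    have "\<bar>\<theta>\<bar> * \<bar>G x - G v0\<bar> \<le> (C * s\<^sup>2) * (L * (2 * C\<^sup>2 * m))"
      using \<theta> order_trans[OF lipschitz[OF v0 x_in] mult_left_mono[OF third L0]] C by (intro mult_mono) auto
    also have "\<dots> = 2 * C ^ 3 * L * (s\<^sup>2 * m)" by (simp add: power2_eq_square power3_eq_cube)
    also have "\<dots> \<le> 2 * C ^ 3 * L * m ^ 3" using s2(3) C L0 by (intro mult_left_mono) auto
    finally show "\<bar>\<theta>\<bar> * \<bar>G x - G v0\<bar> \<le> (2 * C ^ 3 * m ^ 3) * L" by (simp add: mult_ac)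
    show "\<bar>G x - G v0 - G1 v0 * (x - v0) - G2 v0 / 2 * (x - v0)\<^sup>2\<bar> \<le> L * (8 * C ^ 6 * m ^ 3)"
      using order_trans[OF taylor[OF v0 x_in] mult_left_mono[OF cube L0]] .
    show "\<bar>G1 v0\<bar> * \<bar>x - g (y + w) - p y \<bullet> a\<bar> \<le> L * (C ^ 3 * m ^ 3)"
      using first bounds(2)[OF v0] L0 by (intro mult_mono) auto
    show "\<bar>G2 v0\<bar> / 2 * \<bar>(x - v0)\<^sup>2 - (p y \<bullet> w)\<^sup>2\<bar> \<le> L / 2 * (9 * C ^ 5 * m ^ 3)"
      using sq bounds(3)[OF v0] L0 by (intro mult_mono) auto
  qed
  also have "\<dots> \<le> step_const C * m ^ 3"
  proof -
    have "0 \<le> L * C ^ 5 * m ^ 3" using L0 C m by simp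
    then show ?thesis by (simp add: step_const_def algebra_simps)
  qed
  finally show ?thesis by (simp add: x_def m_def)
qed

text \<open>Completing the square; this is the pointwise Hamilton--Jacobi--Bellman inequality.\<close>

lemma running_gain_nonpos:
  fixes p \<alpha> :: "'a::real_inner"
  assumes v: "v \<in> {A..B}"
  shows "1/2 * (\<beta> * (norm \<alpha>)\<^sup>2) * G v + G1 v * (p \<bullet> \<alpha>) + G2 v / 2 * (norm p)\<^sup>2 - 1/2 * (R \<beta> * (norm \<alpha>)\<^sup>2) \<le> 0"
proof -
  define c where "c = - G2 v"
  have c: "0 < c" using signs[OF v] by (simp add: c_def)
  have "(\<beta> * G v - R \<beta>) * (norm \<alpha>)\<^sup>2 \<le> - ((G1 v)\<^sup>2 / c) * (norm \<alpha>)\<^sup>2"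
    using R_ge[OF v, of \<beta>] by (intro mult_right_mono) (auto simp: c_def)
  moreover have "0 \<le> (norm ((G1 v / c) *\<^sub>R \<alpha> - p))\<^sup>2 * c" using c by simp
  moreover have "(norm ((G1 v / c) *\<^sub>R \<alpha> - p))\<^sup>2 * c = (G1 v)\<^sup>2 / c * (norm \<alpha>)\<^sup>2 - 2 * G1 v * (p \<bullet> \<alpha>) + c * (norm p)\<^sup>2"
    using c unfolding power2_norm_eq_inner
    by (simp add: inner_diff_left inner_diff_right inner_commute power2_eq_square field_simps)
  ultimately show ?thesis by (simp add: c_def algebra_simps)
qed

text \<open>For this \<alpha> the square completed in \<open>running_gain_nonpos\<close> is zero,
  and at the rate \<open>bs v\<close> the bound \<open>R_ge\<close> is attained. If \<open>p\<close>
  is the gradient of \<open>v\<close>, then \<alpha> is \<open>F'' / F'\<close> times the gradient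
  of \<open>G v\<close>.\<close>

lemma running_gain_optimal:
  fixes p :: "'a::real_inner"
  assumes v: "v \<in> {A..B}"
  defines "\<alpha> \<equiv> (- G2 v / G1 v) *\<^sub>R p"
  shows "1/2 * (bs v * (norm \<alpha>)\<^sup>2) * G v + G1 v * (p \<bullet> \<alpha>) + G2 v / 2 * (norm p)\<^sup>2 - 1/2 * (R (bs v) * (norm \<alpha>)\<^sup>2) = 0"
proof -
  have *: "p \<bullet> \<alpha> = - G2 v / G1 v * (norm p)\<^sup>2" "(norm \<alpha>)\<^sup>2 = (G2 v / G1 v)\<^sup>2 * (norm p)\<^sup>2"
    unfolding \<alpha>_def power2_norm_eq_inner by (simp_all add: power2_eq_square)
  show ?thesis
    unfolding R_eq[OF v] * using signs[OF v] by (simp add: field_simps power2_eq_square)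
qed

end

section \<open>Time integrals along bounded paths\<close>

definition bounded_path :: "real \<Rightarrow> (real \<Rightarrow> 'b::euclidean_space) \<Rightarrow> bool" where
  "bounded_path C x \<longleftrightarrow> (\<lambda>s. indicator {0..1} s *\<^sub>R x s) \<in> borel_measurable borel \<and> (\<forall>s\<in>{0..1}. norm (x s) \<le> C)"

lemma bounded_path_integrable:
  assumes x: "bounded_path C x" and "0 \<le> u" "t \<le> 1"
  shows "set_integrable lborel {u..t} x"
  unfolding set_integrable_def
proof (rule Bochner_Integration.integrable_bound)
  show "integrable lborel (\<lambda>s. indicator {u..t} s *\<^sub>R C)"
    by (intro integrable_indicator) (auto simp: emeasure_lborel_Icc_eq)
  have eq: "indicator {u..t} s *\<^sub>R x s = indicator {u..t} s *\<^sub>R (indicator {0..1} s *\<^sub>R x s)" for s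
    using assms by (auto simp: indicator_def)
  show "(\<lambda>s. indicator {u..t} s *\<^sub>R x s) \<in> borel_measurable lborel"
    unfolding eq by (rule borel_measurable_scaleR) (use x in \<open>auto simp: bounded_path_def\<close>)
  show "AE s in lborel. norm (indicator {u..t} s *\<^sub>R x s) \<le> norm (indicator {u..t} s *\<^sub>R C)"
    using assms by (auto simp: bounded_path_def indicator_def intro!: AE_I2 order_trans[OF _ abs_ge_self])
qed

lemma bounded_path_integral_add:
  assumes x: "bounded_path C x" and "0 \<le> u" "u \<le> t" "t \<le> t'" "t' \<le> 1"
  shows "(LINT s:{u..t'}|lborel. x s) = (LINT s:{u..t}|lborel. x s) + (LINT s:{t..t'}|lborel. x s)"
proof -
  have "{u..t'} = {u..t} \<union> {t..t'}" using assms by auto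
  moreover have "AE s in lborel. \<not> (s \<in> {u..t} \<and> s \<in> {t..t'})"
    using AE_lborel_singleton[of t] by eventually_elim auto
  ultimately show ?thesis
    using assms by (simp add: set_integral_Un_AE bounded_path_integrable[OF x])
qed

lemma bounded_path_integral_norm_le:
  assumes x: "bounded_path C x" and "0 \<le> u" "u \<le> t" "t \<le> 1"
  shows "norm (LINT s:{u..t}|lborel. x s) \<le> C * (t - u)"
proof -
  have int: "set_integrable lborel {u..t} x"
    using assms by (intro bounded_path_integrable[OF x])
  have "norm (LINT s:{u..t}|lborel. x s) \<le> (LINT s:{u..t}|lborel. norm (x s))"
    by (rule set_integral_norm_bound[OF int])
  also have "\<dots> \<le> (LINT s:{u..t}|lborel. C)"
    using assms by (intro set_integral_mono set_integrable_norm[OF int]) (auto simp: bounded_path_def set_integrable_def)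
  also have "\<dots> = C * (t - u)"
    using assms by (simp add: set_lebesgue_integral_def)
  finally show ?thesis .
qed

section \<open>Controls and independent increments\<close>

text \<open>Turns progressive measurability, stated on a restricted time interval, into
  measurability over the whole time axis, where parameter integrals against Lebesgue measure are
  measurable.\<close>

lemma measurable_extend_by_indicator:
  fixes f :: "real \<times> 'w \<Rightarrow> 'b::euclidean_space"
  assumes f: "f \<in> borel_measurable (restrict_space borel S \<Otimes>\<^sub>M N)" and S: "S \<in> sets borel"
  shows "(\<lambda>(s, \<omega>). indicator S s *\<^sub>R f (s, \<omega>)) \<in> borel_measurable (borel \<Otimes>\<^sub>M N)"
proof -
  let ?X = "S \<times> space N"
  have X: "?X \<inter> space (borel \<Otimes>\<^sub>M N) \<in> sets (borel \<Otimes>\<^sub>M N)"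
    using S by (auto simp: space_pair_measure intro!: sets.Int)
  have "(\<lambda>x. x) \<in> restrict_space (borel \<Otimes>\<^sub>M N) ?X \<rightarrow>\<^sub>M restrict_space borel S \<Otimes>\<^sub>M N"
  proof (rule measurable_pair)
    show "fst \<circ> (\<lambda>x. x) \<in> restrict_space (borel \<Otimes>\<^sub>M N) ?X \<rightarrow>\<^sub>M restrict_space borel S"
      by (intro measurable_restrict_space2 measurable_restrict_space1) (auto simp: space_restrict_space o_def)
    show "snd \<circ> (\<lambda>x. x) \<in> restrict_space (borel \<Otimes>\<^sub>M N) ?X \<rightarrow>\<^sub>M N"
      by (intro measurable_restrict_space1) (auto simp: o_def)
  qed
  from measurable_compose[OF this f] have "(\<lambda>x. indicator ?X x *\<^sub>R f x) \<in> borel_measurable (borel \<Otimes>\<^sub>M N)"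
    by (subst (asm) borel_measurable_restrict_space_iff[OF X]) simp
  then show ?thesis
    by (rule measurable_cong[THEN iffD1, rotated]) (auto simp: space_pair_measure indicator_def)
qed

text \<open>The indicator confines the measurability requirement to \<open>{0..1}\<close>; a control
  is unconstrained at other times.\<close>

definition jointly_bounded :: "'w measure \<Rightarrow> real \<Rightarrow> (real \<Rightarrow> 'w \<Rightarrow> 'b::euclidean_space) \<Rightarrow> bool" where
  "jointly_bounded M C X \<longleftrightarrow> (\<lambda>(s, \<omega>). indicator {0..1} s *\<^sub>R X s \<omega>) \<in> borel_measurable (borel \<Otimes>\<^sub>M M) \<and>
     (\<forall>s\<in>{0..1}. \<forall>\<omega>\<in>space M. norm (X s \<omega>) \<le> C)"

lemma jointly_bounded_path: "jointly_bounded M C X \<Longrightarrow> \<omega> \<in> space M \<Longrightarrow> bounded_path C (\<lambda>s. X s \<omega>)"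
  unfolding jointly_bounded_def bounded_path_def
  using measurable_Pair1[of "\<lambda>(s, \<omega>). indicator {0..1} s *\<^sub>R X s \<omega>" borel M borel \<omega>] by simp

lemma jointly_bounded_integral_measurable:
  assumes X: "jointly_bounded M C X" and "0 \<le> u" "t \<le> 1"
  shows "(\<lambda>\<omega>. LINT s:{u..t}|lborel. X s \<omega>) \<in> borel_measurable M"
proof -
  have "sets (M \<Otimes>\<^sub>M lborel) = sets (M \<Otimes>\<^sub>M (borel :: real measure))"
    by (intro sets_pair_measure_cong) auto
  note cong = measurable_cong_sets[OF this refl]
  have [measurable]: "(\<lambda>z. indicator {0..1} (snd z) *\<^sub>R X (snd z) (fst z)) \<in> borel_measurable (M \<Otimes>\<^sub>M lborel)"
    using X measurable_pair_swap[of "\<lambda>(s, \<omega>). indicator {0..1} s *\<^sub>R X s \<omega>" borel M borel]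
    unfolding cong by (simp add: jointly_bounded_def split_beta')
  have "(\<lambda>z. indicator {u..t} (snd z) *\<^sub>R (indicator {0..1} (snd z) *\<^sub>R X (snd z) (fst z))) \<in> borel_measurable (M \<Otimes>\<^sub>M lborel)"
    by (rule borel_measurable_scaleR) measurable
  then have "(\<lambda>(\<omega>, s). indicator {u..t} s *\<^sub>R (indicator {0..1} s *\<^sub>R X s \<omega>)) \<in> borel_measurable (M \<Otimes>\<^sub>M lborel)"
    by (simp only: split_beta')
  then have "(\<lambda>\<omega>. LINT s|lborel. indicator {u..t} s *\<^sub>R (indicator {0..1} s *\<^sub>R X s \<omega>)) \<in> borel_measurable M"
    by (rule lborel.borel_measurable_lebesgue_integral)
  moreover have "indicator {u..t} s *\<^sub>R (indicator {0..1} s *\<^sub>R X s \<omega>) = indicator {u..t} s *\<^sub>R X s \<omega>" for s \<omega>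
    using assms(2,3) by (auto simp: indicator_def)
  ultimately show ?thesis by (simp only: set_lebesgue_integral_def)
qed

lemma jointly_bounded_weighted_square:
  fixes X :: "real \<Rightarrow> 'w \<Rightarrow> 'b::euclidean_space"
  assumes X: "jointly_bounded M C X" and Z: "jointly_bounded M K Z"
    and R: "R \<in> borel_measurable borel" "\<And>z. \<bar>z\<bar> \<le> K \<Longrightarrow> \<bar>R z\<bar> \<le> K'" and "0 \<le> C" "0 \<le> K'"
  shows "jointly_bounded M (K' * C\<^sup>2) (\<lambda>s \<omega>. R (Z s \<omega>) * (norm (X s \<omega>))\<^sup>2)"
  unfolding jointly_bounded_def
proof (intro conjI ballI)
  have [measurable]: "(\<lambda>x. indicator {0..1} (fst x) *\<^sub>R X (fst x) (snd x)) \<in> borel_measurable (borel \<Otimes>\<^sub>M M)"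
    "(\<lambda>x. indicator {0..1} (fst x) *\<^sub>R Z (fst x) (snd x)) \<in> borel_measurable (borel \<Otimes>\<^sub>M M)"
    using X Z by (auto simp: jointly_bounded_def split_beta')
  have "(\<lambda>x. R (indicator {0..1} (fst x) *\<^sub>R Z (fst x) (snd x)) * (norm (indicator {0..1} (fst x) *\<^sub>R X (fst x) (snd x)))\<^sup>2)
      \<in> borel_measurable (borel \<Otimes>\<^sub>M M)"
    using R(1) by measurable
  also have "(\<lambda>x. R (indicator {0..1} (fst x) *\<^sub>R Z (fst x) (snd x)) * (norm (indicator {0..1} (fst x) *\<^sub>R X (fst x) (snd x)))\<^sup>2)
      = (\<lambda>(s, \<omega>). indicator {0..1} s *\<^sub>R (R (Z s \<omega>) * (norm (X s \<omega>))\<^sup>2))"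
    by (auto simp: indicator_def fun_eq_iff)
  finally show "(\<lambda>(s, \<omega>). indicator {0..1} s *\<^sub>R (R (Z s \<omega>) * (norm (X s \<omega>))\<^sup>2)) \<in> borel_measurable (borel \<Otimes>\<^sub>M M)" .
  fix s \<omega> assume "s \<in> {0..1::real}" "\<omega> \<in> space M"
  then have "\<bar>R (Z s \<omega>)\<bar> \<le> K'" "norm (X s \<omega>) \<le> C"
    using X Z R(2) by (auto simp: jointly_bounded_def)
  then show "norm (R (Z s \<omega>) * (norm (X s \<omega>))\<^sup>2) \<le> K' * C\<^sup>2"
    using \<open>0 \<le> K'\<close> by (auto simp: abs_mult intro!: mult_mono power_mono)
qed

lemma jointly_bounded_mult:
  fixes X Z :: "real \<Rightarrow> 'w \<Rightarrow> real"
  assumes X: "jointly_bounded M C X" and Z: "jointly_bounded M K Z" and "0 \<le> C"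
  shows "jointly_bounded M (C * K) (\<lambda>s \<omega>. X s \<omega> * Z s \<omega>)"
  unfolding jointly_bounded_def
proof (intro conjI ballI)
  have "(\<lambda>x. (indicator {0..1} (fst x) *\<^sub>R X (fst x) (snd x)) * (indicator {0..1} (fst x) *\<^sub>R Z (fst x) (snd x))) \<in> borel_measurable (borel \<Otimes>\<^sub>M M)"
    using X Z by (auto simp: jointly_bounded_def split_beta' intro: borel_measurable_times)
  also have "(\<lambda>x. (indicator {0..1} (fst x) *\<^sub>R X (fst x) (snd x)) * (indicator {0..1} (fst x) *\<^sub>R Z (fst x) (snd x)))
    = (\<lambda>(s, \<omega>). indicator {0..1} s *\<^sub>R (X s \<omega> * Z s \<omega>))"
    by (auto simp: indicator_def fun_eq_iff)
  finally show "(\<lambda>(s, \<omega>). indicator {0..1} s *\<^sub>R (X s \<omega> * Z s \<omega>)) \<in> borel_measurable (borel \<Otimes>\<^sub>M M)" .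
  fix s \<omega> assume "s \<in> {0..1::real}" "\<omega> \<in> space M"
  then show "norm (X s \<omega> * Z s \<omega>) \<le> C * K"
    using X Z \<open>0 \<le> C\<close> by (auto simp: jointly_bounded_def abs_mult intro!: mult_mono)
qed

text \<open>The discount is integrated over time in the cost, so it must be measurable jointly in
  time and scenario. It is therefore treated as a parameter integral whose upper limit is one of the
  parameters.\<close>

lemma jointly_bounded_discount:
  fixes \<alpha> :: "real \<Rightarrow> 'w \<Rightarrow> 'a::euclidean_space"
  assumes X: "jointly_bounded M C (\<lambda>s \<omega>. \<beta> s \<omega> * (norm (\<alpha> s \<omega>))\<^sup>2)"
  shows "jointly_bounded M (exp (C / 2)) (discount \<alpha> \<beta>)"
    and "\<And>s \<omega>. s \<in> {0..1} \<Longrightarrow> \<omega> \<in> space M \<Longrightarrow> discount \<alpha> \<beta> s \<omega> \<le> exp (C / 2)"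
proof -
  let ?h = "\<lambda>s \<omega>. \<beta> s \<omega> * (norm (\<alpha> s \<omega>))\<^sup>2"
  show le: "discount \<alpha> \<beta> s \<omega> \<le> exp (C / 2)" if "s \<in> {0..1}" "\<omega> \<in> space M" for s \<omega>
  proof -
    have "norm (?h s \<omega>) \<le> C" using X that unfolding jointly_bounded_def by blast
    then have "0 \<le> C" by (rule order_trans[OF norm_ge_zero])
    have "norm (LINT r:{0..s}|lborel. ?h r \<omega>) \<le> C * (s - 0)"
      using that by (intro bounded_path_integral_norm_le[OF jointly_bounded_path[OF X that(2)]]) auto
    also have "\<dots> \<le> C" using that \<open>0 \<le> C\<close> by (simp add: mult_left_le)
    finally show ?thesis by (simp add: discount_def)
  qed
  have "(\<lambda>((t, \<omega>), s). indicator {0..t} s *\<^sub>R (indicator {0..1} s *\<^sub>R ?h s \<omega>)) \<in> borel_measurable ((borel \<Otimes>\<^sub>M M) \<Otimes>\<^sub>M lborel)"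
  proof -
    have h: "(\<lambda>x. indicator {0..1} (fst x) *\<^sub>R ?h (fst x) (snd x)) \<in> borel_measurable (borel \<Otimes>\<^sub>M M)"
      using X by (auto simp: jointly_bounded_def split_beta')
    have "(\<lambda>z. (snd z, snd (fst z))) \<in> (borel \<Otimes>\<^sub>M M) \<Otimes>\<^sub>M lborel \<rightarrow>\<^sub>M borel \<Otimes>\<^sub>M M"
      by measurable
    from measurable_compose[OF this h] have [measurable]:
      "(\<lambda>z. indicator {0..1} (snd z) *\<^sub>R ?h (snd z) (snd (fst z))) \<in> borel_measurable ((borel \<Otimes>\<^sub>M M) \<Otimes>\<^sub>M lborel)"
      by simp
    \<comment> \<open>As the upper limit varies, the indicator of the integration interval is
      spelled out as a condition on the pair of times.\<close>
    have "(\<lambda>z. (if 0 \<le> snd z \<and> snd z \<le> fst (fst z) then 1 else 0) *\<^sub>R (indicator {0..1} (snd z) *\<^sub>R ?h (snd z) (snd (fst z))))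
       \<in> borel_measurable ((borel \<Otimes>\<^sub>M M) \<Otimes>\<^sub>M lborel)"
      by measurable
    then show ?thesis
      by (rule measurable_cong[THEN iffD1, rotated]) (auto simp: indicator_def)
  qed
  then have "(\<lambda>(t, \<omega>). LINT s|lborel. indicator {0..t} s *\<^sub>R (indicator {0..1} s *\<^sub>R ?h s \<omega>)) \<in> borel_measurable (borel \<Otimes>\<^sub>M M)"
    using lborel.borel_measurable_lebesgue_integral[of "\<lambda>x s. indicator {0..fst x} s *\<^sub>R (indicator {0..1} s *\<^sub>R ?h s (snd x))" "borel \<Otimes>\<^sub>M M"]
    by (simp add: split_beta')
  then have "(\<lambda>x. indicator {0..1} (fst x) *\<^sub>R exp (1/2 * (LINT s|lborel. indicator {0..fst x} s *\<^sub>R (indicator {0..1} s *\<^sub>R ?h s (snd x))))) \<in> borel_measurable (borel \<Otimes>\<^sub>M M)"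
    by (simp add: split_beta') measurable
  also have "(\<lambda>x. indicator {0..1} (fst x) *\<^sub>R exp (1/2 * (LINT s|lborel. indicator {0..fst x} s *\<^sub>R (indicator {0..1} s *\<^sub>R ?h s (snd x)))))
    = (\<lambda>(t, \<omega>). indicator {0..1} t *\<^sub>R discount \<alpha> \<beta> t \<omega>)"
  proof (intro ext, clarify)
    fix t \<omega>
    have "indicator {0..t} s *\<^sub>R (indicator {0..1} s *\<^sub>R ?h s \<omega>) = indicator {0..t} s *\<^sub>R ?h s \<omega>" if "t \<in> {0..1}" for s
      using that by (auto simp: indicator_def)
    then show "indicator {0..1} (fst (t, \<omega>)) *\<^sub>R exp (1/2 * (LINT s|lborel. indicator {0..fst (t, \<omega>)} s *\<^sub>R (indicator {0..1} s *\<^sub>R ?h s (snd (t, \<omega>)))))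
      = indicator {0..1} t *\<^sub>R discount \<alpha> \<beta> t \<omega>"
      by (cases "t \<in> {0..1}")
        (simp_all only: discount_def set_lebesgue_integral_def fst_conv snd_conv indicator_simps(2) scale_zero_left not_False_eq_True)
  qed
  finally show "jointly_bounded M (exp (C / 2)) (discount \<alpha> \<beta>)"
    using le unfolding jointly_bounded_def by (auto simp: discount_def)
qed

section \<open>Adaptedness of integrals and discounts\<close>

context usual_filtered_prob_space
begin

lemma Ft_measurable: "0 \<le> t \<Longrightarrow> f \<in> measurable (Ft t) N \<Longrightarrow> f \<in> measurable M N"
  by (rule measurable_from_subalg[OF Ft_subalgebra])

lemma Ft_measurable_mono: "0 \<le> s \<Longrightarrow> s \<le> t \<Longrightarrow> f \<in> measurable (Ft s) N \<Longrightarrow> f \<in> measurable (Ft t) N"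
  using Ft_mono[of s t] Ft_subalgebra[of s] Ft_subalgebra[of t]
  by (intro measurable_from_subalg[of "Ft t" "Ft s"]) (auto simp: subalgebra_def)

lemma space_Ft: "0 \<le> t \<Longrightarrow> space (Ft t) = space M"
  using Ft_subalgebra[of t] by (simp add: subalgebra_def)

lemma progressive_integral_measurable:
  assumes X: "progressively_measurable Ft X" and t: "0 \<le> t" "t \<le> 1"
  shows "(\<lambda>\<omega>. LINT s:{0..t}|lborel. X s \<omega>) \<in> borel_measurable (Ft t)"
proof -
  have "(\<lambda>(s, \<omega>). indicator {0..t} s *\<^sub>R X s \<omega>) \<in> borel_measurable (borel \<Otimes>\<^sub>M Ft t)"
    using measurable_extend_by_indicator[of "\<lambda>(s, \<omega>). X s \<omega>" "{0..t}" "Ft t"] X t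
    by (simp add: progressively_measurable_def)
  from measurable_pair_swap[OF this]
  have "(\<lambda>(\<omega>, s). indicator {0..t} s *\<^sub>R X s \<omega>) \<in> borel_measurable (Ft t \<Otimes>\<^sub>M lborel)"
    by (simp add: split_beta')
  from lborel.borel_measurable_lebesgue_integral[OF this] show ?thesis
    by (simp add: set_lebesgue_integral_def)
qed

lemma progressive_jointly_bounded:
  assumes X: "progressively_measurable Ft X" and "\<And>t \<omega>. t \<in> {0..1} \<Longrightarrow> \<omega> \<in> space M \<Longrightarrow> norm (X t \<omega>) \<le> C"
  shows "jointly_bounded M C X"
proof -
  have "(\<lambda>(s, \<omega>). indicator {0..1} s *\<^sub>R X s \<omega>) \<in> borel_measurable (borel \<Otimes>\<^sub>M Ft 1)"
    using measurable_extend_by_indicator[of "\<lambda>(s, \<omega>). X s \<omega>" "{0..1}" "Ft 1"] X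
    by (simp add: progressively_measurable_def)
  moreover have "(\<lambda>x. x) \<in> borel \<Otimes>\<^sub>M M \<rightarrow>\<^sub>M borel \<Otimes>\<^sub>M Ft 1"
    using Ft_measurable[of 1 "\<lambda>x. x" "Ft 1"]
    by (intro measurable_pair) (auto simp: o_def intro: measurable_compose[OF measurable_snd])
  ultimately show ?thesis
    unfolding jointly_bounded_def using assms(2) measurable_compose by blast
qed

lemma progressive_weighted_square:
  fixes \<alpha> :: "real \<Rightarrow> 'w \<Rightarrow> 'b::euclidean_space"
  assumes "progressively_measurable Ft \<alpha>" "progressively_measurable Ft \<beta>"
  shows "progressively_measurable Ft (\<lambda>s \<omega>. \<beta> s \<omega> * (norm (\<alpha> s \<omega>))\<^sup>2)"
  using assms unfolding progressively_measurable_def split_beta'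
  by (auto intro!: borel_measurable_times borel_measurable_power borel_measurable_norm)

lemma discount_adapted:
  assumes "progressively_measurable Ft \<alpha>" "progressively_measurable Ft \<beta>" "0 \<le> t" "t \<le> 1"
  shows "discount \<alpha> \<beta> t \<in> borel_measurable (Ft t)"
  using progressive_integral_measurable[OF progressive_weighted_square[OF assms(1,2)] assms(3,4)]
  unfolding discount_def[abs_def] by measurable

end

section \<open>Brownian increments as Gaussian integrals\<close>

context std_brownian_motion
begin

lemma W_measurable[measurable]: "0 \<le> t \<Longrightarrow> W t \<in> borel_measurable M"
  using W_adapted Ft_measurable by blast

lemma
  fixes h :: "'a \<Rightarrow> real"
  assumes [measurable]: "h \<in> borel_measurable borel" and st: "0 \<le> s" "s \<le> t"
  shows integrable_increment: "integrable M (\<lambda>\<omega>. h (W t \<omega> - W s \<omega>)) \<longleftrightarrow> integrable std_gaussian (\<lambda>z. h (sqrt (t - s) *\<^sub>R z))"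
    and expectation_increment: "(\<integral>\<omega>. h (W t \<omega> - W s \<omega>) \<partial>M) = (\<integral>z. h (sqrt (t - s) *\<^sub>R z) \<partial>std_gaussian)"
proof -
  have [measurable]: "W t \<in> borel_measurable M" "W s \<in> borel_measurable M" using st by auto
  have "integrable M (\<lambda>\<omega>. h (W t \<omega> - W s \<omega>)) \<longleftrightarrow> integrable (distr M borel (\<lambda>\<omega>. W t \<omega> - W s \<omega>)) h"
    by (subst integrable_distr_eq) auto
  also have "\<dots> \<longleftrightarrow> integrable std_gaussian (\<lambda>z. h (sqrt (t - s) *\<^sub>R z))"
    unfolding W_increment_distr[OF st] by (subst integrable_distr_eq) auto
  finally show "integrable M (\<lambda>\<omega>. h (W t \<omega> - W s \<omega>)) \<longleftrightarrow> integrable std_gaussian (\<lambda>z. h (sqrt (t - s) *\<^sub>R z))" .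
  have "(\<integral>\<omega>. h (W t \<omega> - W s \<omega>) \<partial>M) = integral\<^sup>L (distr M borel (\<lambda>\<omega>. W t \<omega> - W s \<omega>)) h"
    by (subst integral_distr) auto
  also have "\<dots> = (\<integral>z. h (sqrt (t - s) *\<^sub>R z) \<partial>std_gaussian)"
    unfolding W_increment_distr[OF st] by (subst integral_distr) auto
  finally show "(\<integral>\<omega>. h (W t \<omega> - W s \<omega>) \<partial>M) = (\<integral>z. h (sqrt (t - s) *\<^sub>R z) \<partial>std_gaussian)" .
qed

text \<open>Replaces conditioning on the past. The identity map into \<open>Ft s\<close> carries the
  whole past, independence makes its joint law with the increment a product measure, and Fubini
  integrates the increment out.\<close>

lemma expectation_independent_increment:
  fixes \<Psi> :: "'w \<Rightarrow> 'a \<Rightarrow> real"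
  assumes \<Psi>[measurable]: "(\<lambda>(\<omega>, w). \<Psi> \<omega> w) \<in> borel_measurable (Ft s \<Otimes>\<^sub>M borel)" and st: "0 \<le> s" "s \<le> t"
    and int: "integrable M (\<lambda>\<omega>. \<Psi> \<omega> (W t \<omega> - W s \<omega>))"
  shows "(\<integral>\<omega>. \<Psi> \<omega> (W t \<omega> - W s \<omega>) \<partial>M) = (\<integral>\<omega>. (\<integral>z. \<Psi> \<omega> (sqrt (t - s) *\<^sub>R z) \<partial>std_gaussian) \<partial>M)"
proof -
  let ?\<Delta> = "\<lambda>\<omega>. W t \<omega> - W s \<omega>"
  have \<Delta>[measurable]: "?\<Delta> \<in> borel_measurable M"
    using st by (intro borel_measurable_diff W_measurable) auto
  have id: "(\<lambda>\<omega>. \<omega>) \<in> M \<rightarrow>\<^sub>M Ft s"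
    using Ft_measurable[OF st(1), of "\<lambda>x. x" "Ft s"] by simp
  interpret P1: prob_space "distr M (Ft s) (\<lambda>\<omega>. \<omega>)" using id by (rule prob_space_distr)
  interpret P2: prob_space "distr M borel ?\<Delta>" using \<Delta> by (rule prob_space_distr)
  have prod: "distr M (Ft s) (\<lambda>\<omega>. \<omega>) \<Otimes>\<^sub>M distr M borel ?\<Delta> = distr M (Ft s \<Otimes>\<^sub>M borel) (\<lambda>\<omega>. (\<omega>, ?\<Delta> \<omega>))"
  proof (rule pair_measure_eqI)
    fix E H assume "E \<in> sets (distr M (Ft s) (\<lambda>\<omega>. \<omega>))" "H \<in> sets (distr M borel ?\<Delta>)"
    then have E: "E \<in> sets (Ft s)" and H: "H \<in> sets borel" by simp_all
    have E': "E \<in> sets M" "E \<inter> space M = E"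
      using E Ft_subalgebra[OF st(1)] sets.sets_into_space[OF E] space_Ft[OF st(1)] by (auto simp: subalgebra_def)
    have H': "?\<Delta> -` H \<inter> space M \<in> sets M" using H by measurable
    have "prob (E \<inter> (?\<Delta> -` H \<inter> space M)) = prob E * prob (?\<Delta> -` H \<inter> space M)"
      using H by (intro indep_setD[OF W_increment_indep[OF st] E] in_vimage_algebra)
    then have "emeasure M (E \<inter> (?\<Delta> -` H \<inter> space M)) = emeasure M E * emeasure M (?\<Delta> -` H \<inter> space M)"
      by (simp add: emeasure_eq_measure ennreal_mult)
    moreover have "emeasure (distr M (Ft s) (\<lambda>\<omega>. \<omega>)) E = emeasure M E"
      using E id by (subst emeasure_distr) (simp_all add: vimage_ident E'(2))
    moreover have "emeasure (distr M borel ?\<Delta>) H = emeasure M (?\<Delta> -` H \<inter> space M)"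
      using H by (subst emeasure_distr) auto
    moreover have "emeasure (distr M (Ft s \<Otimes>\<^sub>M borel) (\<lambda>\<omega>. (\<omega>, ?\<Delta> \<omega>))) (E \<times> H)
        = emeasure M ((\<lambda>\<omega>. (\<omega>, ?\<Delta> \<omega>)) -` (E \<times> H) \<inter> space M)"
      using E H measurable_Pair[OF id \<Delta>] by (subst emeasure_distr) auto
    moreover have "(\<lambda>\<omega>. (\<omega>, ?\<Delta> \<omega>)) -` (E \<times> H) \<inter> space M = E \<inter> (?\<Delta> -` H \<inter> space M)"
      by auto
    ultimately show "emeasure (distr M (Ft s) (\<lambda>\<omega>. \<omega>)) E * emeasure (distr M borel ?\<Delta>) H
        = emeasure (distr M (Ft s \<Otimes>\<^sub>M borel) (\<lambda>\<omega>. (\<omega>, ?\<Delta> \<omega>))) (E \<times> H)"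
      by (simp only:)
  next
    have "sets (distr M (Ft s) (\<lambda>\<omega>. \<omega>) \<Otimes>\<^sub>M distr M borel ?\<Delta>) = sets (Ft s \<Otimes>\<^sub>M borel)"
      by (rule sets_pair_measure_cong) simp_all
    then show "sets (distr M (Ft s) (\<lambda>\<omega>. \<omega>) \<Otimes>\<^sub>M distr M borel ?\<Delta>)
        = sets (distr M (Ft s \<Otimes>\<^sub>M borel) (\<lambda>\<omega>. (\<omega>, ?\<Delta> \<omega>)))"
      by simp
  qed (unfold_locales)
  interpret P: pair_sigma_finite "distr M (Ft s) (\<lambda>\<omega>. \<omega>)" "distr M borel ?\<Delta>" ..
  have pair: "(\<lambda>\<omega>. (\<omega>, ?\<Delta> \<omega>)) \<in> M \<rightarrow>\<^sub>M Ft s \<Otimes>\<^sub>M borel"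
    using id \<Delta> by (rule measurable_Pair)
  have intP: "integrable (distr M (Ft s) (\<lambda>\<omega>. \<omega>) \<Otimes>\<^sub>M distr M borel ?\<Delta>) (\<lambda>(\<omega>, w). \<Psi> \<omega> w)"
    unfolding prod integrable_distr_eq[OF pair \<Psi>] using int by simp
  have "(\<integral>\<omega>. \<Psi> \<omega> (?\<Delta> \<omega>) \<partial>M) = integral\<^sup>L (distr M (Ft s) (\<lambda>\<omega>. \<omega>) \<Otimes>\<^sub>M distr M borel ?\<Delta>) (\<lambda>(\<omega>, w). \<Psi> \<omega> w)"
    unfolding prod integral_distr[OF pair \<Psi>] by simp
  also have "\<dots> = (\<integral>\<omega>. (\<integral>w. \<Psi> \<omega> w \<partial>distr M borel ?\<Delta>) \<partial>distr M (Ft s) (\<lambda>\<omega>. \<omega>))"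
    using P.integral_fst'[OF intP] by simp
  also have "\<dots> = (\<integral>\<omega>. (\<integral>w. \<Psi> \<omega> w \<partial>distr M borel ?\<Delta>) \<partial>M)"
  proof (rule integral_distr[OF id])
    have "(\<lambda>(\<omega>, w). \<Psi> \<omega> w) \<in> borel_measurable (Ft s \<Otimes>\<^sub>M distr M borel ?\<Delta>)"
      by (subst measurable_cong_sets[OF sets_pair_measure_cong[OF refl sets_distr] refl]) (rule \<Psi>)
    then show "(\<lambda>\<omega>. \<integral>w. \<Psi> \<omega> w \<partial>distr M borel ?\<Delta>) \<in> borel_measurable (Ft s)"
      by (rule P2.borel_measurable_lebesgue_integral)
  qed
  also have "\<dots> = (\<integral>\<omega>. (\<integral>z. \<Psi> \<omega> (sqrt (t - s) *\<^sub>R z) \<partial>std_gaussian) \<partial>M)"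
  proof (rule Bochner_Integration.integral_cong[OF refl])
    fix \<omega> assume "\<omega> \<in> space M"
    then have [measurable]: "\<Psi> \<omega> \<in> borel_measurable borel"
      using measurable_Pair2[OF \<Psi>, of \<omega>] space_Ft[OF st(1)] by simp
    then show "(\<integral>w. \<Psi> \<omega> w \<partial>distr M borel ?\<Delta>) = (\<integral>z. \<Psi> \<omega> (sqrt (t - s) *\<^sub>R z) \<partial>std_gaussian)"
      unfolding W_increment_distr[OF st] by (subst integral_distr) auto
  qed
  finally show ?thesis .
qed

text \<open>The semigroup property of the heat flow is read off from the independent increments.\<close>

lemma heat_semigroup:
  fixes \<phi> :: "'a \<Rightarrow> real"
  assumes [measurable]: "\<phi> \<in> borel_measurable borel" and \<phi>: "\<And>y. \<bar>\<phi> y\<bar> \<le> B" and "0 \<le> r" "0 \<le> s"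
  shows "heat (r + s) \<phi> y = heat r (heat s \<phi>) y"
proof -
  have [measurable]: "W (r + s) \<in> borel_measurable M" "W r \<in> borel_measurable M" "W 0 \<in> borel_measurable M"
    using assms by auto
  have W0: "(\<lambda>\<omega>. W r \<omega> - W 0 \<omega>) \<in> borel_measurable (Ft r)"
    using assms Ft_measurable_mono[OF _ _ W_adapted, of 0 r] W_adapted[of r] by (intro borel_measurable_diff) auto
  have [measurable]: "heat s \<phi> \<in> borel_measurable borel"
  proof -
    have "(\<lambda>y. \<integral>z. \<phi> (y + sqrt s *\<^sub>R z) \<partial>std_gaussian) \<in> borel_measurable borel"
      by (rule std_gaussian.borel_measurable_lebesgue_integral) measurable
    then show ?thesis by (simp add: heat_def[abs_def])
  qed
  \<comment> \<open>Increments from time 0 are used, since \<open>W 0\<close> vanishes only almost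
    surely.\<close>
  have "heat (r + s) \<phi> y = (\<integral>\<omega>. \<phi> (y + (W (r + s) \<omega> - W 0 \<omega>)) \<partial>M)"
    unfolding heat_def using assms by (subst expectation_increment[of "\<lambda>x. \<phi> (y + x)"]) auto
  also have "\<dots> = (\<integral>\<omega>. \<phi> (y + (W r \<omega> - W 0 \<omega>) + (W (r + s) \<omega> - W r \<omega>)) \<partial>M)"
  proof -
    have "y + (W (r + s) \<omega> - W 0 \<omega>) = y + (W r \<omega> - W 0 \<omega>) + (W (r + s) \<omega> - W r \<omega>)" for \<omega>
      by simp
    then show ?thesis by (simp only:)
  qed
  also have "\<dots> = (\<integral>\<omega>. (\<integral>z. \<phi> (y + (W r \<omega> - W 0 \<omega>) + sqrt (r + s - r) *\<^sub>R z) \<partial>std_gaussian) \<partial>M)"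
  proof (rule expectation_independent_increment[of "\<lambda>\<omega> w. \<phi> (y + (W r \<omega> - W 0 \<omega>) + w)"])
    show "(\<lambda>(\<omega>, w). \<phi> (y + (W r \<omega> - W 0 \<omega>) + w)) \<in> borel_measurable (Ft r \<Otimes>\<^sub>M borel)"
      using W0 by measurable
    show "integrable M (\<lambda>\<omega>. \<phi> (y + (W r \<omega> - W 0 \<omega>) + (W (r + s) \<omega> - W r \<omega>)))"
      using \<phi> by (intro integrable_const_bound[of _ B]) auto
  qed (use assms in auto)
  also have "\<dots> = (\<integral>\<omega>. heat s \<phi> (y + (W r \<omega> - W 0 \<omega>)) \<partial>M)"
    by (simp add: heat_def)
  also have "\<dots> = heat r (heat s \<phi>) y"
    unfolding heat_def[of r] using assms by (subst expectation_increment[of "\<lambda>x. heat s \<phi> (y + x)"]) auto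
  finally show ?thesis .
qed

end

section \<open>Controlled diffusions\<close>

lemma C11_bound_mono: "C11_bound C g p \<Longrightarrow> C \<le> C' \<Longrightarrow> C11_bound C' g p"
  unfolding C11_bound_def
  by (intro conjI allI) (blast intro: order_trans mult_right_mono norm_ge_zero zero_le_power2)+

lemma C11_bound_continuous:
  assumes "C11_bound C g p" shows "continuous_on UNIV g" "continuous_on UNIV p"
proof -
  have "0 \<le> C" using assms order_trans[OF norm_ge_zero] unfolding C11_bound_def by blast
  have "\<bar>g x - g y\<bar> \<le> C * norm (x - y)" "norm (p x - p y) \<le> C * norm (x - y)" for x y
    using C11_bound_lipschitz[OF assms, of y "x - y"] assms
    unfolding C11_bound_def by (auto simp: algebra_simps dest: spec2[of _ y "x - y"])
  then have "C-lipschitz_on UNIV g" "C-lipschitz_on UNIV p"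
    using \<open>0 \<le> C\<close> by (auto intro!: lipschitz_onI simp: dist_norm)
  then show "continuous_on UNIV g" "continuous_on UNIV p"
    by (auto intro: lipschitz_on_continuous_on)
qed

context hjb_kernel
begin

definition R_bound :: "real \<Rightarrow> real" where "R_bound c = (SUP x\<in>{-c..c}. \<bar>R x\<bar>)"

lemma R_bound: "\<bar>x\<bar> \<le> c \<Longrightarrow> \<bar>R x\<bar> \<le> R_bound c"
proof -
  assume "\<bar>x\<bar> \<le> c"
  have "continuous_on {-c..c} (\<lambda>x. \<bar>R x\<bar>)"
    by (intro continuous_intros continuous_on_subset[OF cont(5)]) auto
  then have "bdd_above ((\<lambda>x. \<bar>R x\<bar>) ` {-c..c})"
    by (intro bounded_imp_bdd_above compact_imp_bounded compact_continuous_image) auto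
  then show ?thesis
    unfolding R_bound_def using \<open>\<bar>x\<bar> \<le> c\<close> by (intro cSUP_upper) auto
qed

lemma R_bound_nonneg: "0 \<le> c \<Longrightarrow> 0 \<le> R_bound c"
  using R_bound[of 0 c] by simp

end

section \<open>The heat flow up to the shifted terminal time\<close>

locale bm_hjb = std_brownian_motion M Ft W + hjb_kernel A B L G G1 G2 bs R
  for M :: "'w measure" and Ft and W :: "real \<Rightarrow> 'w \<Rightarrow> 'a::euclidean_space" and A B L G G1 G2 bs R +
  fixes \<phi> :: "'a \<Rightarrow> real" and \<epsilon> :: real
  assumes \<phi>_measurable[measurable]: "\<phi> \<in> borel_measurable borel" and \<phi>_in: "\<And>y. \<phi> y \<in> {A..B}" and \<epsilon>: "0 < \<epsilon>"
begin

definition v :: "real \<Rightarrow> 'a \<Rightarrow> real" where "v t = heat (1 + \<epsilon> - t) \<phi>"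

text \<open>The constant of \<open>heat_C11\<close> at the smallest remaining time \<epsilon>; it
  serves all \<open>t \<le> 1\<close>.\<close>

definition C0 :: real where "C0 = 2 * max \<bar>A\<bar> \<bar>B\<bar> + 18 * max \<bar>A\<bar> \<bar>B\<bar> / \<epsilon>"

lemma C0_nonneg: "0 \<le> C0" using \<epsilon> by (simp add: C0_def)

lemma \<phi>_bound: "\<bar>\<phi> y\<bar> \<le> max \<bar>A\<bar> \<bar>B\<bar>"
  using \<phi>_in[of y] by auto

lemma v_in: "v t y \<in> {A..B}"
  unfolding v_def by (rule heat_between[OF \<phi>_measurable \<phi>_in])

lemma v_bound: "\<bar>v t y\<bar> \<le> max \<bar>A\<bar> \<bar>B\<bar>"
  using v_in[of t y] by auto

lemma v_C11_ex: assumes "t \<le> 1" shows "\<exists>p. C11_bound C0 (v t) p"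
proof -
  have "\<exists>p. C11_bound (2 * max \<bar>A\<bar> \<bar>B\<bar> + 18 * max \<bar>A\<bar> \<bar>B\<bar> / (1 + \<epsilon> - t)) (v t) p"
    unfolding v_def by (rule heat_C11[OF \<phi>_measurable \<phi>_bound]) (use assms \<epsilon> in simp)
  then obtain p where p: "C11_bound (2 * max \<bar>A\<bar> \<bar>B\<bar> + 18 * max \<bar>A\<bar> \<bar>B\<bar> / (1 + \<epsilon> - t)) (v t) p" ..
  have "18 * max \<bar>A\<bar> \<bar>B\<bar> / (1 + \<epsilon> - t) \<le> 18 * max \<bar>A\<bar> \<bar>B\<bar> / \<epsilon>"
    using assms \<epsilon> by (intro divide_left_mono) auto
  then have "C11_bound C0 (v t) p"
    by (intro C11_bound_mono[OF p]) (simp add: C0_def)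
  then show ?thesis by blast
qed

definition grad :: "real \<Rightarrow> 'a \<Rightarrow> 'a" where "grad t = (SOME p. C11_bound C0 (v t) p)"

lemma v_C11: "t \<le> 1 \<Longrightarrow> C11_bound C0 (v t) (grad t)"
  unfolding grad_def by (rule someI_ex[OF v_C11_ex])

lemma v_measurable: "t \<le> 1 \<Longrightarrow> v t \<in> borel_measurable borel"
  and grad_measurable: "t \<le> 1 \<Longrightarrow> grad t \<in> borel_measurable borel"
  by (rule borel_measurable_continuous_onI, rule C11_bound_continuous[OF v_C11], assumption)+

lemma v_comp_measurable: "t \<le> 1 \<Longrightarrow> continuous_on {A..B} h \<Longrightarrow> (\<lambda>y. h (v t y) :: real) \<in> borel_measurable borel"
  by (rule borel_measurable_continuous_onI, rule continuous_on_compose2[OF _ C11_bound_continuous(1)[OF v_C11]])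
    (auto intro: v_in simp del: atLeastAtMost_iff)

lemma v_semigroup:
  assumes "t \<le> t'" "t' \<le> 1"
  shows "v t y = (\<integral>z. v t' (y + sqrt (t' - t) *\<^sub>R z) \<partial>std_gaussian)"
  using heat_semigroup[OF \<phi>_measurable \<phi>_bound, of "t' - t" "1 + \<epsilon> - t'" y] assms \<epsilon>
  by (simp add: v_def heat_def[of "t' - t"])

lemma v_integrable: "t \<le> 1 \<Longrightarrow> integrable std_gaussian (\<lambda>z. v t (y + r *\<^sub>R z))"
  using v_measurable[of t] v_bound[of t]
  by (intro integrable_std_gaussian_bounded[of _ "max \<bar>A\<bar> \<bar>B\<bar>"]) auto

text \<open>\<open>v t\<close> averages \<open>v t'\<close> over a Gaussian displacement of variance
  \<open>t' - t\<close>. The linear term has mean zero and the quadratic remainder is left, so the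
  bound is linear in \<open>t' - t\<close>, as \<open>one_step_pathwise\<close> demands.\<close>

lemma v_time_diff:
  assumes "t \<le> t'" "t' \<le> 1"
  shows "\<bar>v t' y - v t y\<bar> \<le> C0 * (t' - t) * gauss_norm_moment TYPE('a) 2"
proof -
  let ?r = "sqrt (t' - t)"
  let ?X = "\<lambda>z. v t' (y + ?r *\<^sub>R z) - v t' y - grad t' y \<bullet> (?r *\<^sub>R z)"
  have lin: "integrable std_gaussian (\<lambda>z. grad t' y \<bullet> (?r *\<^sub>R z))"
    using integrable_mult_right[OF integrable_std_gaussian_inner[of "grad t' y"], of ?r] by (simp add: inner_commute)
  have int: "integrable std_gaussian ?X"
    using v_integrable[OF assms(2)] lin by (intro Bochner_Integration.integrable_diff) auto
  have "(\<integral>z. grad t' y \<bullet> (?r *\<^sub>R z) \<partial>std_gaussian) = 0"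
    using std_gaussian_mean[of "grad t' y"] by (simp add: inner_commute)
  then have "v t y - v t' y = integral\<^sup>L std_gaussian ?X"
    using v_integrable[OF assms(2)] lin v_semigroup[OF assms] by simp
  then have "\<bar>v t' y - v t y\<bar> = \<bar>integral\<^sup>L std_gaussian ?X\<bar>" by (simp add: abs_minus_commute)
  also have "\<dots> \<le> (\<integral>z. \<bar>?X z\<bar> \<partial>std_gaussian)" by (rule integral_abs_bound)
  also have "\<dots> \<le> (\<integral>(z::'a). C0 * (t' - t) * norm z ^ 2 \<partial>std_gaussian)"
  proof (rule integral_mono)
    fix z :: 'a
    have "\<bar>?X z\<bar> \<le> C0 * (norm (?r *\<^sub>R z))\<^sup>2"
      using v_C11[OF assms(2)] unfolding C11_bound_def by blast
    also have "\<dots> = C0 * (t' - t) * norm z ^ 2"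
      using assms by (simp add: power_mult_distrib)
    finally show "\<bar>?X z\<bar> \<le> C0 * (t' - t) * norm z ^ 2" .
    show "integrable std_gaussian (\<lambda>z::'a. C0 * (t' - t) * norm z ^ 2)"
      by (intro integrable_mult_right integrable_std_gaussian_norm) simp
  qed (rule integrable_abs[OF int])
  also have "\<dots> = C0 * (t' - t) * gauss_norm_moment TYPE('a) 2"
    by (simp add: gauss_norm_moment_def)
  finally show ?thesis .
qed

text \<open>The error of one step depends on the controls only through their bound \<open>c\<close>; the Euler controls below change with
  the mesh.\<close>

definition C1 :: "real \<Rightarrow> real" where
  "C1 c = 1 + C0 * (1 + gauss_norm_moment TYPE('a) 2) + c ^ 3"

definition m3 :: real where "m3 = (\<integral>z. (1 + norm (z::'a)) ^ 3 \<partial>std_gaussian)"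

text \<open>First summand: the mean of the discounted pathwise remainder. Second: the price of
  freezing the discount in the running cost during a step.\<close>

definition err_const :: "real \<Rightarrow> real" where
  "err_const c = exp (c ^ 3 / 2) * step_const (C1 c) * m3 + exp (c ^ 3) * c ^ 3 * R_bound c * c\<^sup>2"

end

locale controlled_bm = bm_hjb M Ft W A B L G G1 G2 bs R \<phi> \<epsilon>
  for M :: "'w measure" and Ft and W :: "real \<Rightarrow> 'w \<Rightarrow> 'a::euclidean_space" and A B L G G1 G2 bs R \<phi> \<epsilon> +
  fixes \<alpha> :: "real \<Rightarrow> 'w \<Rightarrow> 'a" and \<beta> :: "real \<Rightarrow> 'w \<Rightarrow> real" and c :: real
  assumes \<alpha>_prog: "progressively_measurable Ft \<alpha>" and \<beta>_prog: "progressively_measurable Ft \<beta>"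
    and \<alpha>_le: "\<And>t \<omega>. t \<in> {0..1} \<Longrightarrow> \<omega> \<in> space M \<Longrightarrow> norm (\<alpha> t \<omega>) \<le> c"
    and \<beta>_le: "\<And>t \<omega>. t \<in> {0..1} \<Longrightarrow> \<omega> \<in> space M \<Longrightarrow> \<bar>\<beta> t \<omega>\<bar> \<le> c"
    and c: "1 \<le> c"
begin

abbreviation D :: "real \<Rightarrow> 'w \<Rightarrow> real" where "D \<equiv> discount \<alpha> \<beta>"
abbreviation b2 :: "real \<Rightarrow> 'w \<Rightarrow> real" where "b2 \<equiv> \<lambda>s \<omega>. \<beta> s \<omega> * (norm (\<alpha> s \<omega>))\<^sup>2"
abbreviation rc :: "real \<Rightarrow> 'w \<Rightarrow> real" where "rc \<equiv> \<lambda>s \<omega>. R (\<beta> s \<omega>) * (norm (\<alpha> s \<omega>))\<^sup>2"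
definition Y :: "real \<Rightarrow> 'w \<Rightarrow> 'a" where "Y t \<omega> = W t \<omega> + (LINT s:{0..t}|lborel. \<alpha> s \<omega>)"
text \<open>The expected discounted value less the cost accumulated so far. It runs from
  \<open>G (v 0 0)\<close> at time 0 to the cost functional of the smoothed terminal function at
  time 1, so the verification argument compares \<open>J 0\<close> with \<open>J 1\<close>.\<close>

definition J :: "real \<Rightarrow> real" where
  "J t = (\<integral>\<omega>. D t \<omega> * G (v t (Y t \<omega>)) - 1/2 * (LINT s:{0..t}|lborel. D s \<omega> * rc s \<omega>) \<partial>M)"

lemma jb_\<alpha>: "jointly_bounded M c \<alpha>"
  by (rule progressive_jointly_bounded[OF \<alpha>_prog \<alpha>_le])

lemma jb_\<beta>: "jointly_bounded M c \<beta>"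
  by (rule progressive_jointly_bounded[OF \<beta>_prog]) (simp add: \<beta>_le)

lemma jb_b2: "jointly_bounded M (c ^ 3) b2"
proof -
  have "jointly_bounded M (c * c\<^sup>2) b2"
    by (rule jointly_bounded_weighted_square[OF jb_\<alpha> jb_\<beta>, of "\<lambda>x. x"]) (use c in auto)
  moreover have "c * c\<^sup>2 = c ^ 3" by (simp add: power2_eq_square power3_eq_cube)
  ultimately show ?thesis by (simp only:)
qed

lemma jb_rc: "jointly_bounded M (R_bound c * c\<^sup>2) rc"
  by (rule jointly_bounded_weighted_square[OF jb_\<alpha> jb_\<beta>])
    (use c R_bound R_bound_nonneg[of c] borel_measurable_continuous_onI[OF cont(5)] in auto)

lemma jb_D: "jointly_bounded M (exp (c ^ 3 / 2)) D"
  by (rule jointly_bounded_discount(1)[OF jb_b2])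

lemma D_le: "t \<in> {0..1} \<Longrightarrow> \<omega> \<in> space M \<Longrightarrow> D t \<omega> \<le> exp (c ^ 3 / 2)"
  by (rule jointly_bounded_discount(2)[OF jb_b2])

lemma D_pos: "0 < D t \<omega>"
  by (simp add: discount_def)

lemma jb_cost: "jointly_bounded M (exp (c ^ 3 / 2) * (R_bound c * c\<^sup>2)) (\<lambda>s \<omega>. D s \<omega> * rc s \<omega>)"
  by (rule jointly_bounded_mult[OF jb_D jb_rc]) simp

lemma D_adapted: "0 \<le> t \<Longrightarrow> t \<le> 1 \<Longrightarrow> D t \<in> borel_measurable (Ft t)"
  by (rule discount_adapted[OF \<alpha>_prog \<beta>_prog])

lemma Y_adapted: "0 \<le> t \<Longrightarrow> t \<le> 1 \<Longrightarrow> Y t \<in> borel_measurable (Ft t)"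
  unfolding Y_def[abs_def]
  by (intro borel_measurable_add W_adapted progressive_integral_measurable[OF \<alpha>_prog])

lemma integral_le:
  assumes "jointly_bounded M C X" "0 \<le> u" "u \<le> t" "t \<le> 1" "\<omega> \<in> space M"
  shows "norm (LINT s:{u..t}|lborel. X s \<omega>) \<le> C * (t - u)"
  by (rule bounded_path_integral_norm_le[OF jointly_bounded_path[OF assms(1,5)] assms(2-4)])

lemma integral_add:
  assumes "jointly_bounded M C X" "0 \<le> u" "u \<le> t" "t \<le> t'" "t' \<le> 1" "\<omega> \<in> space M"
  shows "(LINT s:{u..t'}|lborel. X s \<omega>) = (LINT s:{u..t}|lborel. X s \<omega>) + (LINT s:{t..t'}|lborel. X s \<omega>)"
  by (rule bounded_path_integral_add[OF jointly_bounded_path[OF assms(1,6)] assms(2-5)])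

lemma D_mult:
  assumes "0 \<le> t" "t \<le> t'" "t' \<le> 1" "\<omega> \<in> space M"
  shows "D t' \<omega> = D t \<omega> * exp (1/2 * (LINT s:{t..t'}|lborel. b2 s \<omega>))"
  unfolding discount_def integral_add[OF jb_b2 order_refl assms] by (simp add: distrib_left exp_add)

lemma Y_step:
  assumes "0 \<le> t" "t \<le> t'" "t' \<le> 1" "\<omega> \<in> space M"
  shows "Y t' \<omega> = Y t \<omega> + (LINT s:{t..t'}|lborel. \<alpha> s \<omega>) + (W t' \<omega> - W t \<omega>)"
  unfolding Y_def integral_add[OF jb_\<alpha> order_refl assms] by simp

text \<open>Within a step the discount changes by \<open>O(t' - t)\<close>, so replacing it by its
  initial value costs \<open>O((t' - t)\<^sup>2)\<close>, below the tolerated power 3/2.\<close>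

lemma cost_increment:
  assumes "0 \<le> t" "t \<le> t'" "t' \<le> 1" "\<omega> \<in> space M"
  shows "\<bar>(LINT s:{t..t'}|lborel. D s \<omega> * rc s \<omega>) - D t \<omega> * (LINT s:{t..t'}|lborel. rc s \<omega>)\<bar>
    \<le> exp (c ^ 3) * c ^ 3 * R_bound c * c\<^sup>2 * (t' - t)\<^sup>2"
proof -
  have R0: "0 \<le> R_bound c" using R_bound_nonneg c by simp
  have int: "set_integrable lborel {t..t'} (\<lambda>s. D s \<omega> * rc s \<omega>)" "set_integrable lborel {t..t'} (\<lambda>s. rc s \<omega>)"
    using assms bounded_path_integrable[OF jointly_bounded_path[OF jb_cost]] bounded_path_integrable[OF jointly_bounded_path[OF jb_rc]]
    by auto
  have int': "set_integrable lborel {t..t'} (\<lambda>s. D t \<omega> * rc s \<omega>)"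
    using int(2) by simp
  define \<rho> where "\<rho> s = D s \<omega> * rc s \<omega> - D t \<omega> * rc s \<omega>" for s
  have \<rho>: "set_integrable lborel {t..t'} \<rho>"
    unfolding \<rho>_def[abs_def] by (rule set_integral_diff(1)[OF int(1) int'])
  have "(LINT s:{t..t'}|lborel. D s \<omega> * rc s \<omega>) - D t \<omega> * (LINT s:{t..t'}|lborel. rc s \<omega>)
    = (LINT s:{t..t'}|lborel. \<rho> s)"
    unfolding \<rho>_def using set_integral_diff(2)[OF int(1) int'] by simp
  also have "\<bar>\<dots>\<bar> \<le> (LINT s:{t..t'}|lborel. \<bar>\<rho> s\<bar>)"
    using set_integral_norm_bound[OF \<rho>] by simp
  also have "\<dots> \<le> (LINT s:{t..t'}|lborel. exp (c ^ 3) * c ^ 3 * R_bound c * c\<^sup>2 * (t' - t))"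
  proof (rule set_integral_mono)
    show "set_integrable lborel {t..t'} (\<lambda>s. \<bar>\<rho> s\<bar>)"
      using set_integrable_norm[OF \<rho>] by simp
    show "set_integrable lborel {t..t'} (\<lambda>s. exp (c ^ 3) * c ^ 3 * R_bound c * c\<^sup>2 * (t' - t))"
      unfolding set_integrable_def by (intro integrable_indicator) (auto simp: emeasure_lborel_Icc_eq)
    fix s assume s: "s \<in> {t..t'}"
    define x where "x = 1/2 * (LINT r:{t..s}|lborel. b2 r \<omega>)"
    have "norm (LINT r:{t..s}|lborel. b2 r \<omega>) \<le> c ^ 3 * (s - t)"
      using s assms by (intro integral_le[OF jb_b2]) auto
    also have "\<dots> \<le> c ^ 3 * (t' - t)" using s c by (intro mult_left_mono) auto
    finally have x: "\<bar>x\<bar> \<le> c ^ 3 / 2 * (t' - t)" by (simp add: x_def)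
    also have "\<dots> \<le> c ^ 3 / 2" using assms c by (intro mult_left_le) auto
    finally have x': "\<bar>x\<bar> \<le> c ^ 3 / 2" .
    have "\<bar>exp x - 1\<bar> \<le> exp \<bar>x\<bar> * \<bar>x\<bar>"
    proof -
      obtain r where r: "\<bar>r\<bar> \<le> \<bar>x\<bar>" "exp x = (\<Sum>m<1. x ^ m / fact m) + exp r / fact 1 * x ^ 1"
        using Maclaurin_exp_le[of x 1] by blast
      then have "\<bar>exp x - 1\<bar> = exp r * \<bar>x\<bar>" by (simp add: abs_mult)
      also have "\<dots> \<le> exp \<bar>x\<bar> * \<bar>x\<bar>" using r(1) by (intro mult_right_mono) auto
      finally show ?thesis .
    qed
    also have "\<dots> \<le> exp (c ^ 3 / 2) * (c ^ 3 / 2 * (t' - t))"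
      using x x' by (intro mult_mono) auto
    finally have e: "\<bar>exp x - 1\<bar> \<le> exp (c ^ 3 / 2) * (c ^ 3 / 2 * (t' - t))" .
    have "D s \<omega> = D t \<omega> * exp x"
      unfolding x_def using s assms by (intro D_mult) auto
    then have "\<rho> s = D t \<omega> * (exp x - 1) * rc s \<omega>"
      by (simp add: \<rho>_def algebra_simps)
    then have "\<bar>\<rho> s\<bar> = D t \<omega> * \<bar>exp x - 1\<bar> * \<bar>rc s \<omega>\<bar>"
      using D_pos[of t \<omega>] by (simp only: abs_mult abs_of_pos)
    also have "\<dots> \<le> exp (c ^ 3 / 2) * (exp (c ^ 3 / 2) * (c ^ 3 / 2 * (t' - t))) * (R_bound c * c\<^sup>2)"
    proof (intro mult_mono e)
      show "\<bar>rc s \<omega>\<bar> \<le> R_bound c * c\<^sup>2"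
        using jb_rc s assms unfolding jointly_bounded_def real_norm_def by auto
    qed (use D_le[of t \<omega>] D_pos[of t \<omega>] assms c R0 in auto)
    also have "\<dots> = exp (c ^ 3) * c ^ 3 * R_bound c * c\<^sup>2 * (t' - t) / 2"
      by (simp add: exp_add[symmetric] field_simps)
    also have "\<dots> \<le> exp (c ^ 3) * c ^ 3 * R_bound c * c\<^sup>2 * (t' - t)"
    proof -
      have "0 \<le> exp (c ^ 3) * c ^ 3 * R_bound c * c\<^sup>2 * (t' - t)"
        using c R0 assms by (intro mult_nonneg_nonneg) auto
      then show ?thesis by linarith
    qed
    finally show "\<bar>\<rho> s\<bar> \<le> exp (c ^ 3) * c ^ 3 * R_bound c * c\<^sup>2 * (t' - t)" .
  qed
  also have "\<dots> = exp (c ^ 3) * c ^ 3 * R_bound c * c\<^sup>2 * (t' - t)\<^sup>2"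
  proof -
    have "(LINT s:{t..t'}|lborel. k) = k * (t' - t)" for k :: real
      using assms by (simp add: set_lebesgue_integral_def)
    then show ?thesis by (simp only: power2_eq_square mult.assoc)
  qed
  finally show ?thesis .
qed

end

section \<open>The expected change over one time step\<close>

context prob_space
begin

text \<open>An algebra of functions, so integrability of sums and products follows from closure
  rules alone.\<close>

definition bdd_rv :: "('a \<Rightarrow> real) \<Rightarrow> bool" where
  "bdd_rv h \<longleftrightarrow> h \<in> borel_measurable M \<and> (\<exists>K. \<forall>\<omega>\<in>space M. \<bar>h \<omega>\<bar> \<le> K)"

lemma bdd_rvI: "h \<in> borel_measurable M \<Longrightarrow> (\<And>\<omega>. \<omega> \<in> space M \<Longrightarrow> \<bar>h \<omega>\<bar> \<le> K) \<Longrightarrow> bdd_rv h"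
  unfolding bdd_rv_def by blast

lemma bdd_rv_integrable: "bdd_rv h \<Longrightarrow> integrable M h"
  unfolding bdd_rv_def by (elim conjE exE) (rule integrable_const_bound, auto intro: AE_I2)

lemma bdd_rv_mult: assumes "bdd_rv h" "bdd_rv k" shows "bdd_rv (\<lambda>\<omega>. h \<omega> * k \<omega>)"
proof -
  obtain H K where "\<forall>\<omega>\<in>space M. \<bar>h \<omega>\<bar> \<le> H" "\<forall>\<omega>\<in>space M. \<bar>k \<omega>\<bar> \<le> K"
    using assms by (auto simp: bdd_rv_def)
  then have "\<bar>h \<omega> * k \<omega>\<bar> \<le> H * K" if "\<omega> \<in> space M" for \<omega>
    unfolding abs_mult using that by (intro mult_mono) (auto intro: order_trans[OF abs_ge_zero])
  with assms show ?thesis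
    by (intro bdd_rvI[of _ "H * K"]) (auto simp: bdd_rv_def)
qed

lemma bdd_rv_add: assumes "bdd_rv h" "bdd_rv k" shows "bdd_rv (\<lambda>\<omega>. h \<omega> + k \<omega>)"
proof -
  obtain H K where "\<forall>\<omega>\<in>space M. \<bar>h \<omega>\<bar> \<le> H" "\<forall>\<omega>\<in>space M. \<bar>k \<omega>\<bar> \<le> K"
    using assms by (auto simp: bdd_rv_def)
  then have "\<bar>h \<omega> + k \<omega>\<bar> \<le> H + K" if "\<omega> \<in> space M" for \<omega>
    using that by (intro order_trans[OF abs_triangle_ineq] add_mono) auto
  with assms show ?thesis
    by (intro bdd_rvI[of _ "H + K"]) (auto simp: bdd_rv_def)
qed

lemma bdd_rv_const: "bdd_rv (\<lambda>_. k)"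
  by (intro bdd_rvI[of _ "\<bar>k\<bar>"]) auto

lemma bdd_rv_diff: assumes "bdd_rv h" "bdd_rv k" shows "bdd_rv (\<lambda>\<omega>. h \<omega> - k \<omega>)"
  using bdd_rv_add[OF assms(1) bdd_rv_mult[OF bdd_rv_const[of "- 1"] assms(2)]] by simp

end

context controlled_bm
begin

text \<open>Conditional drift of the discounted value over the step from \<open>t\<close> to \<open>t'\<close>; \<open>gain_rate\<close> below is its density in time.\<close>

definition gain :: "real \<Rightarrow> real \<Rightarrow> 'w \<Rightarrow> real" where
  "gain t t' \<omega> = 1/2 * (LINT s:{t..t'}|lborel. b2 s \<omega>) * G (v t (Y t \<omega>))
     + G1 (v t (Y t \<omega>)) * (grad t' (Y t \<omega>) \<bullet> (LINT s:{t..t'}|lborel. \<alpha> s \<omega>))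
     + G2 (v t (Y t \<omega>)) / 2 * (norm (grad t' (Y t \<omega>)))\<^sup>2 * (t' - t)
     - 1/2 * (LINT s:{t..t'}|lborel. rc s \<omega>)"

lemma bdd_rv_integral:
  assumes "jointly_bounded M C X" "0 \<le> u" "u \<le> t" "t \<le> 1"
  shows "bdd_rv (\<lambda>\<omega>. LINT s:{u..t}|lborel. X s \<omega> :: real)"
  using integral_le[OF assms] jointly_bounded_integral_measurable[OF assms(1,2,4)]
  by (intro bdd_rvI[of _ "C * (t - u)"]) simp_all

lemma Y_measurable: "0 \<le> t \<Longrightarrow> t \<le> 1 \<Longrightarrow> Y t \<in> borel_measurable M"
  using Ft_measurable Y_adapted by blast

lemma bdd_rv_D: assumes "0 \<le> t" "t \<le> 1" shows "bdd_rv (D t)"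
proof (rule bdd_rvI)
  show "D t \<in> borel_measurable M"
    using Ft_measurable D_adapted assms by blast
  show "\<bar>D t \<omega>\<bar> \<le> exp (c ^ 3 / 2)" if "\<omega> \<in> space M" for \<omega>
    using D_le[of t \<omega>] D_pos[of t \<omega>] assms that by simp
qed

lemma bdd_rv_comp:
  assumes "0 \<le> t" "t \<le> 1" "t0 \<le> 1" "continuous_on {A..B} h" "\<And>x. x \<in> {A..B} \<Longrightarrow> \<bar>h x\<bar> \<le> K"
  shows "bdd_rv (\<lambda>\<omega>. h (v t0 (Y t \<omega>)))"
  using measurable_compose[OF Y_measurable[OF assms(1,2)] v_comp_measurable[OF assms(3,4)]] assms(5) v_in
  by (intro bdd_rvI) auto

lemma step_bound:
  assumes t: "0 \<le> t" "t < t'" "t' \<le> 1" and \<omega>: "\<omega> \<in> space M"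
  shows "\<bar>D t' \<omega> * G (v t' (Y t' \<omega>)) - D t \<omega> * (G (v t (Y t \<omega>))
      + 1/2 * (LINT s:{t..t'}|lborel. b2 s \<omega>) * G (v t (Y t \<omega>))
      + G1 (v t (Y t \<omega>)) * (v t' (Y t \<omega> + (W t' \<omega> - W t \<omega>)) - v t (Y t \<omega>))
      + G1 (v t (Y t \<omega>)) * (grad t' (Y t \<omega>) \<bullet> (LINT s:{t..t'}|lborel. \<alpha> s \<omega>))
      + G2 (v t (Y t \<omega>)) / 2 * (grad t' (Y t \<omega>) \<bullet> (W t' \<omega> - W t \<omega>))\<^sup>2)\<bar>
    \<le> exp (c ^ 3 / 2) * (step_const (C1 c) * (sqrt (t' - t) + norm (W t' \<omega> - W t \<omega>)) ^ 3)"
proof -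
  let ?m2 = "gauss_norm_moment TYPE('a) 2"
  have m2: "0 \<le> ?m2"
    unfolding gauss_norm_moment_def by (intro Bochner_Integration.integral_nonneg) auto
  define r where "r = sqrt (t' - t)"
  have r: "0 < r" "r \<le> 1" "r\<^sup>2 = t' - t"
    using t by (simp_all add: r_def)
  define \<theta> where "\<theta> = 1/2 * (LINT s:{t..t'}|lborel. b2 s \<omega>)"
  define a where "a = (LINT s:{t..t'}|lborel. \<alpha> s \<omega>)"
  define w where "w = W t' \<omega> - W t \<omega>"
  have c3: "1 \<le> c ^ 3" using c by simp
  have c_le: "c \<le> c ^ 3" using power_increasing[of 1 3 c] c by simp
  have nn: "0 \<le> C0 * (1 + ?m2)" using C0_nonneg m2 by (intro mult_nonneg_nonneg) auto
  have C0_le: "C0 \<le> C0 * (1 + ?m2)" "C0 * ?m2 \<le> C0 * (1 + ?m2)"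
    using C0_nonneg m2 by (auto intro!: mult_left_mono simp: algebra_simps)
  \<comment> \<open>\<open>C1 c\<close> collects what the pathwise expansion requires of its
    constant: the gradient bounds, the time change of \<open>v\<close>, the drift and the
    exponent.\<close>
  have C1: "1 \<le> C1 c" "c ^ 3 \<le> C1 c" "C0 \<le> C1 c" "C0 * ?m2 \<le> C1 c"
    using nn C0_le c3 unfolding C1_def by linarith+
  have "D t' \<omega> = D t \<omega> * exp \<theta>"
    unfolding \<theta>_def using t \<omega> by (intro D_mult) auto
  moreover have "Y t' \<omega> = Y t \<omega> + a + w"
    unfolding a_def w_def using t \<omega> by (intro Y_step) auto
  moreover have "\<bar>exp \<theta> * G (v t' (Y t \<omega> + a + w)) - (G (v t (Y t \<omega>)) + \<theta> * G (v t (Y t \<omega>))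
      + G1 (v t (Y t \<omega>)) * (v t' (Y t \<omega> + w) - v t (Y t \<omega>))
      + G1 (v t (Y t \<omega>)) * (grad t' (Y t \<omega>) \<bullet> a)
      + G2 (v t (Y t \<omega>)) / 2 * (grad t' (Y t \<omega>) \<bullet> w)\<^sup>2)\<bar> \<le> step_const (C1 c) * (r + norm w) ^ 3"
  proof (rule one_step_pathwise[OF C11_bound_mono[OF v_C11 C1(3)] C1(1) v_in v_in r(1,2)])
    have "\<bar>v t' (Y t \<omega>) - v t (Y t \<omega>)\<bar> \<le> C0 * (t' - t) * ?m2"
      using t by (intro v_time_diff) auto
    also have "\<dots> = (C0 * ?m2) * r\<^sup>2" by (simp add: r)
    also have "\<dots> \<le> C1 c * r\<^sup>2" using C1(4) by (intro mult_right_mono) auto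
    finally show "\<bar>v t' (Y t \<omega>) - v t (Y t \<omega>)\<bar> \<le> C1 c * r\<^sup>2" .
    have "norm a \<le> c * (t' - t)"
      unfolding a_def using t \<omega> by (intro integral_le[OF jb_\<alpha>]) auto
    also have "\<dots> \<le> C1 c * r\<^sup>2" unfolding r(3) using C1(2) c_le t by (intro mult_right_mono) auto
    finally show "norm a \<le> C1 c * r\<^sup>2" .
    have "norm (LINT s:{t..t'}|lborel. b2 s \<omega>) \<le> c ^ 3 * (t' - t)"
      using t \<omega> by (intro integral_le[OF jb_b2]) auto
    also have "\<dots> \<le> C1 c * r\<^sup>2" unfolding r(3) using C1(2) t by (intro mult_right_mono) auto
    finally have "norm (LINT s:{t..t'}|lborel. b2 s \<omega>) \<le> C1 c * r\<^sup>2" .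
    moreover have "\<bar>\<theta>\<bar> \<le> norm (LINT s:{t..t'}|lborel. b2 s \<omega>)" by (simp add: \<theta>_def)
    ultimately show "\<bar>\<theta>\<bar> \<le> C1 c * r\<^sup>2" by linarith
  qed (use t in auto)
  ultimately have "\<bar>D t' \<omega> * G (v t' (Y t' \<omega>)) - D t \<omega> * (G (v t (Y t \<omega>)) + \<theta> * G (v t (Y t \<omega>))
      + G1 (v t (Y t \<omega>)) * (v t' (Y t \<omega> + w) - v t (Y t \<omega>))
      + G1 (v t (Y t \<omega>)) * (grad t' (Y t \<omega>) \<bullet> a)
      + G2 (v t (Y t \<omega>)) / 2 * (grad t' (Y t \<omega>) \<bullet> w)\<^sup>2)\<bar> \<le> D t \<omega> * (step_const (C1 c) * (r + norm w) ^ 3)"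
    using D_pos[of t \<omega>] by (simp only: mult.assoc right_diff_distrib[symmetric] abs_mult abs_of_pos mult_left_mono less_imp_le)
  also have "\<dots> \<le> exp (c ^ 3 / 2) * (step_const (C1 c) * (r + norm w) ^ 3)"
  proof (rule mult_right_mono)
    show "D t \<omega> \<le> exp (c ^ 3 / 2)" using t \<omega> by (intro D_le) auto
    have "0 \<le> step_const (C1 c)"
      unfolding step_const_def using L_ge_1 C1(1) by (intro mult_nonneg_nonneg add_nonneg_nonneg) auto
    then show "0 \<le> step_const (C1 c) * (r + norm w) ^ 3"
      using r by (intro mult_nonneg_nonneg) auto
  qed
  finally show ?thesis by (simp only: \<theta>_def a_def w_def r_def)
qed

text \<open>\<open>step_bound\<close> in expectation: \<open>\<Psi>1\<close> has mean zero by the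
  semigroup property, \<open>\<Psi>2\<close> averages to \<open>V\<close> because the increment has
  covariance \<open>t' - t\<close> times the identity, and Brownian scaling turns the cubic
  remainder into \<open>r ^ 3 * m3\<close>.\<close>

lemma one_step:
  assumes t: "0 \<le> t" "t < t'" "t' \<le> 1"
  shows "\<bar>J t' - J t - (\<integral>\<omega>. D t \<omega> * gain t t' \<omega> \<partial>M)\<bar> \<le> err_const c * sqrt (t' - t) ^ 3"
proof -
  have t1: "t \<le> 1" "0 \<le> t'" "t \<le> t'" using t by auto
  define r where "r = sqrt (t' - t)"
  have r: "0 < r" "r \<le> 1" "r\<^sup>2 = t' - t" using t by (simp_all add: r_def)
  define w where "w \<omega> = W t' \<omega> - W t \<omega>" for \<omega>
  define v0 where "v0 \<omega> = v t (Y t \<omega>)" for \<omega>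
  define p where "p \<omega> = grad t' (Y t \<omega>)" for \<omega>
  define X0 where "X0 \<omega> = D t \<omega> * G (v0 \<omega>)" for \<omega>
  define X1 where "X1 \<omega> = D t' \<omega> * G (v t' (Y t' \<omega>))" for \<omega>
  define S where "S \<omega> = D t \<omega> * (1/2 * (LINT s:{t..t'}|lborel. b2 s \<omega>) * G (v0 \<omega>)
      + G1 (v0 \<omega>) * (p \<omega> \<bullet> (LINT s:{t..t'}|lborel. \<alpha> s \<omega>)))" for \<omega>
  define \<Psi>1 where "\<Psi>1 \<omega> x = D t \<omega> * (G1 (v0 \<omega>) * (v t' (Y t \<omega> + x) - v0 \<omega>))" for \<omega> x
  define \<Psi>2 where "\<Psi>2 \<omega> x = D t \<omega> * (G2 (v0 \<omega>) / 2 * (p \<omega> \<bullet> x)\<^sup>2)" for \<omega> x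
  define V where "V \<omega> = D t \<omega> * (G2 (v0 \<omega>) / 2 * (norm (p \<omega>))\<^sup>2 * (t' - t))" for \<omega>
  define cost where "cost u \<omega> = (LINT s:{0..u}|lborel. D s \<omega> * rc s \<omega>)" for u \<omega>
  define \<Delta>c where "\<Delta>c \<omega> = (LINT s:{t..t'}|lborel. D s \<omega> * rc s \<omega>)" for \<omega>
  define Ic where "Ic \<omega> = D t \<omega> * (LINT s:{t..t'}|lborel. rc s \<omega>)" for \<omega>
  have [measurable]: "Y t \<in> borel_measurable (Ft t)" "D t \<in> borel_measurable (Ft t)"
    "(\<lambda>y. G1 (v t y)) \<in> borel_measurable borel" "(\<lambda>y. G2 (v t y)) \<in> borel_measurable borel"
    "v t \<in> borel_measurable borel" "v t' \<in> borel_measurable borel" "grad t' \<in> borel_measurable borel"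
    using Y_adapted D_adapted v_comp_measurable cont v_measurable grad_measurable t t1 by auto
  have w[measurable]: "w \<in> borel_measurable M"
    unfolding w_def using t t1 by (intro borel_measurable_diff W_measurable)
  have pC0: "norm (p \<omega>) \<le> C0" for \<omega>
    using v_C11[OF t(3)] by (simp add: C11_bound_def p_def)
  have [measurable]: "p \<in> borel_measurable M" "Y t \<in> borel_measurable M"
    using Y_measurable[OF t(1) t1(1)] unfolding p_def[abs_def] by measurable
  note bI = bdd_rv_mult bdd_rv_add bdd_rv_diff bdd_rv_const
  have bD: "bdd_rv (D t)" "bdd_rv (D t')" using bdd_rv_D t t1 by auto
  have bG: "bdd_rv (\<lambda>\<omega>. G (v0 \<omega>))" "bdd_rv (\<lambda>\<omega>. G1 (v0 \<omega>))" "bdd_rv (\<lambda>\<omega>. G2 (v0 \<omega>))" "bdd_rv (\<lambda>\<omega>. G (v t' (Y t' \<omega>)))"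
    unfolding v0_def using t t1 by (auto intro!: bdd_rv_comp cont bounds simp del: atLeastAtMost_iff)
  have bb2: "bdd_rv (\<lambda>\<omega>. LINT s:{t..t'}|lborel. b2 s \<omega>)" and brc: "bdd_rv (\<lambda>\<omega>. LINT s:{t..t'}|lborel. rc s \<omega>)"
    and b\<Delta>c: "bdd_rv \<Delta>c"
    unfolding \<Delta>c_def[abs_def] using t t1 by (intro bdd_rv_integral[OF jb_b2] bdd_rv_integral[OF jb_rc] bdd_rv_integral[OF jb_cost]; simp)+
  have bcost: "bdd_rv (cost u)" if "0 \<le> u" "u \<le> 1" for u
    unfolding cost_def[abs_def] using that by (intro bdd_rv_integral[OF jb_cost]) auto
  have bpa: "bdd_rv (\<lambda>\<omega>. p \<omega> \<bullet> (LINT s:{t..t'}|lborel. \<alpha> s \<omega>))"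
  proof (rule bdd_rvI)
    show "(\<lambda>\<omega>. p \<omega> \<bullet> (LINT s:{t..t'}|lborel. \<alpha> s \<omega>)) \<in> borel_measurable M"
      using jointly_bounded_integral_measurable[OF jb_\<alpha> t(1,3)] by (intro borel_measurable_inner) auto
    fix \<omega> assume "\<omega> \<in> space M"
    then have "norm (LINT s:{t..t'}|lborel. \<alpha> s \<omega>) \<le> c * (t' - t)"
      by (intro integral_le[OF jb_\<alpha> t(1) t1(3) t(3)])
    then show "\<bar>p \<omega> \<bullet> (LINT s:{t..t'}|lborel. \<alpha> s \<omega>)\<bar> \<le> C0 * (c * (t' - t))"
      using pC0[of \<omega>] C0_nonneg by (intro order_trans[OF Cauchy_Schwarz_ineq2] mult_mono) auto
  qed
  have bpp: "bdd_rv (\<lambda>\<omega>. (norm (p \<omega>))\<^sup>2)"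
    by (rule bdd_rvI[of _ "C0\<^sup>2"]) (use pC0 in \<open>auto intro!: power_mono\<close>)
  have bS: "bdd_rv S" unfolding S_def[abs_def] by (intro bI bD bb2 bG bpa)
  have bX0: "bdd_rv X0" unfolding X0_def[abs_def] by (intro bI bD bG)
  have bX1: "bdd_rv X1" unfolding X1_def[abs_def] by (intro bI bD bG)
  have bV: "bdd_rv V"
  proof -
    have "bdd_rv (\<lambda>\<omega>. D t \<omega> * (G2 (v0 \<omega>) * (1 / 2) * (norm (p \<omega>))\<^sup>2 * (t' - t)))" by (intro bI bD bG bpp)
    then show ?thesis by (simp add: V_def[abs_def])
  qed
  have bIc: "bdd_rv Ic" unfolding Ic_def[abs_def] by (intro bI bD brc)
  have b\<Psi>1: "bdd_rv (\<lambda>\<omega>. \<Psi>1 \<omega> (w \<omega>))"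
  proof -
    have "bdd_rv (\<lambda>\<omega>. v t' (Y t \<omega> + w \<omega>))" "bdd_rv v0"
      unfolding v0_def[abs_def] by (rule bdd_rvI[OF _ v_bound], measurable)+
    then show ?thesis unfolding \<Psi>1_def by (intro bI bD bG)
  qed
  have int_w2: "integrable M (\<lambda>\<omega>. norm (w \<omega>) ^ 2)"
  proof -
    have "integrable std_gaussian (\<lambda>z::'a. norm (r *\<^sub>R z) ^ 2)"
      using integrable_mult_right[OF integrable_std_gaussian_norm[of 2, where 'a='a], of "r\<^sup>2"]
      by (simp add: power_mult_distrib)
    then show ?thesis
      using integrable_increment[of "\<lambda>x. norm x ^ 2" t t'] t1 t unfolding w_def r_def by simp
  qed
  obtain K where K: "\<And>\<omega>. \<omega> \<in> space M \<Longrightarrow> \<bar>D t \<omega> * (G2 (v0 \<omega>) * (1 / 2))\<bar> \<le> K"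
    using bI(1)[OF bD(1) bI(1)[OF bG(3) bI(4)[of "1/2"]]] unfolding bdd_rv_def by auto
  \<comment> \<open>The only term of the expansion that is unbounded, being quadratic in the
    increment; a second moment takes the place of \<open>bdd_rv\<close>.\<close>
  have i\<Psi>2: "integrable M (\<lambda>\<omega>. \<Psi>2 \<omega> (w \<omega>))"
  proof (rule Bochner_Integration.integrable_bound)
    show "integrable M (\<lambda>\<omega>. K * (C0\<^sup>2 * norm (w \<omega>) ^ 2))"
      using int_w2 by (intro integrable_mult_right)
    have [measurable]: "D t \<in> borel_measurable M" "(\<lambda>\<omega>. G2 (v0 \<omega>)) \<in> borel_measurable M"
      using bD(1) bG(3) by (simp_all add: bdd_rv_def)
    show "(\<lambda>\<omega>. \<Psi>2 \<omega> (w \<omega>)) \<in> borel_measurable M"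
      unfolding \<Psi>2_def by measurable
    show "AE \<omega> in M. norm (\<Psi>2 \<omega> (w \<omega>)) \<le> norm (K * (C0\<^sup>2 * norm (w \<omega>) ^ 2))"
    proof (rule AE_I2)
      fix \<omega> assume "\<omega> \<in> space M"
      have "\<bar>p \<omega> \<bullet> w \<omega>\<bar> \<le> C0 * norm (w \<omega>)"
        using pC0[of \<omega>] by (intro order_trans[OF Cauchy_Schwarz_ineq2] mult_right_mono) auto
      then have "(p \<omega> \<bullet> w \<omega>)\<^sup>2 \<le> C0\<^sup>2 * norm (w \<omega>) ^ 2"
        using power_mono[of "\<bar>p \<omega> \<bullet> w \<omega>\<bar>" "C0 * norm (w \<omega>)" 2] by (simp add: power_mult_distrib)
      then have "\<bar>D t \<omega> * (G2 (v0 \<omega>) * (1 / 2))\<bar> * (p \<omega> \<bullet> w \<omega>)\<^sup>2 \<le> K * (C0\<^sup>2 * norm (w \<omega>) ^ 2)"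
        using K[OF \<open>\<omega> \<in> space M\<close>] order_trans[OF abs_ge_zero K[OF \<open>\<omega> \<in> space M\<close>]] by (intro mult_mono) auto
      moreover have "norm (\<Psi>2 \<omega> (w \<omega>)) = \<bar>D t \<omega> * (G2 (v0 \<omega>) * (1 / 2))\<bar> * (p \<omega> \<bullet> w \<omega>)\<^sup>2"
        by (simp add: \<Psi>2_def abs_mult)
      ultimately show "norm (\<Psi>2 \<omega> (w \<omega>)) \<le> norm (K * (C0\<^sup>2 * norm (w \<omega>) ^ 2))"
        using abs_ge_self[of "K * (C0\<^sup>2 * norm (w \<omega>) ^ 2)"] unfolding real_norm_def by linarith
    qed
  qed
  have E\<Psi>1: "(\<integral>\<omega>. \<Psi>1 \<omega> (w \<omega>) \<partial>M) = 0"
  proof -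
    have "(\<integral>\<omega>. \<Psi>1 \<omega> (w \<omega>) \<partial>M) = (\<integral>\<omega>. (\<integral>z. \<Psi>1 \<omega> (sqrt (t' - t) *\<^sub>R z) \<partial>std_gaussian) \<partial>M)"
      unfolding w_def
    proof (rule expectation_independent_increment[OF _ t(1) t1(3)])
      show "(\<lambda>(\<omega>, x). \<Psi>1 \<omega> x) \<in> borel_measurable (Ft t \<Otimes>\<^sub>M borel)"
        unfolding \<Psi>1_def v0_def by measurable
      show "integrable M (\<lambda>\<omega>. \<Psi>1 \<omega> (W t' \<omega> - W t \<omega>))"
        using bdd_rv_integrable[OF b\<Psi>1] unfolding w_def .
    qed
    moreover have "(\<integral>z. \<Psi>1 \<omega> (sqrt (t' - t) *\<^sub>R z) \<partial>std_gaussian) = 0" for \<omega>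
      unfolding \<Psi>1_def using v_integrable[OF t(3)] v_semigroup[OF t1(3) t(3), of "Y t \<omega>"]
      by (simp add: v0_def)
    ultimately show ?thesis by simp
  qed
  have E\<Psi>2: "(\<integral>\<omega>. \<Psi>2 \<omega> (w \<omega>) \<partial>M) = (\<integral>\<omega>. V \<omega> \<partial>M)"
  proof -
    have "(\<integral>\<omega>. \<Psi>2 \<omega> (w \<omega>) \<partial>M) = (\<integral>\<omega>. (\<integral>z. \<Psi>2 \<omega> (sqrt (t' - t) *\<^sub>R z) \<partial>std_gaussian) \<partial>M)"
      unfolding w_def
    proof (rule expectation_independent_increment[OF _ t(1) t1(3)])
      show "(\<lambda>(\<omega>, x). \<Psi>2 \<omega> x) \<in> borel_measurable (Ft t \<Otimes>\<^sub>M borel)"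
        unfolding \<Psi>2_def v0_def p_def by measurable
      show "integrable M (\<lambda>\<omega>. \<Psi>2 \<omega> (W t' \<omega> - W t \<omega>))"
        using i\<Psi>2 unfolding w_def .
    qed
    moreover have "(\<integral>z. \<Psi>2 \<omega> (sqrt (t' - t) *\<^sub>R z) \<partial>std_gaussian) = V \<omega>" for \<omega>
    proof -
      have "(\<integral>z. (p \<omega> \<bullet> z)\<^sup>2 \<partial>std_gaussian) = (norm (p \<omega>))\<^sup>2"
        using std_gaussian_variance[of "p \<omega>"] by (simp add: has_bochner_integral_iff inner_commute)
      then show ?thesis
        using t unfolding \<Psi>2_def V_def by (simp add: power_mult_distrib)
    qed
    ultimately show ?thesis by (simp only:)
  qed
  have int_m3: "integrable std_gaussian (\<lambda>z::'a. (1 + norm z) ^ 3)"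
  proof (rule integrable_std_gaussian_of_bound[of _ 8])
    fix z :: 'a
    have "(1 + x) ^ 3 \<le> 8 * (1 + x ^ 4)" if "0 \<le> x" for x :: real
    proof (cases "x \<le> 1")
      case True
      then have "(1 + x) ^ 3 \<le> 2 ^ 3" using that by (intro power_mono) auto
      then show ?thesis using that by (simp add: add_increasing2)
    next
      case False
      then have "(1 + x) ^ 3 \<le> (2 * x) ^ 3" using that by (intro power_mono) auto
      also have "\<dots> = 8 * x ^ 3" by (simp add: power_mult_distrib)
      also have "\<dots> \<le> 8 * x ^ 4" using False power_increasing[of 3 4 x] by simp
      finally show ?thesis by simp
    qed
    then show "\<bar>(1 + norm z) ^ 3\<bar> \<le> 8 * (1 + norm z ^ 4)" by simp
  qed measurable
  have int_w3: "integrable M (\<lambda>\<omega>. (r + norm (w \<omega>)) ^ 3)" and E_w3: "(\<integral>\<omega>. (r + norm (w \<omega>)) ^ 3 \<partial>M) = r ^ 3 * m3"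
  proof -
    have eq: "(r + norm (sqrt (t' - t) *\<^sub>R z)) ^ 3 = r ^ 3 * (1 + norm z) ^ 3" for z :: 'a
      using r unfolding r_def[symmetric] by (simp add: power_mult_distrib[symmetric] distrib_left)
    have m: "(\<lambda>x::'a. (r + norm x) ^ 3) \<in> borel_measurable borel" by measurable
    show "integrable M (\<lambda>\<omega>. (r + norm (w \<omega>)) ^ 3)"
      unfolding w_def integrable_increment[OF m t(1) t1(3)] eq by (intro integrable_mult_right int_m3)
    show "(\<integral>\<omega>. (r + norm (w \<omega>)) ^ 3 \<partial>M) = r ^ 3 * m3"
      unfolding w_def expectation_increment[OF m t(1) t1(3)] eq m3_def by simp
  qed
  define P where "P \<omega> = X1 \<omega> - X0 \<omega> - S \<omega> - \<Psi>1 \<omega> (w \<omega>) - \<Psi>2 \<omega> (w \<omega>)" for \<omega>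
  have P_le: "\<bar>P \<omega>\<bar> \<le> exp (c ^ 3 / 2) * (step_const (C1 c) * (r + norm (w \<omega>)) ^ 3)" if "\<omega> \<in> space M" for \<omega>
    using step_bound[OF t that] unfolding P_def X1_def X0_def S_def \<Psi>1_def \<Psi>2_def v0_def p_def w_def r_def
    by (simp add: algebra_simps)
  note ints = bdd_rv_integrable[OF bX0] bdd_rv_integrable[OF bX1] bdd_rv_integrable[OF bS] bdd_rv_integrable[OF bV]
    bdd_rv_integrable[OF bIc] bdd_rv_integrable[OF b\<Psi>1] i\<Psi>2 bdd_rv_integrable[OF b\<Delta>c]
  have iP: "integrable M P" unfolding P_def[abs_def] by (intro Bochner_Integration.integrable_diff ints)
  have "\<bar>\<integral>\<omega>. P \<omega> \<partial>M\<bar> \<le> (\<integral>\<omega>. \<bar>P \<omega>\<bar> \<partial>M)" by (rule integral_abs_bound)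
  also have "\<dots> \<le> (\<integral>\<omega>. exp (c ^ 3 / 2) * (step_const (C1 c) * (r + norm (w \<omega>)) ^ 3) \<partial>M)"
    by (intro integral_mono iP[THEN integrable_abs] P_le integrable_mult_right int_w3)
  also have "\<dots> = exp (c ^ 3 / 2) * step_const (C1 c) * m3 * r ^ 3"
    by (simp add: E_w3)
  finally have EP: "\<bar>\<integral>\<omega>. P \<omega> \<partial>M\<bar> \<le> exp (c ^ 3 / 2) * step_const (C1 c) * m3 * r ^ 3" .
  let ?K = "exp (c ^ 3) * c ^ 3 * R_bound c * c\<^sup>2"
  have "\<bar>\<integral>\<omega>. \<Delta>c \<omega> - Ic \<omega> \<partial>M\<bar> \<le> (\<integral>\<omega>. \<bar>\<Delta>c \<omega> - Ic \<omega>\<bar> \<partial>M)" by (rule integral_abs_bound)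
  also have "\<dots> \<le> (\<integral>\<omega>. ?K * (t' - t)\<^sup>2 \<partial>M)"
    using cost_increment[OF t(1) t1(3) t(3)] ints unfolding \<Delta>c_def Ic_def
    by (intro integral_mono) auto
  also have "\<dots> = ?K * (t' - t)\<^sup>2" by (simp add: prob_space)
  also have "\<dots> \<le> ?K * r ^ 3"
  proof (rule mult_left_mono)
    have "(t' - t)\<^sup>2 = r ^ 4" unfolding r(3)[symmetric] by simp
    also have "\<dots> \<le> r ^ 3" using r by (intro power_decreasing) auto
    finally show "(t' - t)\<^sup>2 \<le> r ^ 3" .
    show "0 \<le> ?K" using c R_bound_nonneg[of c] by (intro mult_nonneg_nonneg) auto
  qed
  finally have EC: "\<bar>\<integral>\<omega>. \<Delta>c \<omega> - Ic \<omega> \<partial>M\<bar> \<le> ?K * r ^ 3" .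
  have J_eq: "J u = (\<integral>\<omega>. D u \<omega> * G (v u (Y u \<omega>)) \<partial>M) - 1/2 * (\<integral>\<omega>. cost u \<omega> \<partial>M)" if "0 \<le> u" "u \<le> 1" for u
  proof -
    have "bdd_rv (\<lambda>\<omega>. D u \<omega> * G (v u (Y u \<omega>)))"
      using that by (intro bdd_rv_mult bdd_rv_D bdd_rv_comp cont) (auto intro: bounds)
    from bdd_rv_integrable[OF this] bdd_rv_integrable[OF bcost[OF that]] show ?thesis
      unfolding J_def cost_def[symmetric] by simp
  qed
  have "(\<integral>\<omega>. cost t' \<omega> \<partial>M) = (\<integral>\<omega>. cost t \<omega> + \<Delta>c \<omega> \<partial>M)"
    using integral_add[OF jb_cost order_refl t(1) t1(3) t(3)]
    by (intro Bochner_Integration.integral_cong) (auto simp: cost_def \<Delta>c_def)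
  also have "\<dots> = (\<integral>\<omega>. cost t \<omega> \<partial>M) + (\<integral>\<omega>. \<Delta>c \<omega> \<partial>M)"
    using bdd_rv_integrable[OF bcost[OF t(1) t1(1)]] ints by simp
  finally have "J t' - J t = (\<integral>\<omega>. X1 \<omega> \<partial>M) - (\<integral>\<omega>. X0 \<omega> \<partial>M) - 1/2 * (\<integral>\<omega>. \<Delta>c \<omega> \<partial>M)"
    using J_eq[OF t(1) t1(1)] J_eq[OF t1(2) t(3)] by (simp add: X1_def X0_def v0_def add_divide_distrib)
  moreover have "(\<integral>\<omega>. D t \<omega> * gain t t' \<omega> \<partial>M) = (\<integral>\<omega>. S \<omega> + V \<omega> - 1/2 * Ic \<omega> \<partial>M)"
    by (intro Bochner_Integration.integral_cong)
      (auto simp: gain_def S_def V_def Ic_def v0_def p_def algebra_simps)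
  moreover have "\<dots> = (\<integral>\<omega>. S \<omega> \<partial>M) + (\<integral>\<omega>. V \<omega> \<partial>M) - 1/2 * (\<integral>\<omega>. Ic \<omega> \<partial>M)"
    using ints by simp
  moreover have "(\<integral>\<omega>. P \<omega> \<partial>M) = (\<integral>\<omega>. X1 \<omega> \<partial>M) - (\<integral>\<omega>. X0 \<omega> \<partial>M) - (\<integral>\<omega>. S \<omega> \<partial>M) - 0 - (\<integral>\<omega>. V \<omega> \<partial>M)"
    unfolding P_def E\<Psi>1[symmetric] E\<Psi>2[symmetric] using ints by simp
  moreover have "(\<integral>\<omega>. \<Delta>c \<omega> - Ic \<omega> \<partial>M) = (\<integral>\<omega>. \<Delta>c \<omega> \<partial>M) - (\<integral>\<omega>. Ic \<omega> \<partial>M)"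
    using ints by simp
  ultimately have "J t' - J t - (\<integral>\<omega>. D t \<omega> * gain t t' \<omega> \<partial>M) = (\<integral>\<omega>. P \<omega> \<partial>M) - 1/2 * (\<integral>\<omega>. \<Delta>c \<omega> - Ic \<omega> \<partial>M)"
    by (simp add: algebra_simps add_divide_distrib diff_divide_distrib)
  also have "\<bar>\<dots>\<bar> \<le> exp (c ^ 3 / 2) * step_const (C1 c) * m3 * r ^ 3 + ?K * r ^ 3"
    using EP EC by linarith
  also have "\<dots> = err_const c * sqrt (t' - t) ^ 3"
    unfolding err_const_def r_def by (simp add: distrib_right)
  finally show ?thesis .
qed

end

section \<open>Verification and Euler controls\<close>

context controlled_bm
begin

definition gain_rate :: "real \<Rightarrow> real \<Rightarrow> real \<Rightarrow> 'w \<Rightarrow> real" where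
  "gain_rate t t' s \<omega> = 1/2 * (\<beta> s \<omega> * (norm (\<alpha> s \<omega>))\<^sup>2) * G (v t (Y t \<omega>)) + G1 (v t (Y t \<omega>)) * (grad t' (Y t \<omega>) \<bullet> \<alpha> s \<omega>)
     + G2 (v t (Y t \<omega>)) / 2 * (norm (grad t' (Y t \<omega>)))\<^sup>2 - 1/2 * (R (\<beta> s \<omega>) * (norm (\<alpha> s \<omega>))\<^sup>2)"

lemma
  assumes t: "0 \<le> t" "t \<le> t'" "t' \<le> 1" and \<omega>: "\<omega> \<in> space M"
  shows gain_rate_integrable: "integrable lborel (\<lambda>s. indicator {t..t'} s *\<^sub>R gain_rate t t' s \<omega>)"
    and gain_eq_integral: "gain t t' \<omega> = (\<integral>s. indicator {t..t'} s *\<^sub>R gain_rate t t' s \<omega> \<partial>lborel)"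
proof -
  let ?i = "indicator {t..t'} :: real \<Rightarrow> real"
  define g g1 g2 p where "g = G (v t (Y t \<omega>))" "g1 = G1 (v t (Y t \<omega>))" "g2 = G2 (v t (Y t \<omega>))" "p = grad t' (Y t \<omega>)"
  have int: "integrable lborel (\<lambda>s. ?i s *\<^sub>R b2 s \<omega>)" "integrable lborel (\<lambda>s. ?i s *\<^sub>R \<alpha> s \<omega>)"
    "integrable lborel (\<lambda>s. ?i s *\<^sub>R rc s \<omega>)"
    using bounded_path_integrable[OF jointly_bounded_path[OF jb_b2 \<omega>] t(1,3)]
      bounded_path_integrable[OF jointly_bounded_path[OF jb_\<alpha> \<omega>] t(1,3)]
      bounded_path_integrable[OF jointly_bounded_path[OF jb_rc \<omega>] t(1,3)]
    unfolding set_integrable_def by auto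
  have int1: "integrable lborel ?i"
    using t by (intro integrable_real_indicator) (auto simp: emeasure_lborel_Icc_eq)
  define h where "h s = 1/2 * g * (?i s *\<^sub>R b2 s \<omega>) + g1 * (p \<bullet> (?i s *\<^sub>R \<alpha> s \<omega>)) + g2 / 2 * (norm p)\<^sup>2 * ?i s
      - 1/2 * (?i s *\<^sub>R rc s \<omega>)" for s
  have eq: "?i s *\<^sub>R gain_rate t t' s \<omega> = h s" for s
    by (auto simp: indicator_def gain_rate_def h_def g_g1_g2_p_def)
  have ints: "integrable lborel (\<lambda>s. 1/2 * g * (?i s *\<^sub>R b2 s \<omega>))" "integrable lborel (\<lambda>s. g1 * (p \<bullet> (?i s *\<^sub>R \<alpha> s \<omega>)))"
    "integrable lborel (\<lambda>s. g2 / 2 * (norm p)\<^sup>2 * ?i s)" "integrable lborel (\<lambda>s. 1/2 * (?i s *\<^sub>R rc s \<omega>))"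
    by (intro integrable_mult_right integrable_inner_right int int1)+
  show "integrable lborel (\<lambda>s. ?i s *\<^sub>R gain_rate t t' s \<omega>)"
    unfolding eq h_def by (intro Bochner_Integration.integrable_add Bochner_Integration.integrable_diff ints)
  have "integral\<^sup>L lborel h = (\<integral>s. 1/2 * g * (?i s *\<^sub>R b2 s \<omega>) \<partial>lborel) + (\<integral>s. g1 * (p \<bullet> (?i s *\<^sub>R \<alpha> s \<omega>)) \<partial>lborel)
      + (\<integral>s. g2 / 2 * (norm p)\<^sup>2 * ?i s \<partial>lborel) - (\<integral>s. 1/2 * (?i s *\<^sub>R rc s \<omega>) \<partial>lborel)"
    unfolding h_def using ints
    by (simp only: Bochner_Integration.integral_add Bochner_Integration.integral_diff Bochner_Integration.integrable_add)
  also have "\<dots> = 1/2 * g * (LINT s:{t..t'}|lborel. b2 s \<omega>) + g1 * (p \<bullet> (LINT s:{t..t'}|lborel. \<alpha> s \<omega>))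
      + g2 / 2 * (norm p)\<^sup>2 * (t' - t) - 1/2 * (LINT s:{t..t'}|lborel. rc s \<omega>)"
    unfolding integral_mult_right_zero integral_inner_right[OF int(2)] set_lebesgue_integral_def
    using t by simp
  finally show "gain t t' \<omega> = (\<integral>s. ?i s *\<^sub>R gain_rate t t' s \<omega> \<partial>lborel)"
    unfolding eq gain_def g_g1_g2_p_def by simp
qed

lemma gain_nonpos:
  assumes "0 \<le> t" "t \<le> t'" "t' \<le> 1" "\<omega> \<in> space M"
  shows "gain t t' \<omega> \<le> 0"
proof -
  have "indicator {t..t'} s *\<^sub>R gain_rate t t' s \<omega> \<le> 0" for s
    unfolding gain_rate_def using running_gain_nonpos[OF v_in] by (auto simp: indicator_def)
  then have "(\<integral>s. indicator {t..t'} s *\<^sub>R gain_rate t t' s \<omega> \<partial>lborel) \<le> (\<integral>(s::real). 0 \<partial>lborel)"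
    by (intro integral_mono gain_rate_integrable[OF assms]) auto
  then show ?thesis
    unfolding gain_eq_integral[OF assms] by simp
qed

text \<open>Optimality is asked inside the step only, because step controls already carry their next
  value at \<open>t'\<close>; the endpoints are Lebesgue null.\<close>

lemma gain_zero:
  assumes t: "0 \<le> t" "t \<le> t'" "t' \<le> 1" "\<omega> \<in> space M"
    and opt: "\<And>s. t < s \<Longrightarrow> s < t' \<Longrightarrow> \<alpha> s \<omega> = (- G2 (v t (Y t \<omega>)) / G1 (v t (Y t \<omega>))) *\<^sub>R grad t' (Y t \<omega>)"
      "\<And>s. t < s \<Longrightarrow> s < t' \<Longrightarrow> \<beta> s \<omega> = bs (v t (Y t \<omega>))"
  shows "gain t t' \<omega> = 0"
proof -
  have "AE s in lborel. indicator {t..t'} s *\<^sub>R gain_rate t t' s \<omega> = 0"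
    using AE_lborel_singleton[of t] AE_lborel_singleton[of t']
  proof eventually_elim
    case (elim s)
    show ?case
    proof (cases "s \<in> {t..t'}")
      case True
      with elim have "t < s" "s < t'" by auto
      then show ?thesis
        unfolding gain_rate_def opt[OF \<open>t < s\<close> \<open>s < t'\<close>]
        using running_gain_optimal[OF v_in[of t "Y t \<omega>"], of "grad t' (Y t \<omega>)"] by (simp only: scaleR_zero_right)
    qed simp
  qed
  then show ?thesis
    unfolding gain_eq_integral[OF t] by (rule integral_eq_zero_AE)
qed

lemma J_0: "J 0 = G (v 0 0)"
proof -
  have "AE \<omega> in M. D 0 \<omega> * G (v 0 (Y 0 \<omega>)) - 1/2 * (LINT s:{0..0}|lborel. D s \<omega> * rc s \<omega>) = G (v 0 0)"
    using W_start
  proof eventually_elim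
    case (elim \<omega>)
    have zero: "(LINT s:{0..0}|lborel. h s) = 0" for h :: "real \<Rightarrow> 'x::euclidean_space"
    proof -
      have "AE s in lborel. indicator {0..0::real} s *\<^sub>R h s = 0"
        using AE_lborel_singleton[of "0 :: real"] by eventually_elim (auto simp: indicator_def)
      then show ?thesis
        unfolding set_lebesgue_integral_def by (rule integral_eq_zero_AE)
    qed
    show ?case
      unfolding Y_def discount_def elim zero by simp
  qed
  moreover have "bdd_rv (\<lambda>\<omega>. D 0 \<omega> * G (v 0 (Y 0 \<omega>)) - 1/2 * (LINT s:{0..0}|lborel. D s \<omega> * rc s \<omega>))"
    by (intro bdd_rv_mult bdd_rv_diff bdd_rv_const bdd_rv_D bdd_rv_integral[OF jb_cost] bdd_rv_comp[OF _ _ _ cont(1) bounds(1)]) auto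
  ultimately have "J 0 = (\<integral>\<omega>. G (v 0 0) \<partial>M)"
    unfolding J_def by (intro integral_cong_AE) (auto simp: bdd_rv_def)
  then show ?thesis by (simp add: prob_space)
qed

lemma J_1: "J 1 = K_functional M W R (\<lambda>y. G (heat \<epsilon> \<phi> y)) \<alpha> \<beta>"
  unfolding J_def K_functional_def Y_def v_def by (simp add: mult.assoc)

lemma J_mesh_upper:
  assumes "0 < N" "k \<le> N"
  shows "J (real k / real N) \<le> J 0 + real k * (err_const c * sqrt (1 / real N) ^ 3)"
  using \<open>k \<le> N\<close>
proof (induction k)
  case (Suc k)
  define t t' where "t = real k / real N" "t' = real (Suc k) / real N"
  have t: "0 \<le> t" "t < t'" "t' \<le> 1" "t' - t = 1 / real N"
    using Suc.prems \<open>0 < N\<close> by (auto simp: t_t'_def field_simps)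
  have "(\<integral>\<omega>. D t \<omega> * gain t t' \<omega> \<partial>M) \<le> 0"
  proof -
    have "0 \<le> (\<integral>\<omega>. - (D t \<omega> * gain t t' \<omega>) \<partial>M)"
      using gain_nonpos[of t t'] t D_pos[of t]
      by (intro integral_nonneg_AE AE_I2) (auto simp: mult_le_0_iff intro: less_imp_le)
    then show ?thesis by simp
  qed
  with one_step[OF t(1-3)] have "J t' \<le> J t + err_const c * sqrt (t' - t) ^ 3"
    by linarith
  with Suc show ?case
    unfolding t(4) by (simp add: t_t'_def algebra_simps)
qed simp

lemma mesh_error: "0 < N \<Longrightarrow> real N * (K * sqrt (1 / real N) ^ 3) = K / sqrt (real N)"
  by (simp add: power3_eq_cube real_sqrt_divide)

lemma J_upper: "J 1 \<le> J 0"
proof -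
  have "J 1 \<le> J 0 + err_const c * inverse (sqrt (real (Suc n)))" for n
  proof -
    have "J (real (Suc n) / real (Suc n)) \<le> J 0 + real (Suc n) * (err_const c * sqrt (1 / real (Suc n)) ^ 3)"
      by (rule J_mesh_upper) auto
    then show ?thesis
      unfolding mesh_error[OF zero_less_Suc] by (simp add: divide_inverse del: of_nat_Suc)
  qed
  moreover have "(\<lambda>n. J 0 + err_const c * inverse (sqrt (real (Suc n)))) \<longlonglongrightarrow> J 0 + err_const c * 0"
    by (intro tendsto_intros tendsto_inverse_0_at_top filterlim_compose[OF sqrt_at_top]
        filterlim_compose[OF filterlim_real_sequentially] filterlim_Suc)
  ultimately show ?thesis
    using LIMSEQ_le_const[of _ "J 0 + err_const c * 0" "J 1"] by auto
qed

lemma J_mesh_lower: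
  assumes "0 < N" "k \<le> N"
    and gain0: "\<And>k \<omega>. k < N \<Longrightarrow> \<omega> \<in> space M \<Longrightarrow> gain (real k / real N) (real (Suc k) / real N) \<omega> = 0"
  shows "J 0 - real k * (err_const c * sqrt (1 / real N) ^ 3) \<le> J (real k / real N)"
  using \<open>k \<le> N\<close>
proof (induction k)
  case (Suc k)
  define t t' where "t = real k / real N" "t' = real (Suc k) / real N"
  have t: "0 \<le> t" "t < t'" "t' \<le> 1" "t' - t = 1 / real N"
    using Suc.prems \<open>0 < N\<close> by (auto simp: t_t'_def field_simps)
  have "(\<integral>\<omega>. D t \<omega> * gain t t' \<omega> \<partial>M) = (\<integral>\<omega>. 0 \<partial>M)"
    using gain0[of k] Suc.prems by (intro Bochner_Integration.integral_cong) (auto simp: t_t'_def)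
  with one_step[OF t(1-3)] have "J t - err_const c * sqrt (t' - t) ^ 3 \<le> J t'"
    by simp
  with Suc show ?case
    unfolding t(4) by (simp add: t_t'_def algebra_simps)
qed simp

end

section \<open>Upper bound for all controls and near-optimal Euler controls\<close>

context bm_hjb
begin

lemma K_functional_le_value:
  assumes "\<alpha> \<in> bounded_controls M Ft" "\<beta> \<in> bounded_controls M Ft"
  shows "K_functional M W R (\<lambda>y. G (heat \<epsilon> \<phi> y)) \<alpha> \<beta> \<le> G (heat (1 + \<epsilon>) \<phi> 0)"
proof -
  obtain C K where CK: "\<forall>t\<in>{0..1}. \<forall>\<omega>\<in>space M. norm (\<alpha> t \<omega>) \<le> C" "\<forall>t\<in>{0..1}. \<forall>\<omega>\<in>space M. norm (\<beta> t \<omega>) \<le> K"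
    using assms by (auto simp: bounded_controls_def)
  interpret controlled_bm M Ft W A B L G G1 G2 bs R \<phi> \<epsilon> \<alpha> \<beta> "max 1 (max C K)"
    by unfold_locales (use assms CK in \<open>auto simp: bounded_controls_def le_max_iff_disj\<close>)
  show ?thesis
    using J_upper unfolding J_0 J_1 by (simp add: v_def)
qed

lemma progressive_step_process:
  fixes x :: "nat \<Rightarrow> 'w \<Rightarrow> 'b::euclidean_space"
  assumes "0 < N" and x: "\<And>k. k < N \<Longrightarrow> x k \<in> borel_measurable (Ft (real k / real N))"
  shows "progressively_measurable Ft (\<lambda>s \<omega>. \<Sum>k<N. indicator {real k / real N..<real (Suc k) / real N} s *\<^sub>R x k \<omega>)"
  unfolding progressively_measurable_def
proof
  fix t :: real assume t: "t \<in> {0..1}"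
  let ?i = "\<lambda>k s. indicator {real k / real N..<real (Suc k) / real N} s :: real"
  have m: "(\<lambda>z. ?i k (fst z) *\<^sub>R x k (snd z)) \<in> borel_measurable (restrict_space borel {0..t} \<Otimes>\<^sub>M Ft t)"
    if "k \<in> {k. k < N \<and> real k / real N \<le> t}" for k
  proof (rule borel_measurable_scaleR)
    have "?i k \<in> borel_measurable (restrict_space borel {0..t})"
      by (intro measurable_restrict_space1) simp
    then show "(\<lambda>z. ?i k (fst z)) \<in> borel_measurable (restrict_space borel {0..t} \<Otimes>\<^sub>M Ft t)"
      by (rule measurable_compose[OF measurable_fst])
    have "x k \<in> borel_measurable (Ft t)"
      using that x by (intro Ft_measurable_mono[of "real k / real N" t]) auto
    then show "(\<lambda>z. x k (snd z)) \<in> borel_measurable (restrict_space borel {0..t} \<Otimes>\<^sub>M Ft t)"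
      by (rule measurable_compose[OF measurable_snd])
  qed
  \<comment> \<open>Before time \<open>t\<close> only the steps already begun contribute, and their
    values are known at time \<open>t\<close>.\<close>
  have "(\<lambda>z. \<Sum>k\<in>{k. k < N \<and> real k / real N \<le> t}. ?i k (fst z) *\<^sub>R x k (snd z))
      \<in> borel_measurable (restrict_space borel {0..t} \<Otimes>\<^sub>M Ft t)"
    by (rule borel_measurable_sum) (rule m)
  then show "(\<lambda>(s, \<omega>). \<Sum>k<N. ?i k s *\<^sub>R x k \<omega>) \<in> borel_measurable (restrict_space borel {0..t} \<Otimes>\<^sub>M Ft t)"
  proof (rule measurable_cong[THEN iffD1, rotated])
    fix z assume "z \<in> space (restrict_space borel {0..t} \<Otimes>\<^sub>M Ft t)"
    then have "fst z \<le> t" by (auto simp: space_pair_measure space_restrict_space)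
    then show "(\<Sum>k\<in>{k. k < N \<and> real k / real N \<le> t}. ?i k (fst z) *\<^sub>R x k (snd z)) = (case z of (s, \<omega>) \<Rightarrow> \<Sum>k<N. ?i k s *\<^sub>R x k \<omega>)"
      unfolding split_beta' by (intro sum.mono_neutral_left) (auto simp: indicator_def)
  qed
qed

lemma step_process_value:
  assumes "0 < N" "k < N" "real k / real N \<le> s" "s < real (Suc k) / real N"
  shows "(\<Sum>j<N. indicator {real j / real N..<real (Suc j) / real N} s *\<^sub>R x j) = (x k :: 'b::real_vector)"
proof -
  have eq: "j = k" if "real j / real N \<le> s" "s < real (Suc j) / real N" for j
  proof -
    have "real j / real N < real (Suc k) / real N" "real k / real N < real (Suc j) / real N"
      using that assms by linarith+
    then have "real j < real (Suc k)" "real k < real (Suc j)"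
      using \<open>0 < N\<close> by (auto simp: divide_less_cancel simp del: of_nat_Suc)
    then show ?thesis by simp
  qed
  have "(\<Sum>j<N. indicator {real j / real N..<real (Suc j) / real N} s *\<^sub>R x j) = (\<Sum>j<N. if k = j then x j else 0)"
  proof (rule sum.cong[OF refl])
    fix j
    show "indicator {real j / real N..<real (Suc j) / real N} s *\<^sub>R x j = (if k = j then x j else 0)"
      using eq[of j] assms(3,4) by (cases "k = j") (auto simp: indicator_def)
  qed
  then show ?thesis
    using \<open>k < N\<close> by (simp add: sum.delta)
qed

lemma step_process_bound:
  fixes x :: "nat \<Rightarrow> 'b::real_normed_vector"
  assumes "0 < N" "s \<in> {0..1}" "\<And>k. k < N \<Longrightarrow> norm (x k) \<le> K" "0 \<le> K"
  shows "norm (\<Sum>j<N. indicator {real j / real N..<real (Suc j) / real N} s *\<^sub>R x j) \<le> K"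
proof (cases "s < 1")
  case True
  define k where "k = nat \<lfloor>s * real N\<rfloor>"
  have k: "real k \<le> s * real N" "s * real N < real k + 1"
    using assms by (auto simp: k_def)
  have "s * real N < 1 * real N" using True \<open>0 < N\<close> by (intro mult_strict_right_mono) auto
  then have "k < N" using k by linarith
  moreover have "real k / real N \<le> s" "s < real (Suc k) / real N"
    using k \<open>0 < N\<close> by (auto simp: field_simps)
  ultimately show ?thesis
    using step_process_value[OF \<open>0 < N\<close>, of k s x] assms(3) by simp
next
  \<comment> \<open>At \<open>s = 1\<close> all the half-open mesh intervals miss \<open>s\<close>,
    and the process takes the value zero.\<close>
  case False
  then have "indicator {real j / real N..<real (Suc j) / real N} s = (0::real)" if "j < N" for j
    using that assms(2) by (auto simp: indicator_def field_simps)
  then show ?thesis using \<open>0 \<le> K\<close> by simp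
qed

text \<open>The accumulated drift of the Euler scheme at mesh times. The optimal control is a
  feedback of the state it drives; this recursion, written in terms of \<open>W\<close> and earlier
  values only, breaks the circle. As in \<open>gain\<close>, the value is taken at the left mesh
  time and the gradient at the right one.\<close>

primrec euler_shift :: "nat \<Rightarrow> nat \<Rightarrow> 'w \<Rightarrow> 'a" where
  "euler_shift N 0 \<omega> = 0"
| "euler_shift N (Suc k) \<omega> = euler_shift N k \<omega> + (1 / real N) *\<^sub>R
     (let y = W (real k / real N) \<omega> + euler_shift N k \<omega>; u = v (real k / real N) y
      in (- G2 u / G1 u) *\<^sub>R grad (real (Suc k) / real N) y)"

definition euler_point :: "nat \<Rightarrow> nat \<Rightarrow> 'w \<Rightarrow> 'a" where
  "euler_point N k \<omega> = W (real k / real N) \<omega> + euler_shift N k \<omega>"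

definition euler_drift :: "nat \<Rightarrow> nat \<Rightarrow> 'w \<Rightarrow> 'a" where
  "euler_drift N k \<omega> = (let u = v (real k / real N) (euler_point N k \<omega>)
      in (- G2 u / G1 u) *\<^sub>R grad (real (Suc k) / real N) (euler_point N k \<omega>))"

definition euler_rate :: "nat \<Rightarrow> nat \<Rightarrow> 'w \<Rightarrow> real" where
  "euler_rate N k \<omega> = bs (v (real k / real N) (euler_point N k \<omega>))"

lemma euler_shift_Suc: "euler_shift N (Suc k) \<omega> = euler_shift N k \<omega> + (1 / real N) *\<^sub>R euler_drift N k \<omega>"
  by (simp add: euler_drift_def euler_point_def Let_def)

lemma euler_drift_comp_measurable:
  assumes "k < N" shows "(\<lambda>y. (- G2 (v (real k / real N) y) / G1 (v (real k / real N) y)) *\<^sub>R grad (real (Suc k) / real N) y) \<in> borel_measurable borel"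
proof -
  have t: "real k / real N \<le> 1" "real (Suc k) / real N \<le> 1" using assms by auto
  show ?thesis
    by (intro borel_measurable_scaleR borel_measurable_divide borel_measurable_uminus v_comp_measurable[OF t(1)] cont grad_measurable t)
qed

lemma euler_measurable: "0 < N \<Longrightarrow> k < N \<Longrightarrow> euler_point N k \<in> borel_measurable (Ft (real k / real N))
    \<and> euler_drift N k \<in> borel_measurable (Ft (real k / real N)) \<and> euler_rate N k \<in> borel_measurable (Ft (real k / real N))"
proof -
  assume N: "0 < N" "k < N"
  have drift: "euler_drift N k \<in> borel_measurable (Ft (real k / real N))"
    if "k < N" "euler_point N k \<in> borel_measurable (Ft (real k / real N))" for k
    using measurable_compose[OF that(2) euler_drift_comp_measurable[OF that(1)]]
    by (simp add: euler_drift_def[abs_def] Let_def)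
  have point: "euler_point N k \<in> borel_measurable (Ft (real k / real N))"
    if "euler_shift N k \<in> borel_measurable (Ft (real k / real N))" for k
    unfolding euler_point_def[abs_def] by (intro borel_measurable_add W_adapted that) simp
  have shift: "euler_shift N k \<in> borel_measurable (Ft (real k / real N))" if "k < N" for k
    using that
  proof (induction k)
    case 0
    have "euler_shift N 0 = (\<lambda>_. 0)" by auto
    then show ?case by simp
  next
    case (Suc k)
    have "euler_shift N (Suc k) \<in> borel_measurable (Ft (real k / real N))"
      unfolding euler_shift_Suc[abs_def] using Suc
      by (intro borel_measurable_add borel_measurable_scaleR drift point) auto
    then show ?case
      by (rule Ft_measurable_mono[rotated 2]) (auto simp: divide_right_mono)
  qed
  have p: "euler_point N k \<in> borel_measurable (Ft (real k / real N))"
    using N by (intro point shift)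
  moreover have "euler_rate N k \<in> borel_measurable (Ft (real k / real N))"
    unfolding euler_rate_def[abs_def] using N
    by (intro measurable_compose[OF p v_comp_measurable] cont) auto
  ultimately show ?thesis using drift N by blast
qed

text \<open>The bound on the controls involves only \<open>L\<close> and \<Lambda>, neither the mesh
  nor \<epsilon>, so \<epsilon> can afterwards be chosen small relative to
  \<open>exp (c ^ 3 / 2)\<close>.\<close>

lemma K_functional_ge_value:
  assumes grad_le: "\<And>t y. t \<le> 1 \<Longrightarrow> norm (grad t y) \<le> \<Lambda>" and "0 < \<eta>"
  shows "\<exists>\<alpha>\<in>bounded_controls M Ft. \<exists>\<beta>\<in>bounded_controls M Ft.
    (\<forall>t\<in>{0..1}. \<forall>\<omega>\<in>space M. norm (\<alpha> t \<omega>) \<le> 1 + L + L * \<Lambda> \<and> \<bar>\<beta> t \<omega>\<bar> \<le> 1 + L + L * \<Lambda>) \<and>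
    G (heat (1 + \<epsilon>) \<phi> 0) - \<eta> \<le> K_functional M W R (\<lambda>y. G (heat \<epsilon> \<phi> y)) \<alpha> \<beta>"
proof -
  define c where "c = 1 + L + L * \<Lambda>"
  have \<Lambda>: "0 \<le> \<Lambda>" using grad_le[of 0 0] order_trans[OF norm_ge_zero] by auto
  have L\<Lambda>: "0 \<le> L * \<Lambda>" using \<Lambda> L_ge_1 by simp
  then have c: "1 \<le> c" "L \<le> c" "L * \<Lambda> \<le> c" using L_ge_1 by (auto simp: c_def)
  have "(\<lambda>n. err_const c * inverse (sqrt (real (Suc n)))) \<longlonglongrightarrow> err_const c * 0"
    by (intro tendsto_intros tendsto_inverse_0_at_top filterlim_compose[OF sqrt_at_top]
        filterlim_compose[OF filterlim_real_sequentially] filterlim_Suc)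
  then have "eventually (\<lambda>n. err_const c * inverse (sqrt (real (Suc n))) < \<eta>) sequentially"
    using \<open>0 < \<eta>\<close> by (intro order_tendstoD(2)) auto
  then obtain n where n: "err_const c * inverse (sqrt (real (Suc n))) < \<eta>"
    by (auto simp: eventually_sequentially)
  define N where "N = Suc n"
  have N: "0 < N" by (simp add: N_def)
  define \<alpha> where "\<alpha> s \<omega> = (\<Sum>k<N. indicator {real k / real N..<real (Suc k) / real N} s *\<^sub>R euler_drift N k \<omega>)" for s \<omega>
  define \<beta> where "\<beta> s \<omega> = (\<Sum>k<N. indicator {real k / real N..<real (Suc k) / real N} s *\<^sub>R euler_rate N k \<omega>)" for s \<omega>
  have drift_le: "norm (euler_drift N k \<omega>) \<le> L * \<Lambda>" if "k < N" for k \<omega>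
  proof -
    define u where "u = v (real k / real N) (euler_point N k \<omega>)"
    have "\<bar>- G2 u / G1 u\<bar> \<le> L" using bounds(5)[of u] v_in by (simp add: u_def)
    moreover have "norm (grad (real (Suc k) / real N) (euler_point N k \<omega>)) \<le> \<Lambda>"
      using that by (intro grad_le) auto
    ultimately show ?thesis
      unfolding euler_drift_def Let_def u_def[symmetric] norm_scaleR
      using L_ge_1 by (intro mult_mono) auto
  qed
  have rate_le: "norm (euler_rate N k \<omega>) \<le> L" for k \<omega>
    using bounds(4)[OF v_in] by (simp add: euler_rate_def)
  have prog: "progressively_measurable Ft \<alpha>" "progressively_measurable Ft \<beta>"
    unfolding \<alpha>_def[abs_def] \<beta>_def[abs_def] using N euler_measurable by (intro progressive_step_process; simp)+
  have \<alpha>_le: "norm (\<alpha> s \<omega>) \<le> c" and \<beta>_le: "\<bar>\<beta> s \<omega>\<bar> \<le> c" if "s \<in> {0..1}" for s \<omega>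
  proof -
    show "norm (\<alpha> s \<omega>) \<le> c"
      unfolding \<alpha>_def using drift_le L\<Lambda> c(3) by (intro order_trans[OF step_process_bound[OF N that, of _ "L * \<Lambda>"]]) auto
    have "norm (\<beta> s \<omega>) \<le> L"
      unfolding \<beta>_def using rate_le L_ge_1 by (intro step_process_bound[OF N that]) auto
    then show "\<bar>\<beta> s \<omega>\<bar> \<le> c" using c(2) by simp
  qed
  interpret controlled_bm M Ft W A B L G G1 G2 bs R \<phi> \<epsilon> \<alpha> \<beta> c
    by unfold_locales (use prog \<alpha>_le \<beta>_le c in auto)
  \<comment> \<open>This closes the feedback loop: the controlled path passes through the Euler
    points, so the step controls are optimal for its own state at each mesh time.\<close>
  have Y_euler: "Y (real k / real N) \<omega> = euler_point N k \<omega>" if "k \<le> N" "\<omega> \<in> space M" for k \<omega>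
  proof -
    have "(LINT s:{0..real k / real N}|lborel. \<alpha> s \<omega>) = euler_shift N k \<omega>"
      using that(1)
    proof (induction k)
      case 0
      have "AE s in lborel. indicator {0..0::real} s *\<^sub>R \<alpha> s \<omega> = 0"
        using AE_lborel_singleton[of "0 :: real"] by eventually_elim (auto simp: indicator_def)
      then show ?case
        unfolding set_lebesgue_integral_def by (simp add: integral_eq_zero_AE)
    next
      case (Suc k)
      let ?t = "real k / real N" and ?t' = "real (Suc k) / real N"
      have t: "0 \<le> ?t" "?t \<le> ?t'" "?t' \<le> 1" using Suc.prems N by (auto simp: divide_right_mono)
      have "(LINT s:{?t..?t'}|lborel. \<alpha> s \<omega>) = (LINT s:{?t..?t'}|lborel. euler_drift N k \<omega>)"
      proof -
        have "AE s in lborel. indicator {?t..?t'} s *\<^sub>R \<alpha> s \<omega> = indicator {?t..?t'} s *\<^sub>R euler_drift N k \<omega>"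
          using AE_lborel_singleton[of ?t']
        proof eventually_elim
          case (elim s)
          show ?case
          proof (cases "s \<in> {?t..?t'}")
            case True
            with elim have "?t \<le> s" "s < ?t'" by auto
            then have "\<alpha> s \<omega> = euler_drift N k \<omega>"
              unfolding \<alpha>_def using Suc.prems by (intro step_process_value[OF N]) auto
            then show ?thesis by simp
          qed simp
        qed
        moreover have "(\<lambda>s. indicator {?t..?t'} s *\<^sub>R \<alpha> s \<omega>) \<in> borel_measurable lborel"
          using bounded_path_integrable[OF jointly_bounded_path[OF jb_\<alpha> that(2)] t(1,3)]
          unfolding set_integrable_def by (rule borel_measurable_integrable)
        ultimately show ?thesis
          unfolding set_lebesgue_integral_def by (intro integral_cong_AE) auto
      qed
      also have "\<dots> = (1 / real N) *\<^sub>R euler_drift N k \<omega>"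
        using t N by (simp add: set_lebesgue_integral_def field_simps)
      finally show ?case
        using integral_add[OF jb_\<alpha> order_refl t that(2)] Suc unfolding euler_shift_Suc by simp
    qed
    then show ?thesis by (simp add: Y_def euler_point_def)
  qed
  have gain0: "gain (real k / real N) (real (Suc k) / real N) \<omega> = 0" if "k < N" "\<omega> \<in> space M" for k \<omega>
  proof (rule gain_zero)
    have Yk: "Y (real k / real N) \<omega> = euler_point N k \<omega>" using that by (intro Y_euler) auto
    fix s assume s: "real k / real N < s" "s < real (Suc k) / real N"
    show "\<alpha> s \<omega> = (- G2 (v (real k / real N) (Y (real k / real N) \<omega>)) / G1 (v (real k / real N) (Y (real k / real N) \<omega>)))
        *\<^sub>R grad (real (Suc k) / real N) (Y (real k / real N) \<omega>)"
      unfolding \<alpha>_def step_process_value[OF N that(1) less_imp_le[OF s(1)] s(2)] Yk euler_drift_def Let_def ..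
    show "\<beta> s \<omega> = bs (v (real k / real N) (Y (real k / real N) \<omega>))"
      unfolding \<beta>_def step_process_value[OF N that(1) less_imp_le[OF s(1)] s(2)] Yk euler_rate_def ..
  qed (use that N in \<open>auto simp: divide_right_mono\<close>)
  have "J 0 - real N * (err_const c * sqrt (1 / real N) ^ 3) \<le> J (real N / real N)"
    by (rule J_mesh_lower[OF N order_refl gain0])
  then have "J 0 - \<eta> \<le> J 1"
    unfolding mesh_error[OF N] using n N by (simp add: N_def[symmetric] divide_inverse)
  then have "G (heat (1 + \<epsilon>) \<phi> 0) - \<eta> \<le> K_functional M W R (\<lambda>y. G (heat \<epsilon> \<phi> y)) \<alpha> \<beta>"
    unfolding J_0 J_1 by (simp add: v_def)
  moreover have "\<alpha> \<in> bounded_controls M Ft" "\<beta> \<in> bounded_controls M Ft"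
    using prog \<alpha>_le \<beta>_le unfolding bounded_controls_def by (auto intro!: exI[of _ c])
  ultimately show ?thesis
    using \<alpha>_le \<beta>_le unfolding c_def[symmetric] by blast
qed

text \<open>A step of length \<open>norm q / (n + 1)\<close> along the gradient \<open>q\<close>
  itself: the contribution of \<open>C0\<close> vanishes as \<open>n\<close> grows, and with it the
  dependence on \<epsilon>.\<close>

lemma grad_lipschitz_bound:
  assumes lip: "\<And>x y. \<bar>\<phi> x - \<phi> y\<bar> \<le> \<Lambda> * norm (x - y)" and t: "t \<le> 1"
  shows "norm (grad t y) \<le> \<Lambda>"
proof (cases "grad t y = 0")
  case True
  obtain h :: 'a where "norm h = 1" using vector_choose_size[of 1] by auto
  then have "0 \<le> \<Lambda>" using order_trans[OF abs_ge_zero lip[of h 0]] by simp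
  then show ?thesis using True by simp
next
  case False
  define q where "q = grad t y"
  have "norm q \<le> \<Lambda> + C0 * (1 / real (Suc n)) * norm q" for n
  proof -
    define h where "h = (1 / real (Suc n)) *\<^sub>R q"
    have nh: "norm h = norm q / real (Suc n)" "q \<bullet> h = (norm q)\<^sup>2 / real (Suc n)"
      by (simp_all add: h_def power2_norm_eq_inner)
    have "\<bar>v t (y + h) - v t y - q \<bullet> h\<bar> \<le> C0 * (norm h)\<^sup>2"
      using v_C11[OF t] unfolding C11_bound_def q_def by blast
    moreover have "\<bar>v t (y + h) - v t y\<bar> \<le> \<Lambda> * norm h"
      using heat_lipschitz_diff[OF lip \<phi>_bound \<phi>_measurable, of "1 + \<epsilon> - t" "y + h" "1 + \<epsilon> - t" y]
      by (simp add: v_def)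
    ultimately have "q \<bullet> h \<le> \<Lambda> * norm h + C0 * (norm h)\<^sup>2" by linarith
    then have "norm q * (norm q / real (Suc n)) \<le> (\<Lambda> + C0 * (1 / real (Suc n)) * norm q) * (norm q / real (Suc n))"
      unfolding nh by (simp add: power2_eq_square algebra_simps)
    moreover have "0 < norm q / real (Suc n)" using False by (simp add: q_def)
    ultimately show ?thesis by (simp only: mult_le_cancel_right_pos)
  qed
  moreover have "(\<lambda>n. \<Lambda> + C0 * (1 / real (Suc n)) * norm q) \<longlonglongrightarrow> \<Lambda> + C0 * 0 * norm q"
    by (intro tendsto_intros LIMSEQ_Suc[OF lim_1_over_n])
  ultimately show ?thesis
    using LIMSEQ_le_const[of _ "\<Lambda> + C0 * 0 * norm q" "norm q"] by (auto simp: q_def)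
qed

end

section \<open>Lipschitz approximation from below\<close>

text \<open>The Pasch--Hausdorff envelope: for \<open>f\<close> bounded below, its largest minorant
  with Lipschitz constant \<open>n\<close>.\<close>

definition inf_convolution :: "('a::euclidean_space \<Rightarrow> real) \<Rightarrow> nat \<Rightarrow> 'a \<Rightarrow> real" where
  "inf_convolution f n x = (INF y. f y + real n * norm (x - y))"

context
  fixes f :: "'a::euclidean_space \<Rightarrow> real" and a b :: real
  assumes f_in: "\<And>x. f x \<in> {a..b}"
begin

lemma inf_convolution_bdd: "bdd_below (range (\<lambda>y. f y + real n * norm (x - y)))"
  using f_in by (intro bdd_belowI[of _ a]) (auto intro: add_increasing2)

lemma inf_convolution_le: "inf_convolution f n x \<le> f y + real n * norm (x - y)"
  unfolding inf_convolution_def by (rule cINF_lower[OF inf_convolution_bdd]) simp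

lemma inf_convolution_le_self: "inf_convolution f n x \<le> f x"
  using inf_convolution_le[of n x x] by simp

lemma inf_convolution_in: "inf_convolution f n x \<in> {a..b}"
proof -
  have "a \<le> inf_convolution f n x"
    unfolding inf_convolution_def using f_in by (intro cINF_greatest) (auto intro: add_increasing2)
  then show ?thesis
    using inf_convolution_le_self[of n x] f_in[of x] by simp
qed

lemma inf_convolution_lipschitz: "\<bar>inf_convolution f n x - inf_convolution f n x'\<bar> \<le> real n * norm (x - x')"
proof -
  have *: "inf_convolution f n x - real n * norm (x - x') \<le> inf_convolution f n x'" for x x'
    unfolding inf_convolution_def[of f n x']
  proof (rule cINF_greatest)
    fix y
    have "norm (x - y) \<le> norm (x - x') + norm (x' - y)"
      using norm_triangle_ineq[of "x - x'" "x' - y"] by simp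
    then have "real n * norm (x - y) \<le> real n * norm (x - x') + real n * norm (x' - y)"
      unfolding distrib_left[symmetric] by (rule mult_left_mono) simp
    then show "inf_convolution f n x - real n * norm (x - x') \<le> f y + real n * norm (x' - y)"
      using inf_convolution_le[of n x y] by linarith
  qed simp
  show ?thesis
    using *[of x x'] *[of x' x] by (simp add: abs_le_iff norm_minus_commute)
qed

lemma inf_convolution_measurable: "inf_convolution f n \<in> borel_measurable borel"
proof -
  have "(real n)-lipschitz_on UNIV (inf_convolution f n)"
    using inf_convolution_lipschitz by (intro lipschitz_onI) (auto simp: dist_norm)
  then show ?thesis
    by (intro borel_measurable_continuous_onI lipschitz_on_continuous_on)
qed

text \<open>Near \<open>x\<close> lower semicontinuity keeps \<open>f\<close> above
  \<open>c'\<close>; at distance \<delta> or more the penalty \<open>n * \<delta>\<close> exceeds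
  \<open>c' - a\<close>, and \<open>f \<ge> a\<close>.\<close>

lemma inf_convolution_tendsto:
  assumes "lower_semicontinuous f"
  shows "(\<lambda>n. inf_convolution f n x) \<longlonglongrightarrow> f x"
proof (rule order_tendstoI)
  fix c assume "c < f x"
  then obtain c' where c': "c < c'" "c' < f x" using dense by blast
  then have "eventually (\<lambda>y. c' < f y) (nhds x)"
    using assms by (auto simp: lower_semicontinuous_def)
  then obtain \<delta> where \<delta>: "\<delta> > 0" "\<And>y. dist y x < \<delta> \<Longrightarrow> c' < f y"
    by (auto simp: eventually_nhds_metric)
  obtain N :: nat where N: "(c' - a) / \<delta> < real N" using reals_Archimedean2 by blast
  show "eventually (\<lambda>n. c < inf_convolution f n x) sequentially"
  proof (rule eventually_sequentiallyI[of N])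
    fix n assume "N \<le> n"
    have "c' \<le> inf_convolution f n x"
      unfolding inf_convolution_def
    proof (rule cINF_greatest)
      fix y
      show "c' \<le> f y + real n * norm (x - y)"
      proof (cases "dist y x < \<delta>")
        case True
        then show ?thesis using \<delta>(2)[of y] by (simp add: add_increasing2 less_imp_le)
      next
        case False
        have "c' - a \<le> real N * \<delta>" using N \<delta>(1) by (simp add: pos_divide_less_eq less_imp_le)
        also have "\<dots> \<le> real n * norm (x - y)"
          using \<open>N \<le> n\<close> False \<delta>(1) by (intro mult_mono) (auto simp: dist_norm norm_minus_commute)
        finally show ?thesis using f_in[of y] by simp
      qed
    qed simp
    then show "c < inf_convolution f n x" using c' by simp
  qed
next
  fix c assume "f x < c"
  then show "eventually (\<lambda>n. inf_convolution f n x < c) sequentially"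
    using inf_convolution_le_self[of _ x] by (intro always_eventually) (auto intro: le_less_trans)
qed

lemma lower_semicontinuous_measurable: "lower_semicontinuous f \<Longrightarrow> f \<in> borel_measurable borel"
  by (rule borel_measurable_LIMSEQ_real[OF inf_convolution_tendsto inf_convolution_measurable])

end

section \<open>Dependence of the cost functional on the terminal function\<close>

context controlled_bm
begin

lemma K_functional_eq:
  assumes f: "f \<in> borel_measurable borel" "\<And>y. \<bar>f y\<bar> \<le> K"
  shows "integrable M (\<lambda>\<omega>. D 1 \<omega> * f (Y 1 \<omega>))"
    and "K_functional M W R f \<alpha> \<beta> = (\<integral>\<omega>. D 1 \<omega> * f (Y 1 \<omega>) \<partial>M) - 1/2 * (\<integral>\<omega>. (LINT s:{0..1}|lborel. D s \<omega> * rc s \<omega>) \<partial>M)"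
proof -
  have "bdd_rv (\<lambda>\<omega>. f (Y 1 \<omega>))"
    using measurable_compose[OF Y_measurable[of 1] f(1)] f(2) by (intro bdd_rvI) auto
  then show int: "integrable M (\<lambda>\<omega>. D 1 \<omega> * f (Y 1 \<omega>))"
    by (intro bdd_rv_integrable bdd_rv_mult bdd_rv_D) auto
  have "integrable M (\<lambda>\<omega>. LINT s:{0..1}|lborel. D s \<omega> * rc s \<omega>)"
    by (intro bdd_rv_integrable bdd_rv_integral[OF jb_cost]) auto
  with int show "K_functional M W R f \<alpha> \<beta> = (\<integral>\<omega>. D 1 \<omega> * f (Y 1 \<omega>) \<partial>M) - 1/2 * (\<integral>\<omega>. (LINT s:{0..1}|lborel. D s \<omega> * rc s \<omega>) \<partial>M)"
    unfolding K_functional_def Y_def[symmetric] by (simp add: mult.assoc)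
qed

text \<open>For fixed controls the running costs coincide, so an error \<kappa> in the terminal
  function is magnified only by the discount, at most \<open>exp (c ^ 3 / 2)\<close>.\<close>

lemma K_functional_mono:
  assumes f: "f \<in> borel_measurable borel" "\<And>y. \<bar>f y\<bar> \<le> K" and g: "g \<in> borel_measurable borel" "\<And>y. \<bar>g y\<bar> \<le> K"
    and le: "\<And>y. f y \<le> g y + \<kappa>" and "0 \<le> \<kappa>"
  shows "K_functional M W R f \<alpha> \<beta> \<le> K_functional M W R g \<alpha> \<beta> + exp (c ^ 3 / 2) * \<kappa>"
proof -
  have "(\<integral>\<omega>. D 1 \<omega> * f (Y 1 \<omega>) \<partial>M) \<le> (\<integral>\<omega>. D 1 \<omega> * g (Y 1 \<omega>) + exp (c ^ 3 / 2) * \<kappa> \<partial>M)"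
  proof (rule integral_mono)
    fix \<omega> assume "\<omega> \<in> space M"
    have "D 1 \<omega> * f (Y 1 \<omega>) \<le> D 1 \<omega> * (g (Y 1 \<omega>) + \<kappa>)"
      using le D_pos[of 1 \<omega>] by (intro mult_left_mono) auto
    also have "\<dots> \<le> D 1 \<omega> * g (Y 1 \<omega>) + exp (c ^ 3 / 2) * \<kappa>"
      using D_le[of 1 \<omega>] \<open>\<omega> \<in> space M\<close> \<open>0 \<le> \<kappa>\<close> by (simp add: distrib_left mult_right_mono)
    finally show "D 1 \<omega> * f (Y 1 \<omega>) \<le> D 1 \<omega> * g (Y 1 \<omega>) + exp (c ^ 3 / 2) * \<kappa>" .
  qed (use K_functional_eq(1)[OF f] K_functional_eq(1)[OF g] in auto)
  also have "\<dots> = (\<integral>\<omega>. D 1 \<omega> * g (Y 1 \<omega>) \<partial>M) + exp (c ^ 3 / 2) * \<kappa>"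
    using K_functional_eq(1)[OF g] by (simp add: prob_space)
  finally show ?thesis
    unfolding K_functional_eq(2)[OF f] K_functional_eq(2)[OF g] by simp
qed

lemma K_functional_tendsto:
  assumes fn: "\<And>n. fn n \<in> borel_measurable borel" "\<And>n y. \<bar>fn n y\<bar> \<le> K" and f: "f \<in> borel_measurable borel" "\<And>y. \<bar>f y\<bar> \<le> K"
    and lim: "\<And>y. (\<lambda>n. fn n y) \<longlonglongrightarrow> f y"
  shows "(\<lambda>n. K_functional M W R (fn n) \<alpha> \<beta>) \<longlonglongrightarrow> K_functional M W R f \<alpha> \<beta>"
proof -
  have "(\<lambda>n. \<integral>\<omega>. D 1 \<omega> * fn n (Y 1 \<omega>) \<partial>M) \<longlonglongrightarrow> (\<integral>\<omega>. D 1 \<omega> * f (Y 1 \<omega>) \<partial>M)"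
  proof (rule integral_dominated_convergence[where w="\<lambda>_. exp (c ^ 3 / 2) * K"])
    show "AE \<omega> in M. (\<lambda>n. D 1 \<omega> * fn n (Y 1 \<omega>)) \<longlonglongrightarrow> D 1 \<omega> * f (Y 1 \<omega>)"
      by (intro AE_I2 tendsto_intros lim)
    show "AE \<omega> in M. norm (D 1 \<omega> * fn n (Y 1 \<omega>)) \<le> exp (c ^ 3 / 2) * K" for n
      using D_le[of 1] fn(2) by (intro AE_I2) (auto simp: abs_mult abs_of_pos[OF D_pos] intro!: mult_mono)
  qed (use K_functional_eq(1)[OF fn] K_functional_eq(1)[OF f] in auto)
  then show ?thesis
    unfolding K_functional_eq(2)[OF fn] K_functional_eq(2)[OF f] by (intro tendsto_intros)
qed

end

section \<open>Convexity tested on two-valued functions\<close>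

lemma integral_two_valued:
  fixes b :: "'a::euclidean_space" and x y :: real
  assumes "b \<in> Basis"
  shows "(\<integral>(z::'a). (if 0 < z \<bullet> b then x else y) \<partial>std_gaussian) = (x + y) / 2"
proof -
  have "(\<integral>(z::'a). (if 0 < z \<bullet> b then x else y) \<partial>std_gaussian)
    = (\<integral>z. y + (x - y) * indicator {z. 0 < z \<bullet> b} z \<partial>(std_gaussian :: 'a measure))"
    by (intro Bochner_Integration.integral_cong) (auto simp: indicator_def)
  also have "\<dots> = y + (x - y) * measure std_gaussian {z::'a. 0 < z \<bullet> b}"
    by (subst Bochner_Integration.integral_add) (auto intro!: integrable_real_mult_indicator simp: std_gaussian.emeasure_eq_measure)
  finally show ?thesis
    unfolding std_gaussian_halfspace[OF assms] by (simp add: field_simps)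
qed

lemma convex_functional_two_valued:
  fixes F :: "real \<Rightarrow> real"
  assumes "convex_functional_on (measurable_into {a..b} :: ('a::euclidean_space \<Rightarrow> real) set) (gen_mean {a..b} F)"
    and "x \<in> {a..b}" "x' \<in> {a..b}" "y \<in> {a..b}" "y' \<in> {a..b}"
  defines "G \<equiv> inv_into {a..b} F"
  shows "2 * G ((F ((x + x') / 2) + F ((y + y') / 2)) / 2) \<le> G ((F x + F y) / 2) + G ((F x' + F y') / 2)"
proof -
  obtain e :: 'a where e: "e \<in> Basis" using nonempty_Basis by blast
  define tv where "tv p q = (\<lambda>z::'a. if 0 < z \<bullet> e then p else q)" for p q :: real
  have tv: "tv p q \<in> measurable_into {a..b}" if "p \<in> {a..b}" "q \<in> {a..b}" for p q
    using that unfolding tv_def measurable_into_def by auto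
  have mean: "gen_mean {a..b} F (tv p q) = G ((F p + F q) / 2)" for p q
  proof -
    have "(\<lambda>z. F (tv p q z)) = (\<lambda>z. if 0 < z \<bullet> e then F p else F q)" by (auto simp: tv_def)
    then show ?thesis
      unfolding gen_mean_def G_def by (simp add: integral_two_valued[OF e])
  qed
  have "gen_mean {a..b} F (\<lambda>z. 1/2 * tv x y z + 1/2 * tv x' y' z)
      \<le> 1/2 * gen_mean {a..b} F (tv x y) + 1/2 * gen_mean {a..b} F (tv x' y')"
    using assms(1)[unfolded convex_functional_on_def, rule_format, OF tv[OF assms(2,4)] tv[OF assms(3,5)], of "1/2" "1/2"]
    by simp
  moreover have "(\<lambda>z. 1/2 * tv x y z + 1/2 * tv x' y' z) = tv ((x + x') / 2) ((y + y') / 2)"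
    by (auto simp: tv_def)
  ultimately show ?thesis by (simp add: mean)
qed

context convex_two_point_mean
begin

lemma F_lipschitz: obtains L where "0 \<le> L" "\<And>x y. x \<in> {a..b} \<Longrightarrow> y \<in> {a..b} \<Longrightarrow> \<bar>F x - F y\<bar> \<le> L * \<bar>x - y\<bar>"
proof -
  have "bounded (F1 ` {a..b})"
    by (intro compact_imp_bounded compact_continuous_image cont1) auto
  then obtain L where L: "\<And>x. x \<in> {a..b} \<Longrightarrow> \<bar>F1 x\<bar> \<le> L"
    unfolding bounded_iff real_norm_def by (metis imageI)
  have "norm (F x - F y) \<le> L * norm (x - y)" if "x \<in> {a..b}" "y \<in> {a..b}" for x y
    by (rule field_differentiable_bound[OF _ D0 _ that]) (use L in auto)
  moreover have "0 \<le> L" using order_trans[OF abs_ge_zero L[of a]] ab by simp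
  ultimately show ?thesis by (intro that[of L]) auto
qed

lemma hjb_kernel_exists: "\<exists>L. hjb_kernel (F a) (F b) L G G1 G2 (\<lambda>v. - k' (G v)) R"
proof -
  have DG': "(G has_real_derivative G1 v) (at v within {F a..F b})" if "v \<in> {F a..F b}" for v
    unfolding G1_def by (rule DG[OF that])
  have "G ` {F a..F b} \<subseteq> {a..b}" using G_in by blast
  then have contk: "continuous_on {F a..F b} (\<lambda>v. - k' (G v))"
    by (rule continuous_on_minus[OF continuous_on_compose2[OF k'_cont G_cont]])
  have contq: "continuous_on {F a..F b} (\<lambda>v. G2 v / G1 v)"
    by (rule continuous_on_divide[OF G2_cont G1_cont]) (metis G1_pos less_irrefl)
  obtain l0 where l0: "\<And>v. v \<in> {F a..F b} \<Longrightarrow> \<bar>G v\<bar> \<le> l0"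
    using compact_bound[OF G_cont] by blast
  obtain l1 where l1: "\<And>v. v \<in> {F a..F b} \<Longrightarrow> \<bar>G1 v\<bar> \<le> l1"
    using compact_bound[OF G1_cont] by blast
  obtain l2 where l2: "\<And>v. v \<in> {F a..F b} \<Longrightarrow> \<bar>G2 v\<bar> \<le> l2"
    using compact_bound[OF G2_cont] by blast
  obtain l3 where l3: "\<And>v. v \<in> {F a..F b} \<Longrightarrow> \<bar>- k' (G v)\<bar> \<le> l3"
    using compact_bound[OF contk] by blast
  obtain l4 where l4: "\<And>v. v \<in> {F a..F b} \<Longrightarrow> \<bar>G2 v / G1 v\<bar> \<le> l4"
    using compact_bound[OF contq] by blast
  obtain l5 where l5: "\<And>v w. v \<in> {F a..F b} \<Longrightarrow> w \<in> {F a..F b} \<Longrightarrow> \<bar>G v - G w\<bar> \<le> l5 * \<bar>v - w\<bar>"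
    using G_lipschitz by blast
  obtain l6 where l6: "\<And>v w. v \<in> {F a..F b} \<Longrightarrow> w \<in> {F a..F b} \<Longrightarrow> \<bar>G2 v - G2 w\<bar> \<le> l6 * \<bar>v - w\<bar>"
    using G2_lipschitz by blast
  define L where "L = Max {1, l0, l1, l2, l3, l4, l5, l6}"
  have L: "1 \<le> L" "l0 \<le> L" "l1 \<le> L" "l2 \<le> L" "l3 \<le> L" "l4 \<le> L" "l5 \<le> L" "l6 \<le> L"
    unfolding L_def by (rule Max_ge, simp, simp)+
  have lipL: "\<bar>G x - G v\<bar> \<le> L * \<bar>x - v\<bar>" if "v \<in> {F a..F b}" "x \<in> {F a..F b}" for v x
    by (rule order_trans[OF l5[OF that(2,1)] mult_right_mono[OF L(7) abs_ge_zero]])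
  have taylorL: "\<bar>G x - G v - G1 v * (x - v) - G2 v / 2 * (x - v)\<^sup>2\<bar> \<le> L * \<bar>x - v\<bar> ^ 3"
    if "v \<in> {F a..F b}" "x \<in> {F a..F b}" for v x
    by (rule order_trans[OF taylor_second_order_bound[OF DG' DG1 l6 that] mult_right_mono[OF L(8) zero_le_power[OF abs_ge_zero]]])
  have Rge: "\<beta> * G v + (G1 v)\<^sup>2 / (- G2 v) \<le> R \<beta>" if "v \<in> {F a..F b}" for v \<beta>
    using R_ge[OF G_in[OF that], of \<beta>] unfolding k_G[OF that] .
  have Req: "R (- k' (G v)) = - k' (G v) * G v + (G1 v)\<^sup>2 / (- G2 v)" if "v \<in> {F a..F b}" for v
    using R_eq[OF G_in[OF that]] unfolding k_G[OF that] .
  show ?thesis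
    by (rule exI[of _ L], rule hjb_kernel.intro[OF L(1) G_cont G1_cont G2_cont contk R_cont order_trans[OF l0 L(2)]
          order_trans[OF l1 L(3)] order_trans[OF l2 L(4)] order_trans[OF l3 L(5)] order_trans[OF l4 L(6)]
          G1_pos G2_neg lipL taylorL Rge Req])
qed

end

section \<open>Passage to lower-semicontinuous functions\<close>

lemma heat_mono:
  assumes "\<phi> \<in> borel_measurable borel" "\<psi> \<in> borel_measurable borel"
    and "\<And>y. \<bar>\<phi> y\<bar> \<le> B" "\<And>y. \<bar>\<psi> y\<bar> \<le> B" "\<And>y. \<phi> y \<le> \<psi> y"
  shows "heat s \<phi> y \<le> heat s \<psi> y"
  unfolding heat_def using assms
  by (intro integral_mono integrable_std_gaussian_bounded[of _ B] measurable_compose[OF _ assms(1)] measurable_compose[OF _ assms(2)])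
    auto

context convex_two_point_mean
begin

lemma G_mono: "v \<in> {F a..F b} \<Longrightarrow> w \<in> {F a..F b} \<Longrightarrow> v \<le> w \<Longrightarrow> G v \<le> G w"
  using G_less_iff[of w v] by linarith

text \<open>The order of limits differs between the two bounds. From above the controls are fixed:
  first \<epsilon> \<rightarrow> 0 for each \<open>n\<close>, then \<open>n\<close> \<rightarrow>
  \<infinity>. From below \<open>n\<close> comes first and determines \<open>c\<close>, then
  \<epsilon>, and only then the controls.\<close>

lemma representation:
  fixes f :: "'a::euclidean_space \<Rightarrow> real" and W :: "real \<Rightarrow> 'w \<Rightarrow> 'a"
  assumes bm: "std_brownian_motion M Ft W" and lsc: "lower_semicontinuous f" and f_in: "\<And>x. f x \<in> {a..b}"
  shows "ereal (gen_mean {a..b} F f) =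
    (SUP \<alpha>\<in>bounded_controls M Ft. SUP \<beta>\<in>bounded_controls M Ft. ereal (K_functional M W R f \<alpha> \<beta>))"
proof -
  interpret std_brownian_motion M Ft W by (rule bm)
  obtain L where hjb: "hjb_kernel (F a) (F b) L G G1 G2 (\<lambda>v. - k' (G v)) R"
    using hjb_kernel_exists by blast
  have L: "1 \<le> L" and G_lip: "\<And>v x. v \<in> {F a..F b} \<Longrightarrow> x \<in> {F a..F b} \<Longrightarrow> \<bar>G x - G v\<bar> \<le> L * \<bar>x - v\<bar>"
    using hjb_kernel.L_ge_1[OF hjb] hjb_kernel.lipschitz[OF hjb] by blast+
  obtain LF where LF: "0 \<le> LF" "\<And>x y. x \<in> {a..b} \<Longrightarrow> y \<in> {a..b} \<Longrightarrow> \<bar>F x - F y\<bar> \<le> LF * \<bar>x - y\<bar>"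
    using F_lipschitz by blast
  define fn where "fn = inf_convolution f"
  define \<phi> where "\<phi> n y = F (fn n y)" for n y
  define \<Lambda> where "\<Lambda> n = LF * real n" for n
  define m1 where "m1 = gauss_norm_moment TYPE('a) 1"
  \<comment> \<open>The heat modulus at time distance \<epsilon>, passed through the Lipschitz map
    \<open>G\<close>. It measures both the smoothing of \<open>fn n\<close> and the move of the
    terminal time from 1 to \<open>1 + \<epsilon>\<close>.\<close>
  define \<kappa> where "\<kappa> n \<epsilon> = L * (\<Lambda> n * sqrt \<epsilon> * m1)" for n \<epsilon>
  define Kb where "Kb = max \<bar>a\<bar> \<bar>b\<bar>"
  define Bb where "Bb = max \<bar>F a\<bar> \<bar>F b\<bar>"
  define mn where "mn n = G (heat 1 (\<phi> n) 0)" for n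
  have in_bound: "\<bar>u\<bar> \<le> Kb" if "u \<in> {a..b}" for u
    using that unfolding Kb_def by auto
  have in_bound': "\<bar>u\<bar> \<le> Bb" if "u \<in> {F a..F b}" for u
    using that unfolding Bb_def by auto
  have F_in: "F u \<in> {F a..F b}" if "u \<in> {a..b}" for u
    using that F_image by blast
  have fn_in: "fn n y \<in> {a..b}" for n y
    unfolding fn_def by (rule inf_convolution_in[OF f_in])
  have fn_meas: "fn n \<in> borel_measurable borel" for n
    unfolding fn_def by (rule inf_convolution_measurable[OF f_in])
  have f_meas: "f \<in> borel_measurable borel"
    by (rule lower_semicontinuous_measurable[OF f_in lsc])
  have fn_lim: "(\<lambda>n. fn n y) \<longlonglongrightarrow> f y" for y
    unfolding fn_def by (rule inf_convolution_tendsto[OF f_in lsc])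
  have fn_le: "fn n y \<le> f y" for n y
    unfolding fn_def by (rule inf_convolution_le_self[OF f_in])
  have \<phi>_in: "\<phi> n y \<in> {F a..F b}" for n y
    unfolding \<phi>_def by (intro F_in fn_in)
  have \<phi>_lip: "\<bar>\<phi> n x - \<phi> n y\<bar> \<le> \<Lambda> n * norm (x - y)" for n x y
  proof -
    have "\<bar>\<phi> n x - \<phi> n y\<bar> \<le> LF * \<bar>fn n x - fn n y\<bar>"
      unfolding \<phi>_def by (rule LF(2)[OF fn_in fn_in])
    also have "\<dots> \<le> LF * (real n * norm (x - y))"
      unfolding fn_def by (rule mult_left_mono[OF inf_convolution_lipschitz[OF f_in] LF(1)])
    finally show ?thesis by (simp add: \<Lambda>_def)
  qed
  have F_comp_meas: "(\<lambda>y. F (g y)) \<in> borel_measurable borel" if "g \<in> borel_measurable borel" "\<And>y. g y \<in> {a..b}" for g :: "'a \<Rightarrow> real"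
  proof -
    have "F \<in> borel_measurable (restrict_space borel {a..b})"
      by (rule borel_measurable_continuous_on_restrict[OF cont0])
    moreover have "g \<in> borel \<rightarrow>\<^sub>M restrict_space borel {a..b}"
      using that by (intro measurable_restrict_space2) auto
    ultimately show ?thesis by (rule measurable_compose[rotated])
  qed
  have \<phi>_meas: "\<phi> n \<in> borel_measurable borel" for n
    unfolding \<phi>_def[abs_def] by (rule F_comp_meas[OF fn_meas fn_in])
  have Ff_meas: "(\<lambda>y. F (f y)) \<in> borel_measurable borel"
    by (rule F_comp_meas[OF f_meas f_in])
  have \<phi>_bound: "\<bar>\<phi> n y\<bar> \<le> Bb" for n y
    by (rule in_bound'[OF \<phi>_in])
  have heat_in: "heat s (\<phi> n) y \<in> {F a..F b}" for s n y
    by (rule heat_between[OF \<phi>_meas \<phi>_in])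
  have m1: "0 \<le> m1"
    unfolding m1_def gauss_norm_moment_def by (intro Bochner_Integration.integral_nonneg) auto
  have \<Lambda>: "0 \<le> \<Lambda> n" for n using LF(1) by (simp add: \<Lambda>_def)
  have \<kappa>: "0 \<le> \<kappa> n \<epsilon>" if "0 < \<epsilon>" for n \<epsilon>
    using that m1 \<Lambda> L unfolding \<kappa>_def by (intro mult_nonneg_nonneg) auto
  have \<kappa>_lim: "(\<lambda>m. \<kappa> n (1 / real (Suc m))) \<longlonglongrightarrow> 0" for n
  proof -
    have "(\<lambda>m. sqrt (1 / real (Suc m))) \<longlonglongrightarrow> sqrt 0"
      by (intro tendsto_real_sqrt LIMSEQ_Suc[OF lim_1_over_n])
    then have "(\<lambda>m. \<kappa> n (1 / real (Suc m))) \<longlonglongrightarrow> L * (\<Lambda> n * sqrt 0 * m1)"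
      unfolding \<kappa>_def by (rule tendsto_mult_left[OF tendsto_mult_right[OF tendsto_mult_left]])
    then show ?thesis by simp
  qed
  have heat_diff: "\<bar>G (heat s (\<phi> n) y) - G (heat t (\<phi> n) y)\<bar> \<le> \<kappa> n \<epsilon>" if "\<bar>sqrt s - sqrt t\<bar> \<le> sqrt \<epsilon>" for s t n y \<epsilon>
  proof -
    have "\<bar>heat s (\<phi> n) y - heat t (\<phi> n) y\<bar> \<le> \<Lambda> n * \<bar>sqrt s - sqrt t\<bar> * m1"
      using heat_lipschitz_diff[OF \<phi>_lip \<phi>_bound \<phi>_meas, where ?y=y and ?y'=y] unfolding m1_def by simp
    also have "\<dots> \<le> \<Lambda> n * sqrt \<epsilon> * m1"
      using that \<Lambda> m1 by (intro mult_right_mono mult_left_mono) auto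
    finally have "L * \<bar>heat s (\<phi> n) y - heat t (\<phi> n) y\<bar> \<le> \<kappa> n \<epsilon>"
      unfolding \<kappa>_def using L by (intro mult_left_mono) auto
    then show ?thesis
      using G_lip[OF heat_in heat_in] by (rule order_trans[rotated])
  qed
  have heat_0: "G (heat 0 (\<phi> n) y) = fn n y" for n y
    unfolding heat_def by (simp add: \<phi>_def GF[OF fn_in])
  have smooth_close: "\<bar>G (heat \<epsilon> (\<phi> n) y) - fn n y\<bar> \<le> \<kappa> n \<epsilon>" if "0 < \<epsilon>" for n y \<epsilon>
    using heat_diff[of \<epsilon> 0 \<epsilon> n y] that by (simp add: heat_0)
  have value_close: "\<bar>G (heat (1 + \<epsilon>) (\<phi> n) 0) - mn n\<bar> \<le> \<kappa> n \<epsilon>" if "0 < \<epsilon>" for n \<epsilon>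
  proof -
    have "sqrt (1 + \<epsilon>) \<le> sqrt 1 + sqrt \<epsilon>" "sqrt 1 \<le> sqrt (1 + \<epsilon>)"
      using that sqrt_add_le_add_sqrt[of 1 \<epsilon>] by auto
    then have "\<bar>sqrt (1 + \<epsilon>) - sqrt 1\<bar> \<le> sqrt \<epsilon>" by linarith
    then show ?thesis unfolding mn_def by (rule heat_diff)
  qed
  have smooth_meas: "(\<lambda>y. G (heat \<epsilon> (\<phi> n) y)) \<in> borel_measurable borel" if "0 < \<epsilon>" for n \<epsilon>
  proof -
    obtain p where "C11_bound (2 * Bb + 18 * Bb / \<epsilon>) (heat \<epsilon> (\<phi> n)) p"
      using heat_C11[OF \<phi>_meas \<phi>_bound \<open>0 < \<epsilon>\<close>] by blast
    then have "continuous_on UNIV (heat \<epsilon> (\<phi> n))" by (rule C11_bound_continuous(1))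
    then show ?thesis
      by (intro borel_measurable_continuous_onI continuous_on_compose2[OF G_cont]) (use heat_in in blast)+
  qed
  have smooth_bound: "\<bar>G (heat \<epsilon> (\<phi> n) y)\<bar> \<le> Kb" for n \<epsilon> y
    by (rule in_bound[OF G_in[OF heat_in]])
  have bmh: "bm_hjb M Ft W (F a) (F b) L G G1 G2 (\<lambda>v. - k' (G v)) R (\<phi> n) \<epsilon>" if "0 < \<epsilon>" for n \<epsilon>
    by (intro bm_hjb.intro bm hjb bm_hjb_axioms.intro \<phi>_meas \<phi>_in that)
  have ctrl: "controlled_bm M Ft W (F a) (F b) L G G1 G2 (\<lambda>v. - k' (G v)) R (\<phi> n) \<epsilon> \<alpha> \<beta> c"
    if "\<alpha> \<in> bounded_controls M Ft" "\<beta> \<in> bounded_controls M Ft" "0 < \<epsilon>" "1 \<le> c"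
      "\<forall>t\<in>{0..1}. \<forall>\<omega>\<in>space M. norm (\<alpha> t \<omega>) \<le> c \<and> \<bar>\<beta> t \<omega>\<bar> \<le> c" for \<alpha> \<beta> n \<epsilon> c
    by (intro controlled_bm.intro bmh controlled_bm_axioms.intro) (use that in \<open>auto simp: bounded_controls_def\<close>)
  have mean_eq: "gen_mean {a..b} F f = G (heat 1 (\<lambda>y. F (f y)) 0)"
    by (simp add: gen_mean_def heat_def G_def)
  have mn_le: "mn n \<le> gen_mean {a..b} F f" for n
    unfolding mn_def mean_eq
  proof (rule G_mono[OF heat_in])
    show "heat 1 (\<lambda>y. F (f y)) 0 \<in> {F a..F b}"
      by (rule heat_between[OF Ff_meas]) (rule F_in[OF f_in])
    show "heat 1 (\<phi> n) 0 \<le> heat 1 (\<lambda>y. F (f y)) 0"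
      by (rule heat_mono[OF \<phi>_meas Ff_meas \<phi>_bound in_bound'[OF F_in[OF f_in]]])
        (unfold \<phi>_def, rule F_mono[OF fn_in f_in fn_le])
  qed
  have mn_lim: "mn \<longlonglongrightarrow> gen_mean {a..b} F f"
    unfolding mn_def[abs_def] mean_eq
  proof (rule continuous_on_tendsto_compose[OF G_cont])
    show "(\<lambda>n. heat 1 (\<phi> n) 0) \<longlonglongrightarrow> heat 1 (\<lambda>y. F (f y)) 0"
      unfolding heat_def
    proof (rule integral_dominated_convergence[where w="\<lambda>_. Bb"])
      show "AE z in std_gaussian. (\<lambda>n. \<phi> n (0 + sqrt 1 *\<^sub>R z)) \<longlonglongrightarrow> F (f (0 + sqrt 1 *\<^sub>R z))"
        unfolding \<phi>_def
        by (intro AE_I2 continuous_on_tendsto_compose[OF cont0 fn_lim f_in] always_eventually allI fn_in)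
      show "AE z in std_gaussian. norm (\<phi> n (0 + sqrt 1 *\<^sub>R z)) \<le> Bb" for n
        using \<phi>_bound by simp
      show "(\<lambda>z. \<phi> n (0 + sqrt 1 *\<^sub>R z)) \<in> borel_measurable std_gaussian" for n
        using \<phi>_meas by simp
      show "(\<lambda>z. F (f (0 + sqrt 1 *\<^sub>R z))) \<in> borel_measurable std_gaussian"
        using Ff_meas by simp
    qed simp
    show "heat 1 (\<lambda>y. F (f y)) 0 \<in> {F a..F b}"
      by (rule heat_between[OF Ff_meas]) (rule F_in[OF f_in])
  qed (intro always_eventually allI heat_in)
  have upper: "K_functional M W R f \<alpha> \<beta> \<le> gen_mean {a..b} F f"
    if \<alpha>: "\<alpha> \<in> bounded_controls M Ft" and \<beta>: "\<beta> \<in> bounded_controls M Ft" for \<alpha> \<beta>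
  proof -
    obtain C1 C2 where C: "\<forall>t\<in>{0..1}. \<forall>\<omega>\<in>space M. norm (\<alpha> t \<omega>) \<le> C1" "\<forall>t\<in>{0..1}. \<forall>\<omega>\<in>space M. norm (\<beta> t \<omega>) \<le> C2"
      using \<alpha> \<beta> unfolding bounded_controls_def by blast
    define c where "c = max 1 (max C1 C2)"
    have c: "1 \<le> c" "\<forall>t\<in>{0..1}. \<forall>\<omega>\<in>space M. norm (\<alpha> t \<omega>) \<le> c \<and> \<bar>\<beta> t \<omega>\<bar> \<le> c"
      using C unfolding c_def by (auto simp: le_max_iff_disj)
    have "K_functional M W R (fn n) \<alpha> \<beta> \<le> mn n" for n
    proof -
      have "K_functional M W R (fn n) \<alpha> \<beta> \<le> mn n + (1 + exp (c ^ 3 / 2)) * \<kappa> n \<epsilon>" if "0 < \<epsilon>" for \<epsilon>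
      proof -
        have "K_functional M W R (fn n) \<alpha> \<beta> \<le> K_functional M W R (\<lambda>y. G (heat \<epsilon> (\<phi> n) y)) \<alpha> \<beta> + exp (c ^ 3 / 2) * \<kappa> n \<epsilon>"
        proof (rule controlled_bm.K_functional_mono[OF ctrl[OF \<alpha> \<beta> that c] fn_meas in_bound[OF fn_in] smooth_meas[OF that] smooth_bound _ \<kappa>[OF that]])
          show "fn n y \<le> G (heat \<epsilon> (\<phi> n) y) + \<kappa> n \<epsilon>" for y
            using smooth_close[OF that, of n y] by linarith
        qed
        moreover have "K_functional M W R (\<lambda>y. G (heat \<epsilon> (\<phi> n) y)) \<alpha> \<beta> \<le> G (heat (1 + \<epsilon>) (\<phi> n) 0)"
          by (rule bm_hjb.K_functional_le_value[OF bmh[OF that] \<alpha> \<beta>])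
        moreover have "G (heat (1 + \<epsilon>) (\<phi> n) 0) \<le> mn n + \<kappa> n \<epsilon>"
          using value_close[OF that, of n] by linarith
        ultimately show ?thesis by (simp add: distrib_right)
      qed
      then have "K_functional M W R (fn n) \<alpha> \<beta> \<le> mn n + (1 + exp (c ^ 3 / 2)) * \<kappa> n (1 / real (Suc m))" for m
        by simp
      moreover have "(\<lambda>m. mn n + (1 + exp (c ^ 3 / 2)) * \<kappa> n (1 / real (Suc m))) \<longlonglongrightarrow> mn n + (1 + exp (c ^ 3 / 2)) * 0"
        by (intro tendsto_add tendsto_const tendsto_mult_left \<kappa>_lim)
      ultimately show ?thesis
        using LIMSEQ_le_const[of _ "mn n + (1 + exp (c ^ 3 / 2)) * 0" "K_functional M W R (fn n) \<alpha> \<beta>"] by auto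
    qed
    then have "K_functional M W R (fn n) \<alpha> \<beta> \<le> gen_mean {a..b} F f" for n
      using mn_le[of n] by (rule order_trans)
    \<comment> \<open>The locale is entered with \<epsilon> = 1; the two cost functionals compared
      here do not contain \<epsilon>.\<close>
    moreover have "(\<lambda>n. K_functional M W R (fn n) \<alpha> \<beta>) \<longlonglongrightarrow> K_functional M W R f \<alpha> \<beta>"
      by (rule controlled_bm.K_functional_tendsto[OF ctrl[OF \<alpha> \<beta> zero_less_one c] fn_meas in_bound[OF fn_in] f_meas in_bound[OF f_in] fn_lim])
    ultimately show ?thesis
      by (intro LIMSEQ_le_const2) auto
  qed
  have lower: "\<exists>\<alpha>\<in>bounded_controls M Ft. \<exists>\<beta>\<in>bounded_controls M Ft. gen_mean {a..b} F f - \<eta> \<le> K_functional M W R f \<alpha> \<beta>"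
    if "0 < \<eta>" for \<eta>
  proof -
    have "eventually (\<lambda>n. gen_mean {a..b} F f - \<eta> / 3 < mn n) sequentially"
      using \<open>0 < \<eta>\<close> by (intro order_tendstoD(1)[OF mn_lim]) simp
    then obtain n where n: "gen_mean {a..b} F f - \<eta> / 3 < mn n"
      by (auto simp: eventually_sequentially)
    \<comment> \<open>The control bound of \<open>K_functional_ge_value\<close>, with the Lipschitz
      constant of \<open>\<phi> n\<close> bounding the gradient. It is fixed before
      \<epsilon>.\<close>
    define c where "c = 1 + L + L * \<Lambda> n"
    have c: "1 \<le> c" using L \<Lambda>[of n] by (simp add: c_def)
    have "(\<lambda>m. (1 + exp (c ^ 3 / 2)) * \<kappa> n (1 / real (Suc m))) \<longlonglongrightarrow> (1 + exp (c ^ 3 / 2)) * 0"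
      by (intro tendsto_mult_left \<kappa>_lim)
    then have "eventually (\<lambda>m. (1 + exp (c ^ 3 / 2)) * \<kappa> n (1 / real (Suc m)) < \<eta> / 3) sequentially"
      using \<open>0 < \<eta>\<close> by (intro order_tendstoD(2)) auto
    then obtain m where m: "(1 + exp (c ^ 3 / 2)) * \<kappa> n (1 / real (Suc m)) < \<eta> / 3"
      by (auto simp: eventually_sequentially)
    define \<epsilon> where "\<epsilon> = 1 / real (Suc m)"
    have \<epsilon>: "0 < \<epsilon>" by (simp add: \<epsilon>_def)
    obtain \<alpha> \<beta> where \<alpha>: "\<alpha> \<in> bounded_controls M Ft" and \<beta>: "\<beta> \<in> bounded_controls M Ft"
      and le: "\<forall>t\<in>{0..1}. \<forall>\<omega>\<in>space M. norm (\<alpha> t \<omega>) \<le> c \<and> \<bar>\<beta> t \<omega>\<bar> \<le> c"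
      and K: "G (heat (1 + \<epsilon>) (\<phi> n) 0) - \<eta> / 3 \<le> K_functional M W R (\<lambda>y. G (heat \<epsilon> (\<phi> n) y)) \<alpha> \<beta>"
      using bm_hjb.K_functional_ge_value[OF bmh[OF \<epsilon>, of n] bm_hjb.grad_lipschitz_bound[OF bmh[OF \<epsilon>] \<phi>_lip], of "\<eta> / 3"] \<open>0 < \<eta>\<close>
      unfolding c_def by auto
    have "K_functional M W R (\<lambda>y. G (heat \<epsilon> (\<phi> n) y)) \<alpha> \<beta> \<le> K_functional M W R f \<alpha> \<beta> + exp (c ^ 3 / 2) * \<kappa> n \<epsilon>"
    proof (rule controlled_bm.K_functional_mono[OF ctrl[OF \<alpha> \<beta> \<epsilon> c le] smooth_meas[OF \<epsilon>] smooth_bound f_meas in_bound[OF f_in] _ \<kappa>[OF \<epsilon>]])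
      show "G (heat \<epsilon> (\<phi> n) y) \<le> f y + \<kappa> n \<epsilon>" for y
        using smooth_close[OF \<epsilon>, of n y] fn_le[of n y] by linarith
    qed
    moreover have "mn n - \<kappa> n \<epsilon> \<le> G (heat (1 + \<epsilon>) (\<phi> n) 0)"
      using value_close[OF \<epsilon>, of n] by linarith
    moreover have "\<kappa> n \<epsilon> + exp (c ^ 3 / 2) * \<kappa> n \<epsilon> < \<eta> / 3"
      using m by (simp add: distrib_right \<epsilon>_def)
    ultimately have "gen_mean {a..b} F f - \<eta> \<le> K_functional M W R f \<alpha> \<beta>"
      using K n by linarith
    with \<alpha> \<beta> show ?thesis by blast
  qed
  show ?thesis
  proof (rule antisym)
    let ?S = "SUP \<alpha>\<in>bounded_controls M Ft. SUP \<beta>\<in>bounded_controls M Ft. ereal (K_functional M W R f \<alpha> \<beta>)"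
    show "?S \<le> ereal (gen_mean {a..b} F f)"
      by (intro SUP_least) (simp add: upper)
    show "ereal (gen_mean {a..b} F f) \<le> ?S"
    proof (rule ereal_le_epsilon2)
      fix \<eta> :: real assume "0 < \<eta>"
      then obtain \<alpha> \<beta> where \<alpha>: "\<alpha> \<in> bounded_controls M Ft" and \<beta>: "\<beta> \<in> bounded_controls M Ft"
        and K: "gen_mean {a..b} F f - \<eta> \<le> K_functional M W R f \<alpha> \<beta>"
        using lower by blast
      have "ereal (gen_mean {a..b} F f - \<eta>) \<le> ereal (K_functional M W R f \<alpha> \<beta>)"
        using K by simp
      also have "\<dots> \<le> ?S"
        by (rule SUP_upper2[OF \<alpha>], rule SUP_upper[OF \<beta>])
      finally have "ereal (gen_mean {a..b} F f - \<eta>) + ereal \<eta> \<le> ?S + ereal \<eta>"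
        by (rule add_right_mono)
      then show "ereal (gen_mean {a..b} F f) \<le> ?S + ereal \<eta>" by simp
    qed
  qed
qed

end

lemma smooth_on_derivative:
  assumes "smooth_on S F" "x \<in> S"
  shows "((deriv_on S ^^ n) F has_real_derivative (deriv_on S ^^ Suc n) F x) (at x within S)"
proof -
  have "((deriv_on S ^^ n) F) differentiable (at x within S)"
    using assms unfolding smooth_on_def differentiable_on_def by blast
  then show ?thesis
    unfolding vector_derivative_works has_real_derivative_iff_has_vector_derivative by (simp add: deriv_on_def)
qed

theorem theorem5p4:
  fixes a b :: real and F :: "real \<Rightarrow> real"
    and M :: "'w measure" and Ft :: "real \<Rightarrow> 'w measure"
    and W :: "real \<Rightarrow> 'w \<Rightarrow> real ^ 'n"
    and f :: "real ^ 'n \<Rightarrow> real"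
  assumes "a < b"
    and "smooth_on {a..b} F"
    and "strict_mono_on {a..b} F"
    and "\<forall>x\<in>{a..b}. deriv_on {a..b} F x > 0"
    and "\<not> affine_function_on {a..b} F"
    and "convex_functional_on (measurable_into {a..b} :: (real ^ 'n \<Rightarrow> real) set) (gen_mean {a..b} F)"
    and "std_brownian_motion M Ft W"
    and "lower_semicontinuous f"
    and "range f \<subseteq> {a..b}"
  shows "ereal (gen_mean {a..b} F f) =
    (SUP \<alpha>\<in>bounded_controls M Ft. SUP \<beta>\<in>bounded_controls M Ft.
       ereal (K_functional M W (cost_R {a..b} F) f \<alpha> \<beta>))"
proof -
  let ?D = "deriv_on {a..b}"
  have D: "((?D ^^ n) F has_real_derivative (?D ^^ Suc n) F x) (at x within {a..b})" if "x \<in> {a..b}" for n x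
    using smooth_on_derivative[OF assms(2) that] .
  interpret smooth_increasing a b F "?D F" "?D (?D F)" "?D (?D (?D F))"
  proof
    show "continuous_on {a..b} (?D (?D (?D F)))"
      using DERIV_continuous_on[OF D[of _ 3]] by (simp add: numeral_eq_Suc)
  qed (use assms(1,4) D[of _ 0] D[of _ 1] D[of _ 2] in \<open>simp_all add: numeral_eq_Suc\<close>)
  interpret convex_two_point_mean a b F "?D F" "?D (?D F)" "?D (?D (?D F))"
    by unfold_locales (use convex_functional_two_valued[OF assms(6)] assms(5) in \<open>simp_all add: G_def\<close>)
  \<comment> \<open>The Fenchel transform subtracts \<open>- k\<close>, which turns into the
    \<open>+ k\<close> of \<open>R\<close>.\<close>
  have "cost_R {a..b} F = R"
    by (rule ext) (simp add: cost_R_def fenchel_transform_def R_def k_def)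
  then show ?thesis
    using representation[OF assms(7,8)] assms(9) by (simp add: image_subset_iff)
qed

end
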